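(* Let $1<p<\infty$ and let $X=(X,d,\mu)$ be an unbounded metric measure space such that $\mu$ is globally doubling and supports a global $p$-Poincaré inequality. Let $x_0\in X$, write $B_r:=B(x_0,r)$, and let $u$ be a nonconstant quasiharmonic function on $X$. If there is $\alpha>p$ such that $$\limsup_{r\to\infty}\frac{\mu(B_r)}{r^\alpha}>0,$$ then there are a constant $C>0$ and a sequence $r_j\to\infty$ such that $$\int_{B_{r_j}}g_u^p\,d\mu\ge Cr_j^{\alpha-p}\quad\text{for all }j.$$ If moreover $$\liminf_{r\to\infty}\frac{\mu(B_r)}{r^\alpha}>0,$$ then there is a constant $C>0$ such that $$\int_{B_r}g_u^p\,d\mu\ge Cr^{\alpha-p}\quad\text{for all large enough }r.$$
   Context: Throughout, $1<p<\infty$ and $X=(X,d,\mu)$ is a metric space with a positive complete Borel measure $\mu$ such that $0<\mu(B)<\infty$ for all balls $B\subset X$. $X$ need not be complete. Balls are open and come with a prescribed centre and radius $r_B$; $\lambda B$ is the concentric ball with radius $\lambda r_B$. The constants $C$ in the claim may depend on $X$, $\mu$, $p$, $x_0$, $\alpha$ and $u$, but not on $j$ or $r$. Upper gradients. Curves are nonconstant, compact and rectifiable, parameterized by arc length $ds$. A property holds for $p$-almost every curve if for the family $\Gamma$ of curves for which it fails there is a Borel function $0\le\rho\in L^p(X)$ with $\int_\gamma\rho\,ds=\infty$ for all $\gamma\in\Gamma$. A measurable $g:X\to[0,\infty]$ is a $p$-weak upper gradient of $u:X\to[-\infty,\infty]$ if for $p$-almost every curve $\gamma:[0,l_\gamma]\to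 X$, $|u(\gamma(0))-u(\gamma(l_\gamma))|\le\int_\gamma g\,ds$ (left-hand side $\infty$ if a term is $\pm\infty$). If $u$ has a $p$-weak upper gradient in $L^p_{\rm loc}$, then $g_u$ denotes the minimal one (a.e. smallest). For measurable $u$, $\|u\|_{N^{1,p}(X)}^p=\int_X|u|^p\,d\mu+\inf_g\int_Xg^p\,d\mu$, infimum over $p$-weak upper gradients $g$ of $u$, and $N^{1,p}(X)=\{u:\|u\|_{N^{1,p}(X)}<\infty\}$ (functions defined everywhere); $N^{1,p}(E)$ is defined by regarding a measurable set $E$ as a metric measure space in its own right. Doubling and Poincaré. $\mu$ is globally doubling if there is $C>0$ with $\mu(2B)\le C\mu(B)$ for all balls $B$. $\mu$ supports a global $p$-Poincaré inequality if there are $C>0$, $\lambda\ge1$ such that for all balls $B$, all integrable $u$ on $\lambda B$ and all $p$-weak upper gradients $g$ of $u$, $\frac1{\mu(B)}\int_B|u-u_B|\,d\mu\le Cr_B\bigl(\frac1{\mu(\lambda B)}\int_{\lambda B}g^p\,d\mu\bigr)^{1/p}$, where $u_B=\frac1{\mu(B)}\int_Bu\,d\mu$. Quasiharmonic functions on $X$. A function $u$ on $X$ with $u\in N^{1,p}(G)$ for every bounded open $G\subset X$ is a quasiminimizer on $X$ if there is $Q\ge1$ with $\int_{\{\varphi\ne0\}}g_u^p\,d\mu\le Q\int_{\{\varphi\ne0\}}g_{u+\varphi}^p\,d\mu$ for all $\varphi$ in the closure in $N^{1,p}(X)$ of the functions in $N^{1,p}(X)$ vanishing outside some bounded open set (this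 closure is $N^{1,p}(X)$). A continuous (real-valued) quasiminimizer is called quasiharmonic. *)

theory Defs
  imports "HOL-Analysis.Analysis"
begin

text \<open>
  The ambient metric space is the whole of a type of class \<^class>\<open>metric_space\<close>.  The notions
  below that also have to be applied to subsets are defined for a measure \<open>M\<close> whose underlying
  metric space is \<open>space M\<close>; a measurable subset \<open>E\<close>, regarded as a metric measure space in its own
  right, is then \<open>restrict_space M E\<close>, and everything depends only on values on \<open>space M\<close>.
\<close>

text \<open>
  A complete Borel measure is taken to be the completion of a measure on the Borel sets.
\<close>
definition metric_measure :: "'a::metric_space measure \<Rightarrow> bool" where
  "metric_measure \<mu> \<longleftrightarrow>
     (\<exists>\<nu>. sets \<nu> = sets borel \<and> \<mu> = completion \<nu>) \<and>
     (\<forall>x r. 0 < r \<longrightarrow> 0 < emeasure \<mu> (ball x r) \<and> emeasure \<mu> (ball x r) < \<infinity>)"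

text \<open>Used with positive exponents only, so that \<open>0\<close> and \<open>\<infinity>\<close> are mapped to themselves.\<close>
definition ennpow :: "ennreal \<Rightarrow> real \<Rightarrow> ennreal" where
  "ennpow x a = (if x = \<infinity> then \<infinity> else ennreal (enn2real x powr a))"

subsection \<open>Curves and line integrals\<close>

definition curve_length :: "(real \<Rightarrow> 'a::metric_space) \<Rightarrow> real \<Rightarrow> real \<Rightarrow> ennreal" where
  "curve_length \<gamma> a b =
     (SUP (n, t) \<in> {(n::nat, t::nat \<Rightarrow> real). mono_on {..n} t \<and> t ` {..n} \<subseteq> {a..b}}.
        \<Sum>i<n. ennreal (dist (\<gamma> (t i)) (\<gamma> (t (Suc i)))))"

text \<open>
  The pair of \<open>\<gamma>\<close> and \<open>l\<close> represents the curve \<open>\<gamma> : [0,l] \<rightarrow> X\<close>.  Continuity (with Lipschitz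
  constant 1), rectifiability and, since \<open>l > 0\<close>, nonconstancy follow from parameterization by
  arc length.
\<close>
definition arclength_curve :: "'a::metric_space set \<Rightarrow> (real \<Rightarrow> 'a) \<Rightarrow> real \<Rightarrow> bool" where
  "arclength_curve S \<gamma> l \<longleftrightarrow>
     0 < l \<and> \<gamma> ` {0..l} \<subseteq> S \<and>
     (\<forall>s t. 0 \<le> s \<and> s \<le> t \<and> t \<le> l \<longrightarrow> curve_length \<gamma> s t = ennreal (t - s))"

definition line_integral :: "(real \<Rightarrow> 'a) \<Rightarrow> real \<Rightarrow> ('a \<Rightarrow> ennreal) \<Rightarrow> ennreal" where
  "line_integral \<gamma> l g = (\<integral>\<^sup>+t\<in>{0..l}. g (\<gamma> t) \<partial>lebesgue)"

definition p_ae_curve ::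
    "real \<Rightarrow> 'a::metric_space measure \<Rightarrow> ((real \<Rightarrow> 'a) \<Rightarrow> real \<Rightarrow> bool) \<Rightarrow> bool" where
  "p_ae_curve p M P \<longleftrightarrow>
     (\<exists>\<rho> :: 'a \<Rightarrow> ennreal.
        \<rho> \<in> borel_measurable (restrict_space borel (space M)) \<and>
        (\<integral>\<^sup>+x. ennpow (\<rho> x) p \<partial>M) < \<infinity> \<and>
        (\<forall>\<gamma> l. arclength_curve (space M) \<gamma> l \<and> \<not> P \<gamma> l \<longrightarrow> line_integral \<gamma> l \<rho> = \<infinity>))"

subsection \<open>Weak upper gradients and Newtonian spaces\<close>

definition ext_diff :: "ereal \<Rightarrow> ereal \<Rightarrow> ennreal" where
  "ext_diff a b = (if \<bar>a\<bar> = \<infinity> \<or> \<bar>b\<bar> = \<infinity> then \<infinity> else e2ennreal \<bar>a - b\<bar>)"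

text \<open>
  For a completed Borel measure, a measurable \<open>g\<close> coincides a.e. with a Borel function, and
  therefore its line integral along \<open>p\<close>-almost every curve is the integral of a Lebesgue measurable
  function; so measurability along curves need not be required separately.
\<close>
definition weak_upper_gradient ::
    "real \<Rightarrow> 'a::metric_space measure \<Rightarrow> ('a \<Rightarrow> ereal) \<Rightarrow> ('a \<Rightarrow> ennreal) \<Rightarrow> bool" where
  "weak_upper_gradient p M u g \<longleftrightarrow>
     g \<in> borel_measurable M \<and>
     p_ae_curve p M (\<lambda>\<gamma> l. ext_diff (u (\<gamma> 0)) (u (\<gamma> l)) \<le> line_integral \<gamma> l g)"

definition Lp_loc :: "real \<Rightarrow> 'a::metric_space measure \<Rightarrow> ('a \<Rightarrow> ennreal) \<Rightarrow> bool" where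
  "Lp_loc p M g \<longleftrightarrow>
     g \<in> borel_measurable M \<and>
     (\<forall>x\<in>space M. \<exists>r>0. (\<integral>\<^sup>+y\<in>ball x r. ennpow (g y) p \<partial>M) < \<infinity>)"

definition is_minimal_wug ::
    "real \<Rightarrow> 'a::metric_space measure \<Rightarrow> ('a \<Rightarrow> ereal) \<Rightarrow> ('a \<Rightarrow> ennreal) \<Rightarrow> bool" where
  "is_minimal_wug p M u g \<longleftrightarrow>
     weak_upper_gradient p M u g \<and> Lp_loc p M g \<and>
     (\<forall>h. weak_upper_gradient p M u h \<and> Lp_loc p M h \<longrightarrow> (AE x in M. g x \<le> h x))"

text \<open>
  The function \<open>g\<^sub>u\<close>; it is determined up to a.e. equality, and exists whenever \<open>u\<close> has a
  \<open>p\<close>-weak upper gradient in \<open>L\<^sup>p\<^sub>l\<^sub>o\<^sub>c\<close>.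
\<close>
definition minimal_wug ::
    "real \<Rightarrow> 'a::metric_space measure \<Rightarrow> ('a \<Rightarrow> ereal) \<Rightarrow> ('a \<Rightarrow> ennreal)" where
  "minimal_wug p M u = (SOME g. is_minimal_wug p M u g)"

definition newtonian_norm :: "real \<Rightarrow> 'a::metric_space measure \<Rightarrow> ('a \<Rightarrow> ereal) \<Rightarrow> ennreal" where
  "newtonian_norm p M u =
     ennpow ((\<integral>\<^sup>+x. ennpow (e2ennreal \<bar>u x\<bar>) p \<partial>M) +
             (INF g \<in> {g. weak_upper_gradient p M u g}. \<integral>\<^sup>+x. ennpow (g x) p \<partial>M)) (1 / p)"

definition newtonian :: "real \<Rightarrow> 'a::metric_space measure \<Rightarrow> ('a \<Rightarrow> ereal) set" where
  "newtonian p M = {u. u \<in> borel_measurable M \<and> newtonian_norm p M u < \<infinity>}"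

subsection \<open>Doubling and Poincare inequality\<close>

definition globally_doubling :: "'a::metric_space measure \<Rightarrow> bool" where
  "globally_doubling \<mu> \<longleftrightarrow>
     (\<exists>C>0. \<forall>x r. 0 < r \<longrightarrow>
        emeasure \<mu> (ball x (2 * r)) \<le> ennreal C * emeasure \<mu> (ball x r))"

definition avg :: "'a measure \<Rightarrow> 'a set \<Rightarrow> ('a \<Rightarrow> real) \<Rightarrow> real" where
  "avg \<mu> B u = (\<integral>x\<in>B. u x \<partial>\<mu>) / measure \<mu> B"

text \<open>The right-hand side is extended-valued, since \<open>g\<close> need not be in \<open>L\<^sup>p\<close>.\<close>
definition global_Poincare :: "real \<Rightarrow> 'a::metric_space measure \<Rightarrow> bool" where
  "global_Poincare p \<mu> \<longleftrightarrow>
     (\<exists>C>0. \<exists>\<Lambda>\<ge>1. \<forall>x r u g.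
        0 < r \<and> set_integrable \<mu> (ball x (\<Lambda> * r)) u \<and>
        weak_upper_gradient p \<mu> (\<lambda>y. ereal (u y)) g \<longrightarrow>
        ennreal (avg \<mu> (ball x r) (\<lambda>y. \<bar>u y - avg \<mu> (ball x r) u\<bar>))
          \<le> ennreal (C * r) *
             ennpow ((\<integral>\<^sup>+y\<in>ball x (\<Lambda> * r). ennpow (g y) p \<partial>\<mu>)
                       / emeasure \<mu> (ball x (\<Lambda> * r))) (1 / p))"

subsection \<open>Quasiharmonic functions\<close>

definition newtonian_bdd_supp :: "real \<Rightarrow> 'a::metric_space measure \<Rightarrow> ('a \<Rightarrow> ereal) set" where
  "newtonian_bdd_supp p \<mu> =
     {\<psi> \<in> newtonian p \<mu>. \<exists>G. open G \<and> bounded G \<and> (\<forall>x. x \<notin> G \<longrightarrow> \<psi> x = 0)}"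

text \<open>
  Newtonian functions take infinite values only on sets of capacity zero, and changes on such sets
  affect neither the norm nor upper gradients; the convention for \<open>\<infinity> - \<infinity>\<close> is thus immaterial here
  and below.
\<close>
definition newtonian_bdd_supp_closure ::
    "real \<Rightarrow> 'a::metric_space measure \<Rightarrow> ('a \<Rightarrow> ereal) set" where
  "newtonian_bdd_supp_closure p \<mu> =
     {\<phi> \<in> newtonian p \<mu>. \<forall>\<epsilon>>0. \<exists>\<psi>\<in>newtonian_bdd_supp p \<mu>.
        newtonian_norm p \<mu> (\<lambda>x. \<phi> x - \<psi> x) < ennreal \<epsilon>}"

definition quasiminimizer :: "real \<Rightarrow> 'a::metric_space measure \<Rightarrow> ('a \<Rightarrow> ereal) \<Rightarrow> bool" where
  "quasiminimizer p \<mu> u \<longleftrightarrow>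
     (\<forall>G. open G \<and> bounded G \<longrightarrow> u \<in> newtonian p (restrict_space \<mu> G)) \<and>
     (\<exists>Q\<ge>1. \<forall>\<phi>\<in>newtonian_bdd_supp_closure p \<mu>.
        (\<integral>\<^sup>+x\<in>{x. \<phi> x \<noteq> 0}. ennpow (minimal_wug p \<mu> u x) p \<partial>\<mu>)
          \<le> ennreal Q *
             (\<integral>\<^sup>+x\<in>{x. \<phi> x \<noteq> 0}. ennpow (minimal_wug p \<mu> (\<lambda>y. u y + \<phi> y) x) p \<partial>\<mu>))"

definition quasiharmonic :: "real \<Rightarrow> 'a::metric_space measure \<Rightarrow> ('a \<Rightarrow> real) \<Rightarrow> bool" where
  "quasiharmonic p \<mu> u \<longleftrightarrow> continuous_on UNIV u \<and> quasiminimizer p \<mu> (\<lambda>x. ereal (u x))"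

definition energy :: "real \<Rightarrow> 'a::metric_space measure \<Rightarrow> ('a \<Rightarrow> real) \<Rightarrow> 'a set \<Rightarrow> ennreal" where
  "energy p \<mu> u A = (\<integral>\<^sup>+x\<in>A. ennpow (minimal_wug p \<mu> (\<lambda>y. ereal (u y)) x) p \<partial>\<mu>)"

end

theory Submission
  imports Defs
begin

text \<open>
  Both claims follow from one inequality: for a nonconstant quasiharmonic \<open>u\<close> there is \<open>c > 0\<close> such
  that the energy of \<open>u\<close> on \<open>B\<^sub>R\<close> is at least \<open>c \<mu>(B\<^sub>R) / R\<^sup>p\<close> for all large \<open>R\<close>
  (\<open>energy_lower_bound\<close>).  A positive lower or upper limit of \<open>\<mu>(B\<^sub>R) / R\<^sup>\<alpha>\<close> bounds \<open>\<mu>(B\<^sub>R)\<close> from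
  below by \<open>L R\<^sup>\<alpha>\<close>, for all large radii or along a sequence of radii.

  The inequality plays two facts about the oscillation of \<open>u\<close> on \<open>B\<^sub>r\<close> against each other.  It is
  bounded away from \<open>0\<close> as soon as \<open>B\<^sub>r\<close> contains two points at which \<open>u\<close> differs.  On the other
  hand, a quasiminimizer satisfies \<open>sup\<close>-bounds on \<open>B\<^sub>r\<close> in terms of the mean of \<open>|u - a|\<^sup>p\<close> over
  \<open>B\<^sub>2\<^sub>r\<close> (\<open>local_boundedness\<close>), and for the mean value \<open>a\<close> of \<open>u\<close> a Poincare inequality
  (\<open>Lp_Poincare\<close>) bounds that mean by \<open>C r\<^sup>p\<close> times the mean of \<open>g\<^sub>u\<^sup>p\<close> over a larger ball.  Hence
  the mean of \<open>g\<^sub>u\<^sup>p\<close> cannot be much smaller than \<open>r\<^sup>-\<^sup>p\<close>.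

  The bound for the supremum is De Giorgi's.  The Caccioppoli inequality (\<open>Caccioppoli\<close>) controls
  the energy of \<open>u\<close> above a level \<open>k\<close> by the \<open>L\<^sup>p\<close> norm of \<open>(u - k)\<^sub>+\<close>.  Conversely, this norm has to
  be controlled by the energy, with a gain when the set \<open>{u > k}\<close> has small measure.  In Euclidean
  space the gain is due to Sobolev's inequality.  Here it is obtained directly: telescoping along
  balls that shrink to a point \<open>x\<close> bounds \<open>|v(x) - v\<^sub>B|\<^sup>p\<close> by a dyadic potential of the energy
  density (\<open>telescoping\<close>), and the integral of such a potential over a set \<open>A\<close> contains a factor
  \<open>\<mu>(A)\<^sup>\<theta>\<close> with \<open>\<theta> > 0\<close> (\<open>integral_energy_potential_le\<close>).

  These estimates rest on a calculus of weak upper gradients, which includes the existence of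
  minimal ones (\<open>ex_minimal_wug\<close>).  It is derived from facts about a real function on an interval
  whose increments are controlled by the integral of another function, without any differentiation
  along curves.
\<close>

section \<open>Powers of extended nonnegative numbers\<close>

lemma ennpow_ennreal: "0 \<le> x \<Longrightarrow> ennpow (ennreal x) a = ennreal (x powr a)"
  by (simp add: ennpow_def)

lemma ennpow_0 [simp]: "ennpow 0 a = 0"
  by (simp add: ennpow_def)

lemma ennpow_top [simp]: "ennpow top a = top"
  by (simp add: ennpow_def)

lemma ennpow_mono: "0 < a \<Longrightarrow> x \<le> y \<Longrightarrow> ennpow x a \<le> ennpow y a"
  by (cases x; cases y) (auto simp: ennpow_ennreal top_unique intro!: ennreal_leI powr_mono2)

lemma ennpow_mult: "0 < a \<Longrightarrow> ennpow (x * y) a = ennpow x a * ennpow y a"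
  by (cases x; cases y)
     (auto simp: ennpow_ennreal ennreal_mult[symmetric] powr_mult ennreal_mult_top
       ennreal_top_mult)

lemma ennpow_root: "0 < a \<Longrightarrow> ennpow (ennpow x a) (1 / a) = x"
  by (cases x) (auto simp: ennpow_ennreal powr_powr)

lemma ennpow_root': "0 < a \<Longrightarrow> ennpow (ennpow x (1 / a)) a = x"
  using ennpow_root[of "1 / a" x] by simp

lemma ennpow_less_top: "ennpow x a < top \<longleftrightarrow> x < top"
  by (cases x) (auto simp: ennpow_ennreal)

lemma ennpow_add_le:
  assumes "0 < a"
  shows "ennpow (x + y) a \<le> ennreal (2 powr a) * (ennpow x a + ennpow y a)"
proof -
  have "x + y \<le> 2 * max x y"
    by (metis add_mono max.cobounded1 max.cobounded2 mult_2)
  then have "ennpow (x + y) a \<le> ennpow (2 * max x y) a"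
    using assms by (intro ennpow_mono)
  also have "\<dots> = ennreal (2 powr a) * ennpow (max x y) a"
    using assms ennpow_ennreal[of 2 a] by (simp add: ennpow_mult)
  also have "\<dots> \<le> ennreal (2 powr a) * (ennpow x a + ennpow y a)"
    by (intro mult_left_mono) (auto simp: max_def)
  finally show ?thesis .
qed

text \<open>
  For countable families, the supremum replaces the sum, so that Minkowski's inequality can be
  avoided.
\<close>
lemma ennpow_SUP_le:
  fixes f :: "nat \<Rightarrow> ennreal"
  assumes "0 < a"
  shows "ennpow (SUP n. f n) a \<le> (\<Sum>n. ennpow (f n) a)"
proof -
  let ?S = "\<Sum>n. ennpow (f n) a"
  have "f n \<le> ennpow ?S (1 / a)" for n
  proof -
    have "ennpow (f n) a \<le> ?S"
      using sum_le_suminf[of "\<lambda>n. ennpow (f n) a" "{n}"] by simp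
    then have "ennpow (ennpow (f n) a) (1 / a) \<le> ennpow ?S (1 / a)"
      using assms by (intro ennpow_mono) auto
    then show ?thesis
      using assms by (simp add: ennpow_root)
  qed
  then have "ennpow (SUP n. f n) a \<le> ennpow (ennpow ?S (1 / a)) a"
    using assms by (intro ennpow_mono SUP_least) auto
  then show ?thesis
    using assms by (simp add: ennpow_root')
qed

text \<open>
  Each \<open>a\<^sub>j\<close> is at most \<open>\<sigma>\<^sup>j\<close> times the supremum \<open>S\<close> of all \<open>\<sigma>\<^sup>-\<^sup>i a\<^sub>i\<close>, so the sum is at most
  \<open>S / (1 - \<sigma>)\<close>.
\<close>
lemma ennpow_suminf_le:
  fixes a :: "nat \<Rightarrow> ennreal"
  assumes p: "0 < p" and \<sigma>: "0 < \<sigma>" "\<sigma> < 1"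
  shows "ennpow (\<Sum>j. a j) p \<le> ennreal ((1 / (1 - \<sigma>)) powr p) * (\<Sum>j. ennreal (((1 / \<sigma>) ^ j) powr p) * ennpow (a j) p)"
proof -
  define b where "b j = ennreal ((1 / \<sigma>) ^ j) * a j" for j
  define S where "S = (SUP j. b j)"
  have a_le: "a j \<le> ennreal (\<sigma> ^ j) * S" for j
  proof -
    have "ennreal (\<sigma> ^ j) * ennreal ((1 / \<sigma>) ^ j) = ennreal (\<sigma> ^ j * (1 / \<sigma>) ^ j)"
      using \<sigma> by (intro ennreal_mult[symmetric]) auto
    also have "\<sigma> ^ j * (1 / \<sigma>) ^ j = 1" using \<sigma> by (simp add: power_mult_distrib[symmetric])
    finally have "a j = ennreal (\<sigma> ^ j) * b j" by (simp add: b_def mult.assoc[symmetric])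
    also have "\<dots> \<le> ennreal (\<sigma> ^ j) * S" unfolding S_def by (intro mult_left_mono SUP_upper) auto
    finally show ?thesis .
  qed
  have "(\<Sum>j. a j) \<le> (\<Sum>j. ennreal (\<sigma> ^ j) * S)" by (intro suminf_le a_le) auto
  also have "\<dots> = (\<Sum>j. ennreal (\<sigma> ^ j)) * S" by simp
  also have "(\<Sum>j. ennreal (\<sigma> ^ j)) = ennreal (1 / (1 - \<sigma>))"
    using \<sigma> by (subst suminf_ennreal2) (auto simp: summable_geometric suminf_geometric)
  finally have "ennpow (\<Sum>j. a j) p \<le> ennpow (ennreal (1 / (1 - \<sigma>)) * S) p"
    using p by (intro ennpow_mono)
  also have "\<dots> = ennreal ((1 / (1 - \<sigma>)) powr p) * ennpow S p"
    using p \<sigma> by (simp add: ennpow_mult ennpow_ennreal)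
  also have "\<dots> \<le> ennreal ((1 / (1 - \<sigma>)) powr p) * (\<Sum>j. ennpow (b j) p)"
    unfolding S_def by (intro mult_left_mono ennpow_SUP_le p) auto
  also have "(\<lambda>j. ennpow (b j) p) = (\<lambda>j. ennreal (((1 / \<sigma>) ^ j) powr p) * ennpow (a j) p)"
    using p \<sigma> by (intro ext) (simp add: b_def ennpow_mult ennpow_ennreal)
  finally show ?thesis .
qed

lemma ennpow_measurable [measurable]: "(\<lambda>x. ennpow x a) \<in> borel_measurable borel"
  unfolding ennpow_def by measurable

lemma ennreal_inverse_antimono: "a \<le> b \<Longrightarrow> inverse b \<le> inverse (a::ennreal)"
proof (cases a; cases b)
  fix r s assume *: "a \<le> b" "0 \<le> r" "a = ennreal r" "0 \<le> s" "b = ennreal s"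
  show ?thesis
  proof (cases "r = 0")
    case False
    then show ?thesis using * by (simp add: inverse_ennreal le_imp_inverse_le ennreal_leI)
  qed (use * in simp)
qed (auto simp: top_unique)

lemma ennreal_inverse_inj: "inverse a = inverse (b::ennreal) \<Longrightarrow> a = b"
proof (cases a; cases b)
  fix r s assume *: "inverse a = inverse b" "0 \<le> r" "a = ennreal r" "0 \<le> s" "b = ennreal s"
  show ?thesis
  proof (cases "r = 0 \<or> s = 0")
    case True
    then show ?thesis using * by (metis ennreal_0 ennreal_inverse_eq_top_iff)
  next
    case False
    then show ?thesis using * by (simp add: inverse_ennreal)
  qed
qed auto

section \<open>Functions on an interval whose increments are controlled by an integral\<close>

abbreviation segint :: "real \<Rightarrow> real \<Rightarrow> real \<Rightarrow> (real \<Rightarrow> ennreal) \<Rightarrow> ennreal" where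
  "segint l a b G \<equiv> (\<integral>\<^sup>+t\<in>{a..b}. G t \<partial>lebesgue_on {0..l})"

text \<open>
  For \<open>F = u \<circ> \<gamma>\<close> and \<open>G = g \<circ> \<gamma>\<close> this is the upper gradient inequality on all subcurves of \<open>\<gamma>\<close>.
  Requiring it on all subintervals makes the property local.
\<close>
definition controls :: "real \<Rightarrow> (real \<Rightarrow> real) \<Rightarrow> (real \<Rightarrow> ennreal) \<Rightarrow> bool" where
  "controls l F G \<longleftrightarrow> (\<forall>a b. 0 \<le> a \<and> a \<le> b \<and> b \<le> l \<longrightarrow>
     ennreal \<bar>F a - F b\<bar> \<le> segint l a b G)"

lemma controlsD:
  "controls l F G \<Longrightarrow> 0 \<le> a \<Longrightarrow> a \<le> b \<Longrightarrow> b \<le> l \<Longrightarrow>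
     ennreal \<bar>F a - F b\<bar> \<le> segint l a b G"
  by (auto simp: controls_def)

lemma indicator_measurable_lebesgue_on [measurable]:
  "A \<in> sets lebesgue \<Longrightarrow> (indicator A :: real \<Rightarrow> ennreal) \<in> borel_measurable (lebesgue_on {0..l::real})"
  by (rule measurable_restrict_space1) auto

lemma ident_measurable_lebesgue_on [measurable]:
  "A \<in> sets lebesgue \<Longrightarrow> Measurable.pred (lebesgue_on {0..l::real}) (\<lambda>t. t \<in> A)"
  by (rule measurable_restrict_space1) auto

lemma times_indicator_measurable_lebesgue_on [measurable, simp]:
  fixes G :: "real \<Rightarrow> ennreal"
  assumes [measurable]: "G \<in> borel_measurable (lebesgue_on {0..l})"
  shows "(\<lambda>t. G t * indicator {a..b} t) \<in> borel_measurable (lebesgue_on {0..l})"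
proof -
  have [measurable]: "(indicator {a..b} :: real \<Rightarrow> ennreal) \<in> borel_measurable (lebesgue_on {0..l})"
    by (rule indicator_measurable_lebesgue_on) auto
  show ?thesis by measurable
qed

lemma if_measurable_lebesgue_on:
  fixes G :: "real \<Rightarrow> ennreal"
  assumes "G \<in> borel_measurable (lebesgue_on {0..l})" "K \<in> borel_measurable (lebesgue_on {0..l})"
    and "A \<in> sets lebesgue"
  shows "(\<lambda>t. if t \<in> A then G t else K t) \<in> borel_measurable (lebesgue_on {0..l})"
  using assms ident_measurable_lebesgue_on[OF assms(3), of l]
  by (intro measurable_If) (auto simp: pred_def)

lemma AE_lebesgue_on:
  assumes "A \<in> null_sets lebesgue"
  shows "AE t in lebesgue_on {0..l::real}. t \<notin> A"
proof -
  have "AE t in lebesgue. t \<notin> A" using assms by (rule AE_not_in)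
  moreover have "{0..l} \<inter> space lebesgue \<in> sets lebesgue" by simp
  ultimately show ?thesis
    by (subst AE_restrict_space_iff) auto
qed

lemma AE_lebesgue_on_finite: "finite A \<Longrightarrow> AE t in lebesgue_on {0..l::real}. t \<notin> A"
  by (intro AE_lebesgue_on) (simp add: finite_imp_null_set_lborel null_sets_completionI)

lemma ennreal_abs_triangle: "ennreal \<bar>a - c\<bar> \<le> ennreal \<bar>a - b\<bar> + ennreal \<bar>b - c\<bar>"
proof -
  have "ennreal \<bar>a - c\<bar> \<le> ennreal (\<bar>a - b\<bar> + \<bar>b - c\<bar>)" by (rule ennreal_leI) simp
  then show ?thesis by simp
qed

lemma nn_integral_interval_split:
  fixes a b c :: real
  assumes [measurable]: "G \<in> borel_measurable (lebesgue_on {0..l})" and "a \<le> b" "b \<le> c"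
  shows "segint l a c G =
     segint l a b G + segint l b c G"
proof -
  have "AE t in lebesgue_on {0..l}. t \<notin> {b}"
    by (rule AE_lebesgue_on_finite) simp
  then have "segint l a c G =
    (\<integral>\<^sup>+t. G t * indicator {a..b} t + G t * indicator {b..c} t \<partial>lebesgue_on {0..l})"
    by (intro nn_integral_cong_AE, eventually_elim)
       (use assms in \<open>auto split: split_indicator\<close>)
  also have "\<dots> = segint l a b G + segint l b c G"
    by (intro nn_integral_add) auto
  finally show ?thesis .
qed

lemma controls_mono:
  assumes "controls l F G" and "AE t in lebesgue_on {0..l}. G t \<le> H t"
  shows "controls l F H"
  unfolding controls_def
proof (intro allI impI)
  fix a b assume ab: "0 \<le> a \<and> a \<le> b \<and> b \<le> l"
  have "ennreal \<bar>F a - F b\<bar> \<le> segint l a b G"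
    using controlsD[OF assms(1)] ab by auto
  also have "\<dots> \<le> segint l a b H"
    using assms(2) by (intro nn_integral_mono_AE) (auto elim!: eventually_mono split: split_indicator)
  finally show "ennreal \<bar>F a - F b\<bar> \<le> segint l a b H" .
qed

lemma controls_contraction:
  assumes "controls l F G"
    and "\<And>a b. 0 \<le> a \<Longrightarrow> a \<le> b \<Longrightarrow> b \<le> l \<Longrightarrow> \<bar>F' a - F' b\<bar> \<le> \<bar>F a - F b\<bar>"
  shows "controls l F' G"
  unfolding controls_def
proof (intro allI impI)
  fix a b assume ab: "0 \<le> a \<and> a \<le> b \<and> b \<le> l"
  have "ennreal \<bar>F' a - F' b\<bar> \<le> ennreal \<bar>F a - F b\<bar>"
    using assms(2) ab by (intro ennreal_leI) auto
  also have "\<dots> \<le> segint l a b G"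
    using controlsD[OF assms(1)] ab by auto
  finally show "ennreal \<bar>F' a - F' b\<bar> \<le> segint l a b G" .
qed

lemma controls_add:
  assumes "controls l F G" "controls l F' G'"
    and [measurable]: "G \<in> borel_measurable (lebesgue_on {0..l})" "G' \<in> borel_measurable (lebesgue_on {0..l})"
  shows "controls l (\<lambda>t. F t + F' t) (\<lambda>t. G t + G' t)"
  unfolding controls_def
proof (intro allI impI)
  fix a b assume ab: "0 \<le> a \<and> a \<le> b \<and> b \<le> l"
  have "ennreal \<bar>F a + F' a - (F b + F' b)\<bar> \<le> ennreal \<bar>F a - F b\<bar> + ennreal \<bar>F' a - F' b\<bar>"
    using ennreal_abs_triangle[of "F a + F' a" "F b + F' b" "F b + F' a"] by simp
  also have "\<dots> \<le> segint l a b G + segint l a b G'"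
    using controlsD[OF assms(1)] controlsD[OF assms(2)] ab by (intro add_mono) auto
  also have "\<dots> = segint l a b (\<lambda>t. G t + G' t)"
    using assms(3,4) by (subst nn_integral_add[symmetric]) (simp_all add: distrib_right)
  finally show "ennreal \<bar>F a + F' a - (F b + F' b)\<bar> \<le> segint l a b (\<lambda>t. G t + G' t)" .
qed

text \<open>
  The inequality is inherited when adjacent intervals are joined, so compactness of \<open>[0, l]\<close> passes
  from short intervals to all.
\<close>
lemma controls_local:
  assumes [measurable]: "G \<in> borel_measurable (lebesgue_on {0..l})"
    and local: "\<And>x. 0 \<le> x \<Longrightarrow> x \<le> l \<Longrightarrow> \<exists>d>0. \<forall>a b. 0 \<le> a \<and> a \<le> x \<and> x \<le> b \<and> b \<le> l \<and> b - a < d \<longrightarrow>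
      ennreal \<bar>F a - F b\<bar> \<le> segint l a b G"
  shows "controls l F G"
  unfolding controls_def
proof (intro allI impI)
  fix a b :: real assume ab: "0 \<le> a \<and> a \<le> b \<and> b \<le> l"
  define P where "P a b \<longleftrightarrow> (0 \<le> a \<longrightarrow> b \<le> l \<longrightarrow>
    ennreal \<bar>F a - F b\<bar> \<le> segint l a b G)" for a b
  have "a \<le> b" using ab by auto
  then have "P a b"
  proof (induction rule: Bolzano)
    case (trans a b c)
    show ?case unfolding P_def
    proof (intro impI)
      assume c: "0 \<le> a" "c \<le> l"
      have "ennreal \<bar>F a - F c\<bar> \<le> ennreal \<bar>F a - F b\<bar> + ennreal \<bar>F b - F c\<bar>"
        by (rule ennreal_abs_triangle)
      also have "\<dots> \<le> segint l a b G + segint l b c G"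
        using trans c unfolding P_def by (intro add_mono) auto
      also have "\<dots> = segint l a c G"
        using trans by (intro nn_integral_interval_split[symmetric]) auto
      finally show "ennreal \<bar>F a - F c\<bar> \<le> segint l a c G" .
    qed
  next
    case (local x)
    then have "0 \<le> x" "x \<le> l" using ab by auto
    from assms(2)[OF this] show ?case
      unfolding P_def by meson
  qed
  then show "ennreal \<bar>F a - F b\<bar> \<le> segint l a b G"
    using ab by (auto simp: P_def)
qed

text \<open>
  The increment of \<open>F\<close> over \<open>[a, b]\<close> is not changed by removing everything between the first and the
  last zero, and \<open>F\<close> has no zeros inside the two remaining intervals.  This is the source of all
  locality properties of weak upper gradients below.
\<close>
lemma controls_nonzero:
  assumes G[measurable]: "G \<in> borel_measurable (lebesgue_on {0..l})"
    and F: "controls l F G" and cont: "continuous_on {0..l} F"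
  shows "controls l F (\<lambda>t. if F t = 0 then 0 else G t)"
  unfolding controls_def
proof (intro allI impI)
  fix a b :: real assume ab: "0 \<le> a \<and> a \<le> b \<and> b \<le> l"
  let ?H = "\<lambda>t. if F t = 0 then 0 else G t"
  let ?Z = "{t\<in>{a..b}. F t = 0}"
  have Fm: "F \<in> borel_measurable (lebesgue_on {0..l})"
    by (rule continuous_imp_measurable_on_sets_lebesgue[OF cont]) auto
  note [measurable] = Fm
  have Hm[measurable]: "?H \<in> borel_measurable (lebesgue_on {0..l})" by measurable
  have nz: "ennreal \<bar>F c - F d\<bar> \<le> segint l c d ?H"
    if "a \<le> c" "c \<le> d" "d \<le> b" "\<And>t. t \<in> {c<..<d} \<Longrightarrow> F t \<noteq> 0" for c d
  proof -
    have "AE t in lebesgue_on {0..l}. t \<notin> {c,d}"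
      by (rule AE_lebesgue_on_finite) simp
    then have "segint l c d G = segint l c d ?H"
    proof (intro nn_integral_cong_AE, eventually_elim)
      case (elim t)
      show ?case
      proof (cases "t \<in> {c..d}")
        case True
        then have "F t \<noteq> 0" using elim that(4)[of t] by auto
        then show ?thesis by simp
      qed auto
    qed
    then show ?thesis
      using controlsD[OF F, of c d] that(1-3) ab by auto
  qed
  show "ennreal \<bar>F a - F b\<bar> \<le> segint l a b ?H"
  proof (cases "?Z = {}")
    case True
    then show ?thesis using nz[of a b] ab by fastforce
  next
    case False
    have "continuous_on {a..b} F"
      using cont ab by (auto intro: continuous_on_subset)
    then have "closed ?Z"
      by (intro continuous_closed_preimage_constant) auto
    moreover have "{a..b} \<inter> ?Z = ?Z" by auto
    ultimately have cZ: "compact ?Z"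
      using compact_Int_closed[of "{a..b}" ?Z] by (metis compact_Icc)
    obtain s where s: "s \<in> ?Z" "\<And>t. t \<in> ?Z \<Longrightarrow> s \<le> t"
      using compact_attains_inf[OF cZ False] by blast
    obtain r where r: "r \<in> ?Z" "\<And>t. t \<in> ?Z \<Longrightarrow> t \<le> r"
      using compact_attains_sup[OF cZ False] by blast
    have sr: "s \<le> r" using s r by auto
    have "ennreal \<bar>F a - F b\<bar> \<le> ennreal \<bar>F a - F s\<bar> + ennreal \<bar>F r - F b\<bar>"
      using s(1) r(1) ennreal_abs_triangle[of "F a" "F b" 0] by simp
    also have "\<dots> \<le> segint l a s ?H + segint l r b ?H"
    proof (intro add_mono nz)
      show "F t \<noteq> 0" if "t \<in> {a<..<s}" for t using s(2)[of t] s(1) that by force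
      show "F t \<noteq> 0" if "t \<in> {r<..<b}" for t using r(2)[of t] r(1) that by force
    qed (use s r in auto)
    also have "\<dots> \<le> segint l a s ?H + segint l s b ?H"
      using sr by (intro add_mono order_refl nn_integral_mono) (auto split: split_indicator)
    also have "\<dots> = segint l a b ?H"
      using s by (intro nn_integral_interval_split[symmetric]) auto
    finally show ?thesis .
  qed
qed

lemma controls_glue_interval:
  assumes [measurable]: "G \<in> borel_measurable (lebesgue_on {0..l})" "K \<in> borel_measurable (lebesgue_on {0..l})"
    and G: "controls l F G" and K: "controls l F K"
  shows "controls l F (\<lambda>t. if t \<in> {c..d} then G t else K t)" (is "controls l F ?H")
proof -
  have [measurable]: "?H \<in> borel_measurable (lebesgue_on {0..l})"
    by (intro if_measurable_lebesgue_on assms) auto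
  note Hm = this
  have inside: "ennreal \<bar>F a - F b\<bar> \<le> segint l a b ?H"
    if "0 \<le> a" "a \<le> b" "b \<le> l" "c \<le> a" "b \<le> d" for a b
  proof -
    have "segint l a b ?H = segint l a b G"
      using that by (intro nn_integral_cong) (auto split: split_indicator)
    then show ?thesis using controlsD[OF G that(1-3)] by simp
  qed
  have outside: "ennreal \<bar>F a - F b\<bar> \<le> segint l a b ?H"
    if "0 \<le> a" "a \<le> b" "b \<le> l" "b \<le> c \<or> d \<le> a" for a b
  proof -
    have "AE t in lebesgue_on {0..l}. t \<notin> {c,d}"
      by (rule AE_lebesgue_on_finite) simp
    then have "segint l a b K = segint l a b ?H"
      by (intro nn_integral_cong_AE, eventually_elim) (use that in \<open>auto split: split_indicator\<close>)
    then show ?thesis using controlsD[OF K that(1-3)] by simp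
  qed
  show ?thesis
  proof (rule controls_local)
    fix x :: real assume x: "0 \<le> x" "x \<le> l"
    
    have two: "ennreal \<bar>F a - F b\<bar> \<le> segint l a b ?H"
      if "ennreal \<bar>F a - F x\<bar> \<le> segint l a x ?H"
        "ennreal \<bar>F x - F b\<bar> \<le> segint l x b ?H" "a \<le> x" "x \<le> b" for a b
    proof -
      have "ennreal \<bar>F a - F b\<bar> \<le> ennreal \<bar>F a - F x\<bar> + ennreal \<bar>F x - F b\<bar>"
        by (rule ennreal_abs_triangle)
      also have "\<dots> \<le> segint l a b ?H"
        using that nn_integral_interval_split[OF Hm, of a x b] by (simp only: add_mono)
      finally show ?thesis .
    qed
    \<comment> \<open>An interval around \<open>x\<close> of length less than \<open>e\<close> contains neither \<open>c\<close> nor \<open>d\<close>, unless they equal \<open>x\<close>.\<close>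
    define e where "e = Min ((\<lambda>y. if y = x then 1 else \<bar>y - x\<bar>) ` {c, d})"
    have e: "e > 0" "c \<noteq> x \<Longrightarrow> e \<le> \<bar>c - x\<bar>" "d \<noteq> x \<Longrightarrow> e \<le> \<bar>d - x\<bar>"
      by (auto simp: e_def)
    show "\<exists>e>0. \<forall>a b. 0 \<le> a \<and> a \<le> x \<and> x \<le> b \<and> b \<le> l \<and> b - a < e \<longrightarrow>
      ennreal \<bar>F a - F b\<bar> \<le> segint l a b ?H"
    proof (intro exI[of _ e] conjI allI impI)
      fix a b assume ab: "0 \<le> a \<and> a \<le> x \<and> x \<le> b \<and> b \<le> l \<and> b - a < e"
      have 1: "(c \<le> a \<and> x \<le> d) \<or> (x \<le> c \<or> d \<le> a)" using ab e by (smt (verit))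
      have 2: "(c \<le> x \<and> b \<le> d) \<or> (b \<le> c \<or> d \<le> x)" using ab e by (smt (verit))
      show "ennreal \<bar>F a - F b\<bar> \<le> segint l a b ?H"
      proof (rule two)
        show "ennreal \<bar>F a - F x\<bar> \<le> segint l a x ?H"
          using 1 inside[of a x] outside[of a x] ab x by blast
        show "ennreal \<bar>F x - F b\<bar> \<le> segint l x b ?H"
          using 2 inside[of x b] outside[of x b] ab x by blast
      qed (use ab in auto)
    qed (use e in auto)
  qed (rule Hm)
qed

text \<open>
  Used to pass from finite unions of intervals to measurable sets.
\<close>
lemma controls_lim:
  assumes [measurable]: "\<And>n. K n \<in> borel_measurable (lebesgue_on {0..l})"
      "H \<in> borel_measurable (lebesgue_on {0..l})" "W \<in> borel_measurable (lebesgue_on {0..l})"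
    and K: "\<And>n::nat. controls l F (K n)"
    and W: "(\<integral>\<^sup>+t. W t \<partial>lebesgue_on {0..l}) < \<infinity>"
    and le: "\<And>n. AE t in lebesgue_on {0..l}. K n t \<le> W t"
    and lim: "AE t in lebesgue_on {0..l}. (\<lambda>n. K n t) \<longlonglongrightarrow> H t"
  shows "controls l F H"
  unfolding controls_def
proof (intro allI impI)
  fix a b assume ab: "0 \<le> a \<and> a \<le> b \<and> b \<le> l"
  have "(\<lambda>n. \<integral>\<^sup>+t\<in>{a..b}. K n t \<partial>lebesgue_on {0..l}) \<longlonglongrightarrow> segint l a b H"
  proof (rule nn_integral_dominated_convergence[where w=W])
    show "AE t in lebesgue_on {0..l}. K n t * indicator {a..b} t \<le> W t" for n
      using le[of n] by (auto elim!: eventually_mono split: split_indicator)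
    show "AE t in lebesgue_on {0..l}. (\<lambda>n. K n t * indicator {a..b} t) \<longlonglongrightarrow> H t * indicator {a..b} t"
      using lim by (auto elim!: eventually_mono split: split_indicator)
  qed (use W assms(1-3) in \<open>simp_all\<close>)
  then show "ennreal \<bar>F a - F b\<bar> \<le> segint l a b H"
    by (rule LIMSEQ_le_const) (use controlsD[OF K] ab in auto)
qed

lemma controls_glue_finite_union:
  assumes [measurable]: "G \<in> borel_measurable (lebesgue_on {0..l})" "K \<in> borel_measurable (lebesgue_on {0..l})"
    and G: "controls l F G" and K: "controls l F K"
  shows "controls l F (\<lambda>t. if t \<in> (\<Union>i<n::nat. {c i..d i}) then G t else K t)"
proof (induction n)
  case 0
  then show ?case using K by simp
next
  case (Suc n)
  have "controls l F (\<lambda>t. if t \<in> {c n..d n} then G t else if t \<in> (\<Union>i<n::nat. {c i..d i}) then G t else K t)"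
    by (rule controls_glue_interval[OF assms(1) _ G Suc], rule if_measurable_lebesgue_on[OF assms(1,2)]) auto
  also have "(\<lambda>t. if t \<in> {c n..d n} then G t else if t \<in> (\<Union>i<n::nat. {c i..d i}) then G t else K t)
     = (\<lambda>t. if t \<in> (\<Union>i<Suc n. {c i..d i}) then G t else K t)"
    by (rule ext) (auto simp: less_Suc_eq)
  finally show ?case .
qed

text \<open>
  The set \<open>E\<close> is reached in three stages: finite unions of intervals; open sets, as increasing limits
  of those; a decreasing sequence of open sets whose intersection exceeds \<open>E\<close> by a null set only.
\<close>
lemma controls_glue:
  assumes Gm[measurable]: "G \<in> borel_measurable (lebesgue_on {0..l})" "K \<in> borel_measurable (lebesgue_on {0..l})"
    and G: "controls l F G" and K: "controls l F K"
    and fin: "(\<integral>\<^sup>+t. G t \<partial>lebesgue_on {0..l}) < \<infinity>" "(\<integral>\<^sup>+t. K t \<partial>lebesgue_on {0..l}) < \<infinity>"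
    and E[measurable]: "E \<in> sets lebesgue"
  shows "controls l F (\<lambda>t. if t \<in> E then G t else K t)"
proof -
  have W: "(\<integral>\<^sup>+t. (G t + K t) \<partial>lebesgue_on {0..l}) < \<infinity>"
    using fin by (subst nn_integral_add) (auto simp: less_top)
  have op: "controls l F (\<lambda>t. if t \<in> U then G t else K t)" if U: "open U" for U
  proof (cases "U = {}")
    case True
    then show ?thesis using K by simp
  next
    case False
    obtain \<D> where D: "countable \<D>" "\<D> \<subseteq> Pow U" "\<And>X. X \<in> \<D> \<Longrightarrow> \<exists>a b. X = cbox a b" "\<Union>\<D> = U"
      using open_countable_Union_open_cbox[OF U] by blast
    have "\<D> \<noteq> {}" using D(4) False by auto
    then obtain X :: "nat \<Rightarrow> real set" where X: "range X = \<D>"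
      using uncountable_def D(1) by blast
    have "\<forall>n. \<exists>a b. X n = {a..b}" using D(3) X by (metis cbox_interval rangeI)
    then obtain c d where cd: "\<And>n. X n = {c n..d n}" by metis
    have Ucd: "U = (\<Union>n. {c n..d n})" using D(4) X cd by auto
    have [measurable]: "U \<in> sets lebesgue" using U by auto
    show ?thesis
    proof (rule controls_lim[where W="\<lambda>t. G t + K t"])
      show "controls l F (\<lambda>t. if t \<in> (\<Union>i<n. {c i..d i}) then G t else K t)" for n
        by (rule controls_glue_finite_union[OF Gm G K])
      show "(\<lambda>t. if t \<in> (\<Union>i<n. {c i..d i}) then G t else K t) \<in> borel_measurable (lebesgue_on {0..l})" for n
        by (intro if_measurable_lebesgue_on Gm sets.finite_UN) auto
      show "(\<lambda>t. if t \<in> U then G t else K t) \<in> borel_measurable (lebesgue_on {0..l})"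
        by (intro if_measurable_lebesgue_on Gm) auto
      show "AE t in lebesgue_on {0..l}. (\<lambda>n. if t \<in> (\<Union>i<n. {c i..d i}) then G t else K t) \<longlonglongrightarrow> (if t \<in> U then G t else K t)"
      proof (rule AE_I2)
        fix t
        show "(\<lambda>n. if t \<in> (\<Union>i<n. {c i..d i}) then G t else K t) \<longlonglongrightarrow> (if t \<in> U then G t else K t)"
        proof (cases "t \<in> U")
          case True
          then obtain k where "t \<in> {c k..d k}" using Ucd by auto
          then have "eventually (\<lambda>n. t \<in> (\<Union>i<n. {c i..d i})) sequentially"
            by (intro eventually_mono[OF eventually_gt_at_top[of k]]) auto
          then show ?thesis
            using True by (intro tendsto_eventually, elim eventually_mono) simp
        next
          case False
          then have "t \<notin> (\<Union>i<n. {c i..d i})" for n using Ucd by auto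
          then have "(\<lambda>n. if t \<in> (\<Union>i<n. {c i..d i}) then G t else K t) = (\<lambda>n. K t)"
            by (intro ext if_not_P)
          then show ?thesis using False by (simp only: if_False tendsto_const)
        qed
      qed
    qed (use W in \<open>auto\<close>)
  qed
  have "\<exists>T. open T \<and> E \<subseteq> T \<and> emeasure lebesgue (T - E) < ennreal (1 / Suc n)" for n
    by (rule sets_lebesgue_outer_open[OF E, of "1 / Suc n"]) auto
  then obtain U where U: "\<And>n::nat. open (U n)" "\<And>n. E \<subseteq> U n" "\<And>n. emeasure lebesgue (U n - E) < ennreal (1 / Suc n)"
    by metis
  define V where "V n = (\<Inter>i\<le>n. U i)" for n
  have V: "open (V n)" "E \<subseteq> V n" for n using U by (auto simp: V_def)
  have [measurable]: "V n \<in> sets lebesgue" for n using V by auto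
  have "emeasure lebesgue ((\<Inter>n. V n) - E) = 0"
  proof -
    have "emeasure lebesgue ((\<Inter>n. V n) - E) \<le> ennreal (1 / Suc n)" for n
    proof -
      have "emeasure lebesgue ((\<Inter>n. V n) - E) \<le> emeasure lebesgue (U n - E)"
        using U(1) by (intro emeasure_mono) (auto simp: V_def)
      then show ?thesis using U(3)[of n] by simp
    qed
    moreover have "(\<lambda>n. ennreal (1 / Suc n)) \<longlonglongrightarrow> 0"
      using tendsto_ennrealI[OF LIMSEQ_inverse_real_of_nat] by (simp add: field_simps)
    ultimately have "emeasure lebesgue ((\<Inter>n. V n) - E) \<le> 0"
      by (intro LIMSEQ_le_const) auto
    then show ?thesis by simp
  qed
  then have "(\<Inter>n. V n) - E \<in> null_sets lebesgue" by (auto simp: null_sets_def)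
  then have ae: "AE t in lebesgue_on {0..l}. t \<notin> (\<Inter>n. V n) - E"
    by (rule AE_lebesgue_on)
  show ?thesis
  proof (rule controls_lim[where W="\<lambda>t. G t + K t"])
    show "controls l F (\<lambda>t. if t \<in> V n then G t else K t)" for n
      by (rule op) (rule V)
    show "(\<lambda>t. if t \<in> V n then G t else K t) \<in> borel_measurable (lebesgue_on {0..l})" for n
      by (intro if_measurable_lebesgue_on Gm) auto
    show "(\<lambda>t. if t \<in> E then G t else K t) \<in> borel_measurable (lebesgue_on {0..l})"
      by (intro if_measurable_lebesgue_on Gm) auto
    show "AE t in lebesgue_on {0..l}. (\<lambda>n. if t \<in> V n then G t else K t) \<longlonglongrightarrow> (if t \<in> E then G t else K t)"
      using ae
    proof eventually_elim
      case (elim t)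
      show ?case
      proof (cases "t \<in> E")
        case True
        then have "t \<in> V n" for n using V by auto
        then show ?thesis using True by simp
      next
        case False
        then obtain k where "t \<notin> V k" using elim by auto
        then have "eventually (\<lambda>n. t \<notin> V n) sequentially"
            by (intro eventually_mono[OF eventually_ge_at_top[of k]]) (auto simp: V_def intro: order_trans)
        then show ?thesis
          using False by (intro tendsto_eventually, elim eventually_mono) simp
      qed
    qed
  qed (use W in \<open>auto\<close>)
qed

lemma controls_min:
  assumes Gm[measurable]: "G \<in> borel_measurable (lebesgue_on {0..l})" "K \<in> borel_measurable (lebesgue_on {0..l})"
    and G: "controls l F G" and K: "controls l F K"
    and fin: "(\<integral>\<^sup>+t. G t \<partial>lebesgue_on {0..l}) < \<infinity>" "(\<integral>\<^sup>+t. K t \<partial>lebesgue_on {0..l}) < \<infinity>"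
  shows "controls l F (\<lambda>t. min (G t) (K t))"
proof -
  let ?E = "{t\<in>space (lebesgue_on {0..l}). G t \<le> K t}"
  have "?E \<in> sets (lebesgue_on {0..l})" by measurable
  then have E: "?E \<in> sets lebesgue" by (subst (asm) sets_restrict_space_iff) auto
  show ?thesis
    by (rule controls_mono[OF controls_glue[OF Gm G K fin E]])
       (auto intro!: AE_I2 simp: min_def)
qed

text \<open>
  On a short interval \<open>[a, b]\<close> the increment of \<open>\<psi> v\<close> is at most \<open>\<psi>(b) |v(a) - v(b)| + v(a) L (b - a)\<close>,
  and by continuity \<open>\<psi>(b)\<close> and \<open>v(a)\<close> exceed the values of \<open>\<psi>\<close> and \<open>v\<close> at the other points of the
  interval by at most \<open>e\<close>.  Integrability of \<open>G\<close> allows \<open>e\<close> to tend to \<open>0\<close>.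
\<close>
lemma controls_product:
  assumes Gm[measurable]: "G \<in> borel_measurable (lebesgue_on {0..l})"
    and v: "controls l v G" "continuous_on {0..l} v" "\<And>t. t \<in> {0..l} \<Longrightarrow> 0 \<le> v t"
    and fin: "(\<integral>\<^sup>+t. G t \<partial>lebesgue_on {0..l}) < \<infinity>"
    and \<psi>: "\<And>s t. s \<in> {0..l} \<Longrightarrow> t \<in> {0..l} \<Longrightarrow> \<bar>\<psi> s - \<psi> t\<bar> \<le> L * \<bar>s - t\<bar>"
      "\<And>t. t \<in> {0..l} \<Longrightarrow> 0 \<le> \<psi> t" and L: "0 \<le> L"
  shows "controls l (\<lambda>t. \<psi> t * v t) (\<lambda>t. ennreal (\<psi> t) * G t + ennreal (L * v t))"
proof -
  have c\<psi>: "continuous_on {0..l} \<psi>"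
  proof (rule continuous_on_iff[THEN iffD2], intro ballI allI impI)
    fix x e :: real assume x: "x \<in> {0..l}" "0 < e"
    show "\<exists>d>0. \<forall>x'\<in>{0..l}. dist x' x < d \<longrightarrow> dist (\<psi> x') (\<psi> x) < e"
    proof (intro exI[of _ "e / (L + 1)"] conjI ballI impI)
      fix y assume y: "y \<in> {0..l}" "dist y x < e / (L + 1)"
      have "\<bar>\<psi> y - \<psi> x\<bar> \<le> L * \<bar>y - x\<bar>" by (rule \<psi>) (use x y in auto)
      also have "\<dots> \<le> (L + 1) * \<bar>y - x\<bar>" by (auto simp: algebra_simps)
      also have "\<dots> < (L + 1) * (e / (L + 1))"
        using y L by (intro mult_strict_left_mono) (auto simp: dist_real_def)
      finally show "dist (\<psi> y) (\<psi> x) < e" using L by (simp add: dist_real_def)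
    qed (use x L in auto)
  qed
  have [measurable]: "v \<in> borel_measurable (lebesgue_on {0..l})" "\<psi> \<in> borel_measurable (lebesgue_on {0..l})"
    by (auto intro!: continuous_imp_measurable_on_sets_lebesgue c\<psi> v)
  define H where "H e t = ennreal (\<psi> t + e) * G t + ennreal (L * (v t + e))" for e t
  have [measurable]: "H e \<in> borel_measurable (lebesgue_on {0..l})" for e
    unfolding H_def by measurable
  have step: "controls l (\<lambda>t. \<psi> t * v t) (H e)" if e: "0 < e" for e
  proof (rule controls_local)
    fix x assume x: "0 \<le> x" "x \<le> l"
    have "e/2 > 0" using e by auto
    obtain d1 where d1: "d1 > 0" "\<And>t. t \<in> {0..l} \<Longrightarrow> dist t x < d1 \<Longrightarrow> dist (\<psi> t) (\<psi> x) < e / 2"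
      using c\<psi> x \<open>e/2 > 0\<close> unfolding continuous_on_iff by (metis atLeastAtMost_iff)
    obtain d2 where d2: "d2 > 0" "\<And>t. t \<in> {0..l} \<Longrightarrow> dist t x < d2 \<Longrightarrow> dist (v t) (v x) < e / 2"
      using v(2) x \<open>e/2 > 0\<close> unfolding continuous_on_iff by (metis atLeastAtMost_iff)
    show "\<exists>d>0. \<forall>a b. 0 \<le> a \<and> a \<le> x \<and> x \<le> b \<and> b \<le> l \<and> b - a < d \<longrightarrow>
      ennreal \<bar>\<psi> a * v a - \<psi> b * v b\<bar> \<le> segint l a b (H e)"
    proof (intro exI[of _ "min d1 d2"] conjI allI impI)
      fix a b assume ab: "0 \<le> a \<and> a \<le> x \<and> x \<le> b \<and> b \<le> l \<and> b - a < min d1 d2"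
      have \<psi>b: "\<psi> b \<le> \<psi> t + e" if "t \<in> {a..b}" for t
      proof -
        have "dist t x < d1" "dist b x < d1" using that ab by (auto simp: dist_real_def)
        moreover have "t \<in> {0..l}" "b \<in> {0..l}" using that ab by auto
        ultimately have "\<bar>\<psi> t - \<psi> x\<bar> < e / 2" "\<bar>\<psi> b - \<psi> x\<bar> < e / 2"
          using d1(2) unfolding dist_real_def by blast+
        then show ?thesis by linarith
      qed
      have va: "v a \<le> v t + e" if "t \<in> {a..b}" for t
      proof -
        have "dist t x < d2" "dist a x < d2" using that ab by (auto simp: dist_real_def)
        moreover have "t \<in> {0..l}" "a \<in> {0..l}" using that ab by auto
        ultimately have "\<bar>v t - v x\<bar> < e / 2" "\<bar>v a - v x\<bar> < e / 2"
          using d2(2) unfolding dist_real_def by blast+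
        then show ?thesis by linarith
      qed
      have "\<bar>\<psi> a * v a - \<psi> b * v b\<bar> = \<bar>\<psi> b * (v a - v b) + v a * (\<psi> a - \<psi> b)\<bar>"
        by (simp add: algebra_simps)
      also have "\<dots> \<le> \<psi> b * \<bar>v a - v b\<bar> + v a * \<bar>\<psi> a - \<psi> b\<bar>"
        using \<psi>(2)[of b] v(3)[of a] ab abs_triangle_ineq[of "\<psi> b * (v a - v b)" "v a * (\<psi> a - \<psi> b)"]
        by (simp add: abs_mult)
      also have "\<dots> \<le> \<psi> b * \<bar>v a - v b\<bar> + v a * (L * (b - a))"
        using \<psi>(1)[of a b] v(3)[of a] ab by (intro add_left_mono mult_left_mono) auto
      finally have "ennreal \<bar>\<psi> a * v a - \<psi> b * v b\<bar> \<le> ennreal (\<psi> b * \<bar>v a - v b\<bar> + v a * (L * (b - a)))"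
        by (rule ennreal_leI)
      also have "\<dots> = ennreal (\<psi> b) * ennreal \<bar>v a - v b\<bar> + ennreal (L * v a) * ennreal (b - a)"
        using \<psi>(2)[of b] v(3)[of a] ab L
        by (subst ennreal_plus) (auto simp: ennreal_mult[symmetric] mult_ac)
      also have "\<dots> \<le> ennreal (\<psi> b) * segint l a b G + ennreal (L * v a) * (\<integral>\<^sup>+t. indicator {a..b} t \<partial>lebesgue_on {0..l})"
      proof (intro add_mono mult_left_mono controlsD[OF v(1)])
        have "(\<integral>\<^sup>+t. indicator {a..b} t \<partial>lebesgue_on {0..l}) = (\<integral>\<^sup>+t. indicator {a..b} t * indicator {0..l} t \<partial>lebesgue)"
          by (subst nn_integral_restrict_space) auto
        also have "\<dots> = (\<integral>\<^sup>+t. indicator {a..b} t \<partial>lebesgue)"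
          using ab by (intro nn_integral_cong) (auto split: split_indicator)
        also have "\<dots> = ennreal (b - a)" using ab by simp
        finally show "ennreal (b - a) \<le> (\<integral>\<^sup>+t. indicator {a..b} t \<partial>lebesgue_on {0..l})" by simp
      qed (use ab in auto)
      also have "\<dots> = segint l a b (\<lambda>t. ennreal (\<psi> b) * G t + ennreal (L * v a))"
      proof -
        have [measurable]: "(indicator {a..b} :: real \<Rightarrow> ennreal) \<in> borel_measurable (lebesgue_on {0..l})"
          by (rule indicator_measurable_lebesgue_on) auto
        have "segint l a b (\<lambda>t. ennreal (\<psi> b) * G t + ennreal (L * v a))
          = (\<integral>\<^sup>+t. ennreal (\<psi> b) * (G t * indicator {a..b} t) + ennreal (L * v a) * indicator {a..b} t \<partial>lebesgue_on {0..l})"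
          by (simp only: distrib_right mult.assoc)
        also have "\<dots> = (\<integral>\<^sup>+t. ennreal (\<psi> b) * (G t * indicator {a..b} t) \<partial>lebesgue_on {0..l})
          + (\<integral>\<^sup>+t. ennreal (L * v a) * indicator {a..b} t \<partial>lebesgue_on {0..l})"
          by (rule nn_integral_add) measurable
        finally show ?thesis
          by (simp add: nn_integral_cmult)
      qed
      also have "\<dots> \<le> segint l a b (H e)"
        unfolding H_def using \<psi>b va L
        by (intro nn_integral_mono) (auto split: split_indicator intro!: add_mono mult_right_mono ennreal_leI mult_left_mono)
      finally show "ennreal \<bar>\<psi> a * v a - \<psi> b * v b\<bar> \<le> segint l a b (H e)" .
    qed (use d1 d2 in auto)
  qed measurable
  have bdd: "\<exists>B. \<forall>t\<in>{0..l}. f t \<le> B" if "continuous_on {0..l} f" for f :: "real \<Rightarrow> real"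
  proof (cases "l < 0")
    case False
    then show ?thesis using continuous_attains_sup[of "{0..l}" f] that by fastforce
  qed auto
  obtain B1 where B1: "\<And>t. t \<in> {0..l} \<Longrightarrow> \<psi> t \<le> B1" using bdd[OF c\<psi>] by blast
  obtain B2 where B2: "\<And>t. t \<in> {0..l} \<Longrightarrow> v t \<le> B2" using bdd[OF v(2)] by blast
  let ?e = "\<lambda>n. 1 / real (Suc n)"
  have e0: "?e \<longlonglongrightarrow> 0" using LIMSEQ_inverse_real_of_nat by (simp add: field_simps)
  have fm: "emeasure lebesgue {0..l} < \<infinity>" by (simp add: emeasure_lborel_Icc_eq)
  show ?thesis
  proof (rule controls_lim[where W="\<lambda>t. ennreal (B1 + 1) * G t + ennreal (L * (B2 + 1))"])
    show "controls l (\<lambda>t. \<psi> t * v t) (H (?e n))" for n by (rule step) auto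
    have "(\<integral>\<^sup>+t. (ennreal (B1 + 1) * G t + ennreal (L * (B2 + 1))) \<partial>lebesgue_on {0..l})
      = ennreal (B1 + 1) * (\<integral>\<^sup>+t. G t \<partial>lebesgue_on {0..l}) + ennreal (L * (B2 + 1)) * emeasure (lebesgue_on {0..l}) {0..l}"
      by (simp add: nn_integral_add nn_integral_cmult emeasure_restrict_space)
    also have "\<dots> < \<infinity>"
      using fin fm by (auto simp: ennreal_mult_less_top emeasure_restrict_space)
    finally show "(\<integral>\<^sup>+t. (ennreal (B1 + 1) * G t + ennreal (L * (B2 + 1))) \<partial>lebesgue_on {0..l}) < \<infinity>" .
    show "AE t in lebesgue_on {0..l}. H (?e n) t \<le> ennreal (B1 + 1) * G t + ennreal (L * (B2 + 1))" for n
    proof (rule AE_I2)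
      fix t assume "t \<in> space (lebesgue_on {0..l})"
      then have t: "t \<in> {0..l}" by simp
      have "?e n \<le> 1" by simp
      then show "H (?e n) t \<le> ennreal (B1 + 1) * G t + ennreal (L * (B2 + 1))"
        unfolding H_def using B1[OF t] B2[OF t] L
        by (intro add_mono mult_right_mono ennreal_leI mult_left_mono) auto
    qed
    show "AE t in lebesgue_on {0..l}. (\<lambda>n. H (?e n) t) \<longlonglongrightarrow> ennreal (\<psi> t) * G t + ennreal (L * v t)"
    proof -
      have "AE t in lebesgue_on {0..l}. G t \<noteq> \<infinity>"
        by (rule nn_integral_PInf_AE) (use fin in auto)
      then show ?thesis
      proof eventually_elim
        case (elim t)
        have 1: "(\<lambda>n. \<psi> t + ?e n) \<longlonglongrightarrow> \<psi> t + 0" "(\<lambda>n. L * (v t + ?e n)) \<longlonglongrightarrow> L * (v t + 0)"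
          by (intro tendsto_intros e0)+
        have 2: "(\<lambda>n. ennreal (\<psi> t + ?e n)) \<longlonglongrightarrow> ennreal (\<psi> t)" "(\<lambda>n. ennreal (L * (v t + ?e n))) \<longlonglongrightarrow> ennreal (L * v t)"
          using tendsto_ennrealI[OF 1(1)] tendsto_ennrealI[OF 1(2)] by simp_all
        have "(\<lambda>n. ennreal (\<psi> t + ?e n) * G t) \<longlonglongrightarrow> ennreal (\<psi> t) * G t"
          using elim by (intro tendsto_mult_ennreal 2(1) tendsto_const) auto
        then show ?case unfolding H_def
          by (intro tendsto_add 2(2))
      qed
    qed
  qed measurable
qed

section \<open>Curves parameterized by arc length\<close>

lemma curve_length_shift_le:
  "curve_length (\<lambda>t. \<gamma> (a + t)) s t \<le> curve_length \<gamma> (a + s) (a + t)"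
  unfolding curve_length_def
proof (rule SUP_least, clarify)
  fix n :: nat and \<tau> :: "nat \<Rightarrow> real"
  assume \<tau>: "mono_on {..n} \<tau>" "\<tau> ` {..n} \<subseteq> {s..t}"
  have "(n, \<lambda>i. a + \<tau> i) \<in> {(n, \<tau>). mono_on {..n} \<tau> \<and> \<tau> ` {..n} \<subseteq> {a + s..a + t}}"
    using \<tau> by (auto simp: mono_on_def)
  from SUP_upper[OF this, of "\<lambda>(n, \<tau>). \<Sum>i<n. ennreal (dist (\<gamma> (\<tau> i)) (\<gamma> (\<tau> (Suc i))))"]
  show "(\<Sum>i<n. ennreal (dist (\<gamma> (a + \<tau> i)) (\<gamma> (a + \<tau> (Suc i)))))
      \<le> (SUP (n, \<tau>)\<in>{(n, \<tau>). mono_on {..n} \<tau> \<and> \<tau> ` {..n} \<subseteq> {a + s..a + t}}.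
           \<Sum>i<n. ennreal (dist (\<gamma> (\<tau> i)) (\<gamma> (\<tau> (Suc i)))))"
    by simp
qed

lemma curve_length_shift:
  "curve_length (\<lambda>t. \<gamma> (a + t)) s t = curve_length \<gamma> (a + s) (a + t)"
proof (rule antisym[OF curve_length_shift_le])
  show "curve_length \<gamma> (a + s) (a + t) \<le> curve_length (\<lambda>t. \<gamma> (a + t)) s t"
    using curve_length_shift_le[of "\<lambda>t. \<gamma> (a + t)" "- a" "a + s" "a + t"] by simp
qed

lemma arclength_curve_subcurve:
  assumes "arclength_curve S \<gamma> l" "0 \<le> a" "a < b" "b \<le> l" "\<gamma> ` {a..b} \<subseteq> T"
  shows "arclength_curve T (\<lambda>t. \<gamma> (a + t)) (b - a)"
  using assms unfolding arclength_curve_def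
  by (auto simp: curve_length_shift image_subset_iff)

lemma arclength_curve_dist_le:
  assumes "arclength_curve S \<gamma> l" "0 \<le> s" "s \<le> t" "t \<le> l"
  shows "dist (\<gamma> s) (\<gamma> t) \<le> t - s"
proof -
  let ?\<tau> = "\<lambda>i::nat. if i = 0 then s else t"
  have "(1, ?\<tau>) \<in> {(n, \<tau>). mono_on {..n} \<tau> \<and> \<tau> ` {..n} \<subseteq> {s..t}}"
    using assms by (auto simp: mono_on_def)
  from SUP_upper[OF this, of "\<lambda>(n, \<tau>). \<Sum>i<n. ennreal (dist (\<gamma> (\<tau> i)) (\<gamma> (\<tau> (Suc i))))"]
  have "ennreal (dist (\<gamma> s) (\<gamma> t)) \<le> curve_length \<gamma> s t"
    unfolding curve_length_def by simp
  also have "\<dots> = ennreal (t - s)"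
    using assms by (auto simp: arclength_curve_def)
  finally show ?thesis using assms by (subst (asm) ennreal_le_iff) auto
qed

lemma arclength_curve_dist_abs:
  assumes "arclength_curve S \<gamma> l" "s \<in> {0..l}" "t \<in> {0..l}"
  shows "dist (\<gamma> s) (\<gamma> t) \<le> \<bar>s - t\<bar>"
  using arclength_curve_dist_le[OF assms(1), of s t] arclength_curve_dist_le[OF assms(1), of t s] assms
  by (cases "s \<le> t") (auto simp: dist_commute)

lemma arclength_curve_continuous:
  assumes "arclength_curve S \<gamma> l"
  shows "continuous_on {0..l} \<gamma>"
proof (rule continuous_on_iff[THEN iffD2], intro ballI allI impI)
  fix x e :: real assume "x \<in> {0..l}" "0 < e"
  then show "\<exists>d>0. \<forall>y\<in>{0..l}. dist y x < d \<longrightarrow> dist (\<gamma> y) (\<gamma> x) < e"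
    using arclength_curve_dist_abs[OF assms, of _ x]
    by (intro exI[of _ e] conjI ballI impI) (auto simp: dist_real_def intro: order.strict_trans1)
qed

lemma arclength_curve_borel:
  fixes g :: "'a::metric_space \<Rightarrow> ennreal"
  assumes "arclength_curve S \<gamma> l" and [measurable]: "g \<in> borel_measurable borel"
  shows "(\<lambda>t. g (\<gamma> t)) \<in> borel_measurable (lebesgue_on {0..l})"
proof -
  have [measurable]: "\<gamma> \<in> borel_measurable (lebesgue_on {0..l})"
    by (intro continuous_imp_measurable_on_sets_lebesgue arclength_curve_continuous[OF assms(1)]) auto
  show ?thesis by measurable
qed

lemma line_integral_eq: "line_integral \<gamma> l g = (\<integral>\<^sup>+t. g (\<gamma> t) \<partial>lebesgue_on {0..l})"
  by (simp add: line_integral_def nn_integral_restrict_space)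

lemma line_integral_eq': "line_integral \<gamma> l g = segint l 0 l (\<lambda>t. g (\<gamma> t))"
  unfolding line_integral_eq by (intro nn_integral_cong) auto

lemma line_integral_subcurve:
  assumes "(\<lambda>t. g (\<gamma> t)) \<in> borel_measurable (lebesgue_on {0..l})" "0 \<le> a" "b \<le> l"
  shows "line_integral (\<lambda>t. \<gamma> (a + t)) (b - a) g = segint l a b (\<lambda>t. g (\<gamma> t))"
proof -
  have 1: "(\<lambda>t. g (\<gamma> t) * indicator {0..l} t) \<in> borel_measurable lebesgue"
    using assms(1) by (subst (asm) borel_measurable_restrict_space_iff_ennreal) auto
  have [measurable]: "(\<lambda>t. g (\<gamma> t) * indicator {0..l} t * indicator {a..b} t) \<in> borel_measurable lebesgue"
    by (intro borel_measurable_times_ennreal 1 borel_measurable_indicator) auto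
  have 2: "(\<lambda>t. g (\<gamma> t) * indicator {0..l} t * indicator {a..b} t) = (\<lambda>t. g (\<gamma> t) * indicator {a..b} t)"
    using assms by (auto split: split_indicator)
  have "segint l a b (\<lambda>t. g (\<gamma> t)) = (\<integral>\<^sup>+t. g (\<gamma> t) * indicator {a..b} t \<partial>lebesgue)"
    by (subst nn_integral_restrict_space, simp)
       (intro nn_integral_cong, use assms in \<open>auto split: split_indicator\<close>)
  also have "\<dots> = (\<integral>\<^sup>+t. g (\<gamma> (a + t)) * indicator {a..b} (a + t) \<partial>lebesgue)"
    using nn_integral_real_affine_lebesgue[of "\<lambda>t. g (\<gamma> t) * indicator {a..b} t" 1 a]
      \<open>(\<lambda>t. g (\<gamma> t) * indicator {0..l} t * indicator {a..b} t) \<in> borel_measurable lebesgue\<close>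
    unfolding 2 by simp
  also have "\<dots> = line_integral (\<lambda>t. \<gamma> (a + t)) (b - a) g"
    unfolding line_integral_def by (intro nn_integral_cong) (auto split: split_indicator)
  finally show ?thesis by simp
qed

section \<open>Properties of almost every curve\<close>

locale newtonian_setting =
  fixes \<mu> :: "'a::metric_space measure" and p :: real
  assumes p_gt_1: "1 < p" and metric_measure: "metric_measure \<mu>"
begin

lemma p_pos: "0 < p" using p_gt_1 by simp

lemma completion_of_borel: obtains \<nu> where "sets \<nu> = sets borel" "space \<nu> = UNIV" "\<mu> = completion \<nu>"
  using metric_measure unfolding metric_measure_def
  by (metis sets_eq_imp_space_eq space_borel)

lemma space_eq [simp]: "space \<mu> = UNIV"
  by (metis completion_of_borel space_completion)

lemma borel_sets [measurable (raw)]: "A \<in> sets borel \<Longrightarrow> A \<in> sets \<mu>"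
  by (metis completion_of_borel sets_completionI_sets)

lemma borel_measurable_mu: "f \<in> measurable borel M \<Longrightarrow> f \<in> measurable \<mu> M"
  unfolding measurable_def using borel_sets by auto

lemma ball_sets [measurable, simp]: "ball x r \<in> sets \<mu>"
  by (intro borel_sets) auto

lemma emeasure_ball_pos: "0 < r \<Longrightarrow> 0 < emeasure \<mu> (ball x r)"
  and emeasure_ball_finite: "emeasure \<mu> (ball x r) < \<infinity>"
  using metric_measure unfolding metric_measure_def
  by (auto, metis ball_empty emeasure_empty less_eq_real_def not_less infinity_ennreal_def ennreal_zero_less_top zero_less_iff_neq_zero)

lemma continuous_measurable: "continuous_on UNIV u \<Longrightarrow> u \<in> borel_measurable \<mu>"
  by (intro borel_measurable_mu borel_measurable_continuous_onI)

definition ae_curve :: "((real \<Rightarrow> 'a) \<Rightarrow> real \<Rightarrow> bool) \<Rightarrow> bool" where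
  "ae_curve P \<longleftrightarrow> p_ae_curve p \<mu> P"

lemma ae_curve_def':
  "ae_curve P \<longleftrightarrow> (\<exists>\<rho>\<in>borel_measurable borel. (\<integral>\<^sup>+x. ennpow (\<rho> x) p \<partial>\<mu>) < \<infinity> \<and>
     (\<forall>\<gamma> l. arclength_curve UNIV \<gamma> l \<and> \<not> P \<gamma> l \<longrightarrow> line_integral \<gamma> l \<rho> = \<infinity>))"
proof -
  have "borel_measurable (restrict_space borel UNIV) = (borel_measurable borel :: ('a \<Rightarrow> ennreal) set)"
    by (intro measurable_cong_sets) (auto simp: sets_restrict_space)
  then show ?thesis unfolding ae_curve_def p_ae_curve_def by auto
qed

lemma ae_curveI:
  assumes "\<rho> \<in> borel_measurable borel" "(\<integral>\<^sup>+x. ennpow (\<rho> x) p \<partial>\<mu>) < \<infinity>"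
    and "\<And>\<gamma> l. arclength_curve UNIV \<gamma> l \<Longrightarrow> line_integral \<gamma> l \<rho> \<noteq> \<infinity> \<Longrightarrow> P \<gamma> l"
  shows "ae_curve P"
  unfolding ae_curve_def' using assms by blast

lemma ae_curve_mono:
  "ae_curve P \<Longrightarrow> (\<And>\<gamma> l. arclength_curve UNIV \<gamma> l \<Longrightarrow> P \<gamma> l \<Longrightarrow> Q \<gamma> l) \<Longrightarrow> ae_curve Q"
  unfolding ae_curve_def' by blast

text \<open>
  The given densities are multiplied by constants that make the integrals of their \<open>p\<close>th powers
  summable; the supremum of the products is then a density for the union of the exceptional families.
\<close>
lemma ae_curve_all_nat:
  assumes "\<And>n::nat. ae_curve (P n)"
  shows "ae_curve (\<lambda>\<gamma> l. \<forall>n. P n \<gamma> l)"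
proof -
  obtain \<rho> where \<rho>: "\<And>n. \<rho> n \<in> borel_measurable borel" "\<And>n. (\<integral>\<^sup>+x. ennpow (\<rho> n x) p \<partial>\<mu>) < \<infinity>"
    "\<And>n \<gamma> l. arclength_curve UNIV \<gamma> l \<Longrightarrow> \<not> P n \<gamma> l \<Longrightarrow> line_integral \<gamma> l (\<rho> n) = \<infinity>"
    using assms unfolding ae_curve_def' by metis
  note [measurable] = \<rho>(1)
  have [measurable]: "\<rho> n \<in> borel_measurable \<mu>" for n by (intro borel_measurable_mu \<rho>)
  define I where "I n = enn2real (\<integral>\<^sup>+x. ennpow (\<rho> n x) p \<partial>\<mu>)" for n
  have I: "(\<integral>\<^sup>+x. ennpow (\<rho> n x) p \<partial>\<mu>) = ennreal (I n)" "0 \<le> I n" for n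
    using \<rho>(2)[of n] by (auto simp: I_def)
  define c where "c n = ((1/2)^n / (1 + I n)) powr (1 / p)" for n
  have c: "0 < c n" "c n powr p = (1/2)^n / (1 + I n)" for n
    using I(2)[of n] p_pos by (auto simp: c_def powr_powr)
  define \<sigma> where "\<sigma> x = (SUP n. ennreal (c n) * \<rho> n x)" for x
  show ?thesis
  proof (rule ae_curveI)
    show "\<sigma> \<in> borel_measurable borel" unfolding \<sigma>_def by measurable
    have "(\<integral>\<^sup>+x. ennpow (\<sigma> x) p \<partial>\<mu>) \<le> (\<integral>\<^sup>+x. (\<Sum>n. ennpow (ennreal (c n) * \<rho> n x) p) \<partial>\<mu>)"
      unfolding \<sigma>_def using p_pos by (intro nn_integral_mono ennpow_SUP_le)
    also have "\<dots> = (\<Sum>n. \<integral>\<^sup>+x. ennpow (ennreal (c n) * \<rho> n x) p \<partial>\<mu>)"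
      by (intro nn_integral_suminf) measurable
    also have "\<dots> = (\<Sum>n. ennreal ((1/2)^n / (1 + I n) * I n))"
    proof (rule arg_cong[where f=suminf], rule ext)
      fix n
      have "(\<integral>\<^sup>+x. ennpow (ennreal (c n) * \<rho> n x) p \<partial>\<mu>) = ennreal (c n powr p) * (\<integral>\<^sup>+x. ennpow (\<rho> n x) p \<partial>\<mu>)"
        using p_pos c(1)[of n] by (simp add: ennpow_mult ennpow_ennreal nn_integral_cmult)
      then show "(\<integral>\<^sup>+x. ennpow (ennreal (c n) * \<rho> n x) p \<partial>\<mu>) = ennreal ((1/2)^n / (1 + I n) * I n)"
        using I c by (simp add: ennreal_mult[symmetric])
    qed
    also have "\<dots> \<le> (\<Sum>n. ennreal ((1/2)^n))"
    proof (intro suminf_le ennreal_leI allI summableI)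
      fix n
      have "I n / (1 + I n) \<le> 1" using I(2)[of n] by simp
      then have "(1/2)^n * (I n / (1 + I n)) \<le> (1/2)^n" by (intro mult_left_le) auto
      then show "(1/2)^n / (1 + I n) * I n \<le> (1/2)^n" by simp
    qed
    also have "\<dots> < \<infinity>"
      by (subst suminf_ennreal2) (auto intro: summable_geometric)
    finally show "(\<integral>\<^sup>+x. ennpow (\<sigma> x) p \<partial>\<mu>) < \<infinity>" .
  next
    fix \<gamma> l assume \<gamma>: "arclength_curve UNIV \<gamma> l" "line_integral \<gamma> l \<sigma> \<noteq> \<infinity>"
    show "\<forall>n. P n \<gamma> l"
    proof (rule allI, rule ccontr)
      fix n assume "\<not> P n \<gamma> l"
      have [measurable]: "(\<lambda>t. \<rho> n (\<gamma> t)) \<in> borel_measurable (lebesgue_on {0..l})"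
        by (intro arclength_curve_borel[OF \<gamma>(1)] \<rho>)
      have "\<infinity> = ennreal (c n) * line_integral \<gamma> l (\<rho> n)"
        using \<rho>(3)[OF \<gamma>(1) \<open>\<not> P n \<gamma> l\<close>] c(1)[of n] by (simp add: ennreal_mult_eq_top_iff)
      also have "\<dots> = (\<integral>\<^sup>+t. ennreal (c n) * \<rho> n (\<gamma> t) \<partial>lebesgue_on {0..l})"
        unfolding line_integral_eq by (rule nn_integral_cmult[symmetric]) measurable
      also have "\<dots> \<le> line_integral \<gamma> l \<sigma>"
        unfolding line_integral_eq \<sigma>_def by (intro nn_integral_mono SUP_upper) auto
      finally show False using \<gamma>(2) by (simp add: top_unique)
    qed
  qed
qed

lemma ae_curve_conj:
  assumes "ae_curve P" "ae_curve Q"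
  shows "ae_curve (\<lambda>\<gamma> l. P \<gamma> l \<and> Q \<gamma> l)"
proof -
  have "ae_curve (\<lambda>\<gamma> l. \<forall>n::nat. if n = 0 then P \<gamma> l else Q \<gamma> l)"
  proof (rule ae_curve_all_nat)
    fix n :: nat
    show "ae_curve (\<lambda>\<gamma> l. if n = 0 then P \<gamma> l else Q \<gamma> l)"
      by (cases "n = 0") (use assms in simp_all)
  qed
  then show ?thesis by (rule ae_curve_mono) (metis zero_neq_one)
qed

text \<open>
  A density with infinite integral over a subcurve has infinite integral over the whole curve.
\<close>
lemma ae_curve_subcurves:
  assumes "ae_curve P"
  shows "ae_curve (\<lambda>\<gamma> l. \<forall>a b. 0 \<le> a \<and> a < b \<and> b \<le> l \<longrightarrow> P (\<lambda>t. \<gamma> (a + t)) (b - a))"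
proof -
  obtain \<rho> where \<rho>: "\<rho> \<in> borel_measurable borel" "(\<integral>\<^sup>+x. ennpow (\<rho> x) p \<partial>\<mu>) < \<infinity>"
    "\<And>\<gamma> l. arclength_curve UNIV \<gamma> l \<Longrightarrow> \<not> P \<gamma> l \<Longrightarrow> line_integral \<gamma> l \<rho> = \<infinity>"
    using assms unfolding ae_curve_def' by metis
  show ?thesis
  proof (rule ae_curveI[OF \<rho>(1,2)], intro allI impI, rule ccontr)
    fix \<gamma> l a b assume \<gamma>: "arclength_curve UNIV \<gamma> l" "line_integral \<gamma> l \<rho> \<noteq> \<infinity>"
      and ab: "0 \<le> a \<and> a < b \<and> b \<le> l" and "\<not> P (\<lambda>t. \<gamma> (a + t)) (b - a)"
    then have "line_integral (\<lambda>t. \<gamma> (a + t)) (b - a) \<rho> = \<infinity>"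
      by (intro \<rho>(3) arclength_curve_subcurve[OF \<gamma>(1)]) auto
    moreover have "line_integral (\<lambda>t. \<gamma> (a + t)) (b - a) \<rho> = segint l a b (\<lambda>t. \<rho> (\<gamma> t))"
      by (intro line_integral_subcurve arclength_curve_borel[OF \<gamma>(1)] \<rho>) (use ab in auto)
    moreover have "\<dots> \<le> line_integral \<gamma> l \<rho>"
      unfolding line_integral_eq by (intro nn_integral_mono) (auto split: split_indicator)
    ultimately show False using \<gamma>(2) by (simp add: top_unique)
  qed
qed

lemma borel_representative:
  fixes g :: "'a \<Rightarrow> ennreal"
  assumes "g \<in> borel_measurable \<mu>"
  obtains g' N where "g' \<in> borel_measurable borel" "N \<in> sets borel" "emeasure \<mu> N = 0"
    "\<And>x. x \<notin> N \<Longrightarrow> g x = g' x"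
proof -
  obtain \<nu> where \<nu>: "sets \<nu> = sets borel" "space \<nu> = UNIV" "\<mu> = completion \<nu>"
    by (rule completion_of_borel)
  obtain g' where g': "g' \<in> borel_measurable \<nu>" "AE x in \<nu>. g x = g' x"
    using completion_ex_borel_measurable[of g \<nu>] assms \<nu> by auto
  from g'(2) obtain N where N: "{x\<in>space \<nu>. \<not> g x = g' x} \<subseteq> N" "emeasure \<nu> N = 0" "N \<in> sets \<nu>"
    by (rule AE_E)
  show ?thesis
  proof (rule that)
    show "g' \<in> borel_measurable borel" using g'(1) \<nu>(1) measurable_cong_sets by blast
    show "emeasure \<mu> N = 0" using N \<nu> by simp
  qed (use N \<nu> in auto)
qed

text \<open>
  The density that is infinite on \<open>N\<close> and zero elsewhere has a vanishing integral over the space.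
\<close>
lemma ae_curve_avoids_null_set:
  assumes N: "N \<in> sets borel" "emeasure \<mu> N = 0"
  shows "ae_curve (\<lambda>\<gamma> l. AE t in lebesgue_on {0..l}. \<gamma> t \<notin> N)"
proof (rule ae_curveI[where \<rho>="\<lambda>x. top * indicator N x"])
  show "(\<lambda>x. top * indicator N x :: ennreal) \<in> borel_measurable borel"
    using N by auto
  have "(\<integral>\<^sup>+x. ennpow (top * indicator N x) p \<partial>\<mu>) = (\<integral>\<^sup>+x. top * indicator N x \<partial>\<mu>)"
    by (intro nn_integral_cong) (auto split: split_indicator)
  also have "\<dots> = 0"
    using N borel_sets by (subst nn_integral_cmult_indicator) auto
  finally show "(\<integral>\<^sup>+x. ennpow (top * indicator N x) p \<partial>\<mu>) < \<infinity>" by simp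
next
  fix \<gamma> l assume \<gamma>: "arclength_curve UNIV \<gamma> l" "line_integral \<gamma> l (\<lambda>x. top * indicator N x) \<noteq> \<infinity>"
  have "AE t in lebesgue_on {0..l}. top * indicator N (\<gamma> t) \<noteq> (\<infinity>::ennreal)"
    using \<gamma>(2) unfolding line_integral_eq
    by (intro nn_integral_PInf_AE arclength_curve_borel[OF \<gamma>(1)]) (use N in auto)
  then show "AE t in lebesgue_on {0..l}. \<gamma> t \<notin> N"
    by eventually_elim auto
qed

lemma borel_measurable_lebesgue_on_AE:
  fixes f f' :: "real \<Rightarrow> ennreal"
  assumes f': "f' \<in> borel_measurable (lebesgue_on {0..l})" and ae: "AE t in lebesgue_on {0..l}. f t = f' t"
  shows "f \<in> borel_measurable (lebesgue_on {0..l})"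
proof -
  have 1: "(\<lambda>t. f' t * indicator {0..l} t) \<in> borel_measurable lebesgue"
    using f' by (subst (asm) borel_measurable_restrict_space_iff_ennreal) auto
  have "{0..l} \<inter> space lebesgue \<in> sets lebesgue" by simp
  from AE_restrict_space_iff[OF this] ae
  have 2: "AE t in lebesgue. t \<in> {0..l} \<longrightarrow> f t = f' t" by simp
  have "(\<lambda>t. f t * indicator {0..l} t) \<in> borel_measurable lebesgue"
  proof (rule measurableI)
    fix A :: "ennreal set" assume A: "A \<in> sets borel"
    show "(\<lambda>t. f t * indicator {0..l} t) -` A \<inter> space lebesgue \<in> sets lebesgue"
    proof (rule completion.in_sets_AE)
      show "(\<lambda>t. f' t * indicator {0..l} t) -` A \<inter> space lebesgue \<in> sets lebesgue"
        using measurable_sets[OF 1 A] .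
      show "AE t in lebesgue. (t \<in> (\<lambda>t. f' t * indicator {0..l} t) -` A \<inter> space lebesgue) =
              (t \<in> (\<lambda>t. f t * indicator {0..l} t) -` A \<inter> space lebesgue)"
        using 2 by eventually_elim (auto split: split_indicator)
    qed auto
  qed auto
  then show ?thesis
    by (subst borel_measurable_restrict_space_iff_ennreal) auto
qed

text \<open>
  As \<open>g\<close> need not be a Borel function, \<open>g \<circ> \<gamma>\<close> may fail to be measurable, but only along curves that
  spend positive time in a null set.
\<close>
lemma ae_curve_measurable:
  fixes g :: "'a \<Rightarrow> ennreal"
  assumes "g \<in> borel_measurable \<mu>"
  shows "ae_curve (\<lambda>\<gamma> l. (\<lambda>t. g (\<gamma> t)) \<in> borel_measurable (lebesgue_on {0..l}))"
proof -
  obtain g' N where g': "g' \<in> borel_measurable borel" "N \<in> sets borel" "emeasure \<mu> N = 0"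
    "\<And>x. x \<notin> N \<Longrightarrow> g x = g' x"
    by (rule borel_representative[OF assms]) blast
  show ?thesis
  proof (rule ae_curve_mono[OF ae_curve_avoids_null_set[OF g'(2,3)]])
    fix \<gamma> l assume \<gamma>: "arclength_curve UNIV \<gamma> l" "AE t in lebesgue_on {0..l}. \<gamma> t \<notin> N"
    show "(\<lambda>t. g (\<gamma> t)) \<in> borel_measurable (lebesgue_on {0..l})"
      by (rule borel_measurable_lebesgue_on_AE[OF arclength_curve_borel[OF \<gamma>(1) g'(1)]])
         (use \<gamma>(2) g'(4) in \<open>auto elim: eventually_mono\<close>)
  qed
qed

text \<open>
  Up to a null set, \<open>g\<close> is itself a density for the family of exceptional curves.
\<close>
lemma ae_curve_finite_integral:
  fixes g :: "'a \<Rightarrow> ennreal"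
  assumes g: "g \<in> borel_measurable \<mu>" and fin: "(\<integral>\<^sup>+x. ennpow (g x) p \<partial>\<mu>) < \<infinity>"
  shows "ae_curve (\<lambda>\<gamma> l. line_integral \<gamma> l g < \<infinity>)"
proof -
  obtain g' N where g': "g' \<in> borel_measurable borel" "N \<in> sets borel" "emeasure \<mu> N = 0"
    "\<And>x. x \<notin> N \<Longrightarrow> g x = g' x"
    by (rule borel_representative[OF g]) blast
  have aeN: "AE x in \<mu>. x \<notin> N"
    using g'(2,3) borel_sets by (intro AE_not_in) (auto simp: null_sets_def)
  have "ae_curve (\<lambda>\<gamma> l. line_integral \<gamma> l g' \<noteq> \<infinity>)"
  proof (rule ae_curveI[OF g'(1)])
    have "(\<integral>\<^sup>+x. ennpow (g' x) p \<partial>\<mu>) = (\<integral>\<^sup>+x. ennpow (g x) p \<partial>\<mu>)"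
      by (intro nn_integral_cong_AE) (use aeN g'(4) in \<open>auto elim: eventually_mono\<close>)
    then show "(\<integral>\<^sup>+x. ennpow (g' x) p \<partial>\<mu>) < \<infinity>" using fin by simp
  qed auto
  from ae_curve_conj[OF this ae_curve_avoids_null_set[OF g'(2,3)]]
  show ?thesis
  proof (rule ae_curve_mono, elim conjE)
    fix \<gamma> l assume "line_integral \<gamma> l g' \<noteq> \<infinity>" and ae: "AE t in lebesgue_on {0..l}. \<gamma> t \<notin> N"
    moreover have "line_integral \<gamma> l g' = line_integral \<gamma> l g"
      unfolding line_integral_eq
      by (intro nn_integral_cong_AE) (use ae g'(4) in \<open>auto elim: eventually_mono\<close>)
    ultimately show "line_integral \<gamma> l g < \<infinity>" by (simp add: less_top)
  qed
qed

end

section \<open>Separability, and functions that are locally in \<open>L\<^sup>p\<close>\<close>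

context newtonian_setting begin

text \<open>
  The balls of radius \<open>e / 2\<close> around the points of \<open>S\<close> are disjoint and have positive measure, so
  that only finitely many of those with measure above a given bound have their centre in a given ball.
\<close>
lemma countable_separated:
  fixes S :: "'a set"
  assumes e: "0 < e" and sep: "\<And>x y. x \<in> S \<Longrightarrow> y \<in> S \<Longrightarrow> x \<noteq> y \<Longrightarrow> e \<le> dist x y"
  shows "countable S"
proof -
  fix x0 :: 'a
  define T where "T N m = {x \<in> S. dist x0 x < real N \<and> 1 / Suc m < measure \<mu> (ball x (e / 2))}" for N m :: nat
  have m_pos: "0 < measure \<mu> (ball x (e / 2))" for x
    using emeasure_ball_pos[of "e/2" x] emeasure_ball_finite[of x "e/2"] e
    by (simp add: measure_def enn2real_positive_iff)
  have "S \<subseteq> (\<Union>N. \<Union>m. T N m)"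
  proof
    fix x assume "x \<in> S"
    obtain N where "dist x0 x < real N" using reals_Archimedean2 by blast
    moreover obtain m where "1 / Suc m < measure \<mu> (ball x (e / 2))"
      using nat_approx_posE[OF m_pos[of x]] by blast
    ultimately show "x \<in> (\<Union>N. \<Union>m. T N m)" using \<open>x \<in> S\<close> by (auto simp: T_def)
  qed
  moreover have "finite (T N m)" for N m
  proof -
    let ?B = "ball x0 (real N + e)"
    have fB: "?B \<in> fmeasurable \<mu>"
      using emeasure_ball_finite[of x0 "real N + e"] by (auto simp: fmeasurable_def)
    have "card F \<le> Suc m * measure \<mu> ?B" if F: "finite F" "F \<subseteq> T N m" for F
    proof -
      have disj: "disjoint_family_on (\<lambda>x. ball x (e / 2)) F"
      proof (unfold disjoint_family_on_def, intro ballI impI)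
        fix x y assume xy: "x \<in> F" "y \<in> F" "x \<noteq> y"
        then have "e \<le> dist x y" using sep[of x y] F by (auto simp: T_def)
        then show "ball x (e / 2) \<inter> ball y (e / 2) = {}"
          by (intro disjoint_ballI) auto
      qed
      have sub: "ball x (e / 2) \<subseteq> ?B" if "x \<in> F" for x
      proof
        fix y assume "y \<in> ball x (e / 2)"
        then show "y \<in> ?B" using that F e dist_triangle[of x0 y x] by (force simp: T_def)
      qed
      have "card F * (1 / Suc m) = (\<Sum>x\<in>F. 1 / Suc m)" by simp
      also have "\<dots> \<le> (\<Sum>x\<in>F. measure \<mu> (ball x (e / 2)))"
        using F by (intro sum_mono) (auto simp: T_def)
      also have "\<dots> = measure \<mu> (\<Union>x\<in>F. ball x (e / 2))"
        using F emeasure_ball_finite by (intro measure_finite_Union[symmetric] disj) (auto simp: less_top[symmetric] image_subset_iff)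
      also have "\<dots> \<le> measure \<mu> ?B"
        by (intro measure_mono_fmeasurable fB) (use sub F in auto)
      finally show ?thesis by (simp add: field_simps)
    qed
    then have "card F \<le> nat \<lfloor>Suc m * measure \<mu> ?B\<rfloor>" if "F \<subseteq> T N m" "finite F" for F
      using that by (intro le_nat_floor)
    then show ?thesis by (rule finite_if_finite_subsets_card_bdd[THEN conjunct1])
  qed
  then have "countable (\<Union>N. \<Union>m. T N m)" by (intro countable_UN) (auto intro: countable_finite)
  ultimately show ?thesis by (rule countable_subset)
qed

text \<open>
  A maximal \<open>e\<close>-separated set is an \<open>e\<close>-net.
\<close>
lemma separable: obtains D :: "'a set" where "countable D" "\<And>x e. 0 < e \<Longrightarrow> \<exists>d\<in>D. dist d x < e"
proof -
  have net: "\<exists>D::'a set. countable D \<and> (\<forall>x. \<exists>d\<in>D. dist d x < e)" if e: "0 < e" for e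
  proof -
    let ?A = "{S::'a set. \<forall>x\<in>S. \<forall>y\<in>S. x \<noteq> y \<longrightarrow> e \<le> dist x y}"
    have "\<exists>M\<in>?A. \<forall>X\<in>?A. M \<subseteq> X \<longrightarrow> X = M"
    proof (rule subset_Zorn')
      fix C assume C: "subset.chain ?A C"
      have "e \<le> dist x y" if "x \<in> \<Union>C" "y \<in> \<Union>C" "x \<noteq> y" for x y
      proof -
        from that obtain X Y where XY: "X \<in> C" "x \<in> X" "Y \<in> C" "y \<in> Y" by auto
        then have "X \<subseteq> Y \<or> Y \<subseteq> X" using C unfolding subset.chain_def by blast
        then show ?thesis using XY that C unfolding subset.chain_def by blast
      qed
      then show "\<Union>C \<in> ?A" by auto
    qed
    then obtain M where M: "M \<in> ?A" "\<And>X. X \<in> ?A \<Longrightarrow> M \<subseteq> X \<Longrightarrow> X = M" by auto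
    have "\<exists>d\<in>M. dist d x < e" for x
    proof (rule ccontr)
      assume *: "\<not> (\<exists>d\<in>M. dist d x < e)"
      then have "insert x M \<in> ?A" using M(1) by (auto simp: not_less dist_commute)
      then have "insert x M = M" by (intro M(2) subset_insertI)
      then have "x \<in> M" by blast
      then have "\<not> dist x x < e" using * by blast
      then show False using e by simp
    qed
    moreover have "countable M" using M(1) by (intro countable_separated[OF e]) auto
    ultimately show ?thesis by blast
  qed
  have "\<forall>n. \<exists>D::'a set. countable D \<and> (\<forall>x. \<exists>d\<in>D. dist d x < 1 / Suc n)"
    by (intro allI net) auto
  then obtain D where D: "\<And>n. countable (D n :: 'a set)" "\<And>n x. \<exists>d\<in>D n. dist d x < 1 / Suc n" by metis
  show ?thesis
  proof (rule that[of "\<Union>n. D n"])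
    show "countable (\<Union>n. D n)" using D(1) by auto
    fix x and e :: real assume "0 < e"
    then obtain n where "1 / Suc n < e" using nat_approx_posE by blast
    then show "\<exists>d\<in>\<Union>n. D n. dist d x < e" using D(2)[of n x] by force
  qed
qed

text \<open>
  Countably many balls on which \<open>g\<^sup>p\<close> is integrable cover the space, and a curve is a finite
  concatenation of curves each of which lies in one of them.
\<close>
lemma ae_curve_finite_integral_loc:
  assumes "Lp_loc p \<mu> g"
  shows "ae_curve (\<lambda>\<gamma> l. (\<lambda>t. g (\<gamma> t)) \<in> borel_measurable (lebesgue_on {0..l}) \<and>
     (\<integral>\<^sup>+t. g (\<gamma> t) \<partial>lebesgue_on {0..l}) < \<infinity>)"
proof -
  have g[measurable]: "g \<in> borel_measurable \<mu>"
    and loc: "\<And>x. \<exists>r>0. (\<integral>\<^sup>+y\<in>ball x r. ennpow (g y) p \<partial>\<mu>) < \<infinity>"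
    using assms by (auto simp: Lp_loc_def)
  obtain D :: "'a set" where D: "countable D" "\<And>x e. 0 < e \<Longrightarrow> \<exists>d\<in>D. dist d x < e"
    by (rule separable) blast
  define I where "I = {(d, n). d \<in> D \<and> (\<integral>\<^sup>+y\<in>ball d (1 / Suc n). ennpow (g y) p \<partial>\<mu>) < \<infinity>}"
  have cI: "countable I"
    by (rule countable_subset[of _ "D \<times> (UNIV::nat set)"]) (auto simp: I_def D(1))
  have cover: "\<exists>(d, n)\<in>I. dist d x < 1 / Suc n" for x
  proof -
    obtain r where r: "r > 0" "(\<integral>\<^sup>+y\<in>ball x r. ennpow (g y) p \<partial>\<mu>) < \<infinity>" using loc by blast
    obtain n where n: "1 / Suc n < r / 2" using nat_approx_posE[of "r/2"] r(1) by auto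
    obtain d where d: "d \<in> D" "dist d x < 1 / Suc n" using D(2)[of "1 / Suc n" x] by auto
    have "ball d (1 / Suc n) \<subseteq> ball x r"
    proof
      fix y assume "y \<in> ball d (1 / Suc n)"
      then show "y \<in> ball x r" using d n dist_triangle[of x y d] by (simp add: dist_commute)
    qed
    then have "(\<integral>\<^sup>+y\<in>ball d (1 / Suc n). ennpow (g y) p \<partial>\<mu>) \<le> (\<integral>\<^sup>+y\<in>ball x r. ennpow (g y) p \<partial>\<mu>)"
      by (intro nn_integral_mono) (auto split: split_indicator)
    then have "(d, n) \<in> I" using d r by (auto simp: I_def)
    then show ?thesis using d by blast
  qed
  have neI: "I \<noteq> {}" using cover by blast
  define f where "f i = from_nat_into I i" for i
  have f: "range f = I" unfolding f_def using range_from_nat_into[OF neI cI] by simp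
  define U where "U i = ball (fst (f i)) (1 / Suc (snd (f i)))" for i
  have ae_i: "ae_curve (\<lambda>\<gamma> l. line_integral \<gamma> l (\<lambda>y. g y * indicator (U i) y) < \<infinity>)" for i
  proof (rule ae_curve_finite_integral)
    show "(\<lambda>y. g y * indicator (U i) y) \<in> borel_measurable \<mu>" unfolding U_def by measurable
    have "f i \<in> I" using f by auto
    have "(\<integral>\<^sup>+y. ennpow (g y * indicator (U i) y) p \<partial>\<mu>) = (\<integral>\<^sup>+y\<in>U i. ennpow (g y) p \<partial>\<mu>)"
      by (intro nn_integral_cong) (auto split: split_indicator)
    also have "\<dots> < \<infinity>" using \<open>f i \<in> I\<close> by (auto simp: I_def U_def split: prod.splits)
    finally show "(\<integral>\<^sup>+y. ennpow (g y * indicator (U i) y) p \<partial>\<mu>) < \<infinity>" .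
  qed
  from ae_curve_conj[OF ae_curve_measurable[OF g] ae_curve_all_nat[OF ae_i]]
  show ?thesis
  proof (rule ae_curve_mono, elim conjE, intro conjI)
    fix \<gamma> :: "real \<Rightarrow> 'a" and l assume \<gamma>: "arclength_curve UNIV \<gamma> l"
      and m[measurable]: "(\<lambda>t. g (\<gamma> t)) \<in> borel_measurable (lebesgue_on {0..l})"
      and fin: "\<forall>i. line_integral \<gamma> l (\<lambda>y. g y * indicator (U i) y) < \<infinity>"
    show "(\<lambda>t. g (\<gamma> t)) \<in> borel_measurable (lebesgue_on {0..l})" by fact
    have l: "0 \<le> l" using \<gamma> by (auto simp: arclength_curve_def)
    define P where "P a b \<longleftrightarrow> (0 \<le> a \<longrightarrow> b \<le> l \<longrightarrow> segint l a b (\<lambda>t. g (\<gamma> t)) < \<infinity>)" for a b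
    have "P 0 l"
      using l
    proof (induction rule: Bolzano)
      case (trans a b c)
      then show ?case
        using nn_integral_interval_split[OF m, of a b c] by (auto simp: P_def)
    next
      case (local x)
      obtain i where i: "\<gamma> x \<in> U i"
      proof -
        obtain d n where "(d, n) \<in> I" "dist d (\<gamma> x) < 1 / Suc n" using cover[of "\<gamma> x"] by auto
        then show ?thesis using f that unfolding U_def by (metis fst_conv snd_conv imageE mem_ball)
      qed
      define r where "r = 1 / Suc (snd (f i)) - dist (fst (f i)) (\<gamma> x)"
      have r: "r > 0" using i by (auto simp: U_def r_def)
      show ?case
      proof (intro exI[of _ r] conjI allI impI r)
        fix a b assume ab': "a \<le> x \<and> x \<le> b \<and> b - a < r"
        show "P a b" unfolding P_def
        proof (intro impI)
          assume "0 \<le> a" "b \<le> l"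
          note ab = ab' this
          have "\<gamma> t \<in> U i" if t: "t \<in> {a..b}" for t
          proof -
            have "dist (\<gamma> x) (\<gamma> t) \<le> \<bar>x - t\<bar>"
              using t ab local by (intro arclength_curve_dist_abs[OF \<gamma>]) auto
            also have "\<dots> < r" using t ab by auto
            finally show ?thesis
              using dist_triangle[of "fst (f i)" "\<gamma> t" "\<gamma> x"] by (auto simp: U_def r_def)
          qed
          then have "segint l a b (\<lambda>t. g (\<gamma> t)) \<le> line_integral \<gamma> l (\<lambda>y. g y * indicator (U i) y)"
            unfolding line_integral_eq by (intro nn_integral_mono) (auto split: split_indicator)
          then show "segint l a b (\<lambda>t. g (\<gamma> t)) < \<infinity>"
            using fin by (meson order_le_less_trans)
        qed
      qed
    qed
    then show "(\<integral>\<^sup>+t. g (\<gamma> t) \<partial>lebesgue_on {0..l}) < \<infinity>"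
      using line_integral_eq'[of \<gamma> l g] by (simp add: line_integral_eq P_def)
  qed
qed

section \<open>Calculus of weak upper gradients\<close>

abbreviation wug :: "('a \<Rightarrow> real) \<Rightarrow> ('a \<Rightarrow> ennreal) \<Rightarrow> bool" where
  "wug u g \<equiv> weak_upper_gradient p \<mu> (\<lambda>x. ereal (u x)) g"

lemma ext_diff_ereal [simp]: "ext_diff (ereal a) (ereal b) = ennreal \<bar>a - b\<bar>"
  by (simp add: ext_diff_def)

text \<open>
  Almost every curve has only nonexceptional subcurves, so the inequality for the end points
  turns into one for any two points of the curve.
\<close>
lemma wug_iff:
  "wug u g \<longleftrightarrow> g \<in> borel_measurable \<mu> \<and> ae_curve (\<lambda>\<gamma> l. controls l (\<lambda>t. u (\<gamma> t)) (\<lambda>t. g (\<gamma> t)))"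
  (is "_ \<longleftrightarrow> _ \<and> ae_curve ?Q")
proof -
  have "ae_curve ?Q \<longleftrightarrow> ae_curve (\<lambda>\<gamma> l. ext_diff (u (\<gamma> 0)) (u (\<gamma> l)) \<le> line_integral \<gamma> l g)"
    (is "_ \<longleftrightarrow> ae_curve ?P") if g: "g \<in> borel_measurable \<mu>"
  proof
    assume "ae_curve ?Q"
    then show "ae_curve ?P"
    proof (rule ae_curve_mono)
      fix \<gamma> l assume "arclength_curve UNIV \<gamma> l" "?Q \<gamma> l"
      then show "?P \<gamma> l"
        using controlsD[of l "\<lambda>t. u (\<gamma> t)" _ 0 l] by (auto simp: arclength_curve_def line_integral_eq')
    qed
  next
    assume "ae_curve ?P"
    from ae_curve_conj[OF ae_curve_measurable[OF g] ae_curve_subcurves[OF this]]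
    show "ae_curve ?Q"
    proof (rule ae_curve_mono, elim conjE)
      fix \<gamma> :: "real \<Rightarrow> 'a" and l assume m: "(\<lambda>t. g (\<gamma> t)) \<in> borel_measurable (lebesgue_on {0..l})"
        and *: "\<forall>a b. 0 \<le> a \<and> a < b \<and> b \<le> l \<longrightarrow> ?P (\<lambda>t. \<gamma> (a + t)) (b - a)"
      show "?Q \<gamma> l" unfolding controls_def
      proof (intro allI impI)
        fix a b assume ab: "0 \<le> a \<and> a \<le> b \<and> b \<le> l"
        show "ennreal \<bar>u (\<gamma> a) - u (\<gamma> b)\<bar> \<le> segint l a b (\<lambda>t. g (\<gamma> t))"
        proof (cases "a = b")
          case False
          then show ?thesis
            using *[rule_format, of a b] line_integral_subcurve[of g \<gamma> l a b, OF m] ab by simp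
        qed simp
      qed
    qed
  qed
  then show ?thesis
    unfolding weak_upper_gradient_def ae_curve_def by auto
qed

lemma wugD_measurable: "wug u g \<Longrightarrow> g \<in> borel_measurable \<mu>"
  by (simp add: wug_iff)

lemma wug_ae_curve:
  assumes "wug u g" "Lp_loc p \<mu> g"
  shows "ae_curve (\<lambda>\<gamma> l. controls l (\<lambda>t. u (\<gamma> t)) (\<lambda>t. g (\<gamma> t)) \<and>
     (\<lambda>t. g (\<gamma> t)) \<in> borel_measurable (lebesgue_on {0..l}) \<and>
     (\<integral>\<^sup>+t. g (\<gamma> t) \<partial>lebesgue_on {0..l}) < \<infinity>)"
  using assms wug_iff by (intro ae_curve_conj ae_curve_finite_integral_loc) auto

lemma Lp_loc_le:
  assumes "Lp_loc p \<mu> g" "h \<in> borel_measurable \<mu>" "\<And>x. h x \<le> g x"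
  shows "Lp_loc p \<mu> h"
  unfolding Lp_loc_def
proof (intro conjI ballI assms)
  fix x assume "x \<in> space \<mu>"
  then obtain r where r: "r > 0" "(\<integral>\<^sup>+y\<in>ball x r. ennpow (g y) p \<partial>\<mu>) < \<infinity>"
    using assms(1) unfolding Lp_loc_def by blast
  have "(\<integral>\<^sup>+y\<in>ball x r. ennpow (h y) p \<partial>\<mu>) \<le> (\<integral>\<^sup>+y\<in>ball x r. ennpow (g y) p \<partial>\<mu>)"
    by (intro nn_integral_mono mult_right_mono ennpow_mono assms p_pos) auto
  then show "\<exists>r>0. (\<integral>\<^sup>+y\<in>ball x r. ennpow (h y) p \<partial>\<mu>) < \<infinity>" using r by (meson order_le_less_trans)
qed

lemma wug_min:
  assumes g: "wug u g" "Lp_loc p \<mu> g" and h: "wug u h" "Lp_loc p \<mu> h"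
  shows "wug u (\<lambda>x. min (g x) (h x))"
  unfolding wug_iff
proof
  show "(\<lambda>x. min (g x) (h x)) \<in> borel_measurable \<mu>"
    using g h by (intro borel_measurable_min) (auto dest: wugD_measurable)
  show "ae_curve (\<lambda>\<gamma> l. controls l (\<lambda>t. u (\<gamma> t)) (\<lambda>t. min (g (\<gamma> t)) (h (\<gamma> t))))"
    by (rule ae_curve_mono[OF ae_curve_conj[OF wug_ae_curve[OF g] wug_ae_curve[OF h]]])
       (auto intro: controls_min)
qed

lemma wug_INF:
  fixes g :: "nat \<Rightarrow> 'a \<Rightarrow> ennreal"
  assumes g: "\<And>n. wug u (g n)" "\<And>n. Lp_loc p \<mu> (g n)" and dec: "\<And>n x. g (Suc n) x \<le> g n x"
  shows "wug u (\<lambda>x. INF n. g n x)"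
  unfolding wug_iff
proof
  have [measurable]: "g n \<in> borel_measurable \<mu>" for n using g by (auto dest: wugD_measurable)
  show m: "(\<lambda>x. INF n. g n x) \<in> borel_measurable \<mu>" by measurable
  have dec': "decseq (\<lambda>n. g n x)" for x using dec by (intro decseq_SucI)
  show "ae_curve (\<lambda>\<gamma> l. controls l (\<lambda>t. u (\<gamma> t)) (\<lambda>t. INF n. g n (\<gamma> t)))"
  proof (rule ae_curve_mono[OF ae_curve_conj[OF ae_curve_measurable[OF m] ae_curve_all_nat[OF wug_ae_curve[OF g]]]], elim conjE)
    fix \<gamma> :: "real \<Rightarrow> 'a" and l
    assume m: "(\<lambda>t. INF n. g n (\<gamma> t)) \<in> borel_measurable (lebesgue_on {0..l})"
      and *: "\<forall>n. controls l (\<lambda>t. u (\<gamma> t)) (\<lambda>t. g n (\<gamma> t)) \<and>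
        (\<lambda>t. g n (\<gamma> t)) \<in> borel_measurable (lebesgue_on {0..l}) \<and>
        (\<integral>\<^sup>+t. g n (\<gamma> t) \<partial>lebesgue_on {0..l}) < \<infinity>"
    show "controls l (\<lambda>t. u (\<gamma> t)) (\<lambda>t. INF n. g n (\<gamma> t))"
    proof (rule controls_lim[where K="\<lambda>n t. g n (\<gamma> t)" and W="\<lambda>t. g 0 (\<gamma> t)"])
      show "AE t in lebesgue_on {0..l}. g n (\<gamma> t) \<le> g 0 (\<gamma> t)" for n
        using dec' by (intro AE_I2) (auto simp: decseq_def)
      show "AE t in lebesgue_on {0..l}. (\<lambda>n. g n (\<gamma> t)) \<longlonglongrightarrow> (INF n. g n (\<gamma> t))"
        by (intro AE_I2 LIMSEQ_INF dec')
    qed (use m * in auto)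
  qed
qed

lemma wug_contraction:
  assumes "wug u g" "\<And>x y. \<bar>v x - v y\<bar> \<le> \<bar>u x - u y\<bar>"
  shows "wug v g"
  using assms unfolding wug_iff
  by (auto elim!: ae_curve_mono intro: controls_contraction)

lemma wug_nonzero:
  assumes g: "wug u g" "Lp_loc p \<mu> g" and u: "continuous_on UNIV u"
  shows "wug u (\<lambda>x. if u x = 0 then 0 else g x)"
  unfolding wug_iff
proof
  have [measurable]: "u \<in> borel_measurable \<mu>" by (rule continuous_measurable[OF u])
  have [measurable]: "g \<in> borel_measurable \<mu>" using g by (auto dest: wugD_measurable)
  show "(\<lambda>x. if u x = 0 then 0 else g x) \<in> borel_measurable \<mu>" by measurable
  show "ae_curve (\<lambda>\<gamma> l. controls l (\<lambda>t. u (\<gamma> t)) (\<lambda>t. if u (\<gamma> t) = 0 then 0 else g (\<gamma> t)))"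
  proof (rule ae_curve_mono[OF wug_ae_curve[OF g]], elim conjE)
    fix \<gamma> l assume \<gamma>: "arclength_curve UNIV \<gamma> l" and *: "controls l (\<lambda>t. u (\<gamma> t)) (\<lambda>t. g (\<gamma> t))"
      "(\<lambda>t. g (\<gamma> t)) \<in> borel_measurable (lebesgue_on {0..l})"
    have "continuous_on {0..l} (\<lambda>t. u (\<gamma> t))"
      by (rule continuous_on_compose2[OF u arclength_curve_continuous[OF \<gamma>]]) auto
    with controls_nonzero[OF *(2,1)]
    show "controls l (\<lambda>t. u (\<gamma> t)) (\<lambda>t. if u (\<gamma> t) = 0 then 0 else g (\<gamma> t))" .
  qed
qed

lemma wug_add:
  assumes g: "wug u g" and h: "wug v h"
  shows "wug (\<lambda>x. u x + v x) (\<lambda>x. g x + h x)"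
  unfolding wug_iff
proof
  have [measurable]: "g \<in> borel_measurable \<mu>" "h \<in> borel_measurable \<mu>" using g h by (auto dest: wugD_measurable)
  show "(\<lambda>x. g x + h x) \<in> borel_measurable \<mu>" by measurable
  have "ae_curve (\<lambda>\<gamma> l. (controls l (\<lambda>t. u (\<gamma> t)) (\<lambda>t. g (\<gamma> t)) \<and> controls l (\<lambda>t. v (\<gamma> t)) (\<lambda>t. h (\<gamma> t))) \<and>
     (\<lambda>t. g (\<gamma> t)) \<in> borel_measurable (lebesgue_on {0..l}) \<and> (\<lambda>t. h (\<gamma> t)) \<in> borel_measurable (lebesgue_on {0..l}))"
    using g h by (intro ae_curve_conj ae_curve_measurable) (auto simp: wug_iff)
  then show "ae_curve (\<lambda>\<gamma> l. controls l (\<lambda>t. u (\<gamma> t) + v (\<gamma> t)) (\<lambda>t. g (\<gamma> t) + h (\<gamma> t)))"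
    by (rule ae_curve_mono) (auto intro: controls_add)
qed

lemma wug_product:
  assumes g: "wug v g" "Lp_loc p \<mu> g" and v: "continuous_on UNIV v" "\<And>x. 0 \<le> v x"
    and \<psi>: "\<And>x y. \<bar>\<psi> x - \<psi> y\<bar> \<le> L * dist x y" "\<And>x. 0 \<le> \<psi> x" "continuous_on UNIV \<psi>" and L: "0 \<le> L"
  shows "wug (\<lambda>x. \<psi> x * v x) (\<lambda>x. ennreal (\<psi> x) * g x + ennreal (L * v x))"
  unfolding wug_iff
proof
  have [measurable]: "v \<in> borel_measurable \<mu>" "\<psi> \<in> borel_measurable \<mu>" by (auto intro!: continuous_measurable v \<psi>)
  have [measurable]: "g \<in> borel_measurable \<mu>" using g by (auto dest: wugD_measurable)
  show "(\<lambda>x. ennreal (\<psi> x) * g x + ennreal (L * v x)) \<in> borel_measurable \<mu>" by measurable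
  show "ae_curve (\<lambda>\<gamma> l. controls l (\<lambda>t. \<psi> (\<gamma> t) * v (\<gamma> t)) (\<lambda>t. ennreal (\<psi> (\<gamma> t)) * g (\<gamma> t) + ennreal (L * v (\<gamma> t))))"
  proof (rule ae_curve_mono[OF wug_ae_curve[OF g]], elim conjE)
    fix \<gamma> l assume \<gamma>: "arclength_curve UNIV \<gamma> l" and *: "controls l (\<lambda>t. v (\<gamma> t)) (\<lambda>t. g (\<gamma> t))"
      "(\<lambda>t. g (\<gamma> t)) \<in> borel_measurable (lebesgue_on {0..l})" "(\<integral>\<^sup>+t. g (\<gamma> t) \<partial>lebesgue_on {0..l}) < \<infinity>"
    have "continuous_on {0..l} (\<lambda>t. v (\<gamma> t))"
      by (rule continuous_on_compose2[OF v(1) arclength_curve_continuous[OF \<gamma>]]) auto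
    moreover have "\<bar>\<psi> (\<gamma> s) - \<psi> (\<gamma> t)\<bar> \<le> L * \<bar>s - t\<bar>" if "s \<in> {0..l}" "t \<in> {0..l}" for s t
    using \<psi>(1)[of "\<gamma> s" "\<gamma> t"] arclength_curve_dist_abs[OF \<gamma> that] L by (meson mult_left_mono order_trans)
    ultimately show "controls l (\<lambda>t. \<psi> (\<gamma> t) * v (\<gamma> t)) (\<lambda>t. ennreal (\<psi> (\<gamma> t)) * g (\<gamma> t) + ennreal (L * v (\<gamma> t)))"
      using v \<psi> L * by (intro controls_product) auto
  qed
qed

section \<open>Existence of minimal weak upper gradients\<close>

lemma sigma_finite: "sigma_finite_measure \<mu>"
proof
  fix x0 :: 'a
  show "\<exists>A. countable A \<and> A \<subseteq> sets \<mu> \<and> \<Union>A = space \<mu> \<and> (\<forall>a\<in>A. emeasure \<mu> a \<noteq> \<infinity>)"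
  proof (intro exI[of _ "range (\<lambda>n::nat. ball x0 n)"] conjI)
    show "\<Union>(range (\<lambda>n::nat. ball x0 n)) = space \<mu>"
      using reals_Archimedean2 by (auto simp: set_eq_iff)
  qed (use emeasure_ball_finite in \<open>auto simp: less_top[symmetric]\<close>)
qed

text \<open>
  A minimal weak upper gradient is found by maximizing the integral of \<open>w / (1 + g)\<close> for a fixed
  positive integrable \<open>w\<close>; this is finite no matter how large \<open>g\<close> is.  As the admissible functions are
  closed under minima and decreasing limits, a maximizing sequence can be chosen decreasing, and its
  limit \<open>m\<close> is a maximizer.  For any other admissible \<open>h\<close>, the minimum of \<open>m\<close> and \<open>h\<close> cannot do
  better, so it equals \<open>m\<close> almost everywhere.
\<close>
lemma ex_minimal_wug:
  assumes "wug u g0" "Lp_loc p \<mu> g0"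
  shows "is_minimal_wug p \<mu> (\<lambda>x. ereal (u x)) (minimal_wug p \<mu> (\<lambda>x. ereal (u x)))"
proof -
  define \<G> where "\<G> = {g. wug u g \<and> Lp_loc p \<mu> g}"
  have \<G>_meas: "g \<in> borel_measurable \<mu>" if "g \<in> \<G>" for g
    using that by (auto simp: \<G>_def dest: wugD_measurable)
  have \<G>_min: "(\<lambda>x. min (g x) (h x)) \<in> \<G>" if "g \<in> \<G>" "h \<in> \<G>" for g h
    using that \<G>_meas[OF that(1)] \<G>_meas[OF that(2)] unfolding \<G>_def
    by (auto intro!: wug_min Lp_loc_le[of g])
  interpret sigma_finite_measure \<mu> by (rule sigma_finite)
  obtain w where w[measurable]: "w \<in> borel_measurable \<mu>" and w_fin: "integral\<^sup>N \<mu> w \<noteq> \<infinity>"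
    and w_pos: "\<And>x. 0 < w x" "\<And>x. w x < \<infinity>"
    using Ex_finite_integrable_function by auto
  define J where "J g = (\<integral>\<^sup>+x. w x * inverse (1 + g x) \<partial>\<mu>)" for g
  have J_mono: "J h \<le> J g" if "\<And>x. g x \<le> h x" for g h
    unfolding J_def by (intro nn_integral_mono mult_left_mono) (auto intro!: ennreal_inverse_antimono that)
  have J_le: "J g \<le> integral\<^sup>N \<mu> w" for g
  proof -
    have "inverse (1 + g x) \<le> 1" for x
    proof -
      have "inverse (1 + g x) \<le> inverse 1" by (rule ennreal_inverse_antimono) simp
      then show ?thesis by simp
    qed
    then have "w x * inverse (1 + g x) \<le> w x * 1" for x by (intro mult_left_mono) auto
    then show ?thesis unfolding J_def by (intro nn_integral_mono) simp
  qed
  have "\<G> \<noteq> {}" using assms by (auto simp: \<G>_def)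
  then obtain h :: "nat \<Rightarrow> ennreal" where h: "range h \<subseteq> J ` \<G>" "(SUP g\<in>\<G>. J g) = (SUP n. h n)"
    using ennreal_SUP_countable_SUP[of \<G> J] by metis
  have "\<forall>n. \<exists>g\<in>\<G>. J g = h n" using h(1) by (metis imageE image_subset_iff UNIV_I)
  then obtain f where f: "\<And>n. f n \<in> \<G>" "\<And>n. J (f n) = h n" by metis
  define g where "g n = rec_nat (f 0) (\<lambda>n g x. min (g x) (f (Suc n) x)) n" for n
  have g_simps: "g 0 = f 0" "g (Suc n) = (\<lambda>x. min (g n x) (f (Suc n) x))" for n
    by (auto simp: g_def)
  have g: "g n \<in> \<G>" for n by (induction n) (auto simp: g_simps f \<G>_min)
  have g_le: "g n x \<le> f n x" for n x by (cases n) (auto simp: g_simps)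
  define m where "m x = (INF n. g n x)" for x
  have m: "m \<in> \<G>"
  proof -
    have 1: "wug u m" unfolding m_def
      using g by (intro wug_INF) (auto simp: \<G>_def g_simps)
    moreover have "Lp_loc p \<mu> m"
      by (rule Lp_loc_le[of "g 0"]) (use g 1 in \<open>auto simp: \<G>_def m_def intro: INF_lower dest: wugD_measurable\<close>)
    ultimately show ?thesis by (simp add: \<G>_def)
  qed
  have Jm: "J g' \<le> J m" if "g' \<in> \<G>" for g'
  proof -
    have "J g' \<le> (SUP n. h n)" unfolding h(2)[symmetric] by (rule SUP_upper[OF that])
    also have "\<dots> \<le> J m"
    proof (rule SUP_least)
      fix n
      have "m x \<le> f n x" for x
        unfolding m_def by (rule INF_lower2[of n]) (auto intro: g_le)
      then show "h n \<le> J m" unfolding f(2)[symmetric] by (rule J_mono)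
    qed
    finally show ?thesis .
  qed
  have "AE x in \<mu>. m x \<le> h x" if h: "h \<in> \<G>" for h
  proof -
    have [measurable]: "m \<in> borel_measurable \<mu>" "h \<in> borel_measurable \<mu>" using h m \<G>_meas by auto
    let ?k = "\<lambda>x. min (m x) (h x)"
    have "J ?k \<le> J m" using Jm[OF \<G>_min[OF m h]] .
    have mono: "w x * inverse (1 + m x) \<le> w x * inverse (1 + ?k x)" for x
      by (intro mult_left_mono ennreal_inverse_antimono) auto
    have "AE x in \<mu>. w x * inverse (1 + ?k x) = w x * inverse (1 + m x)"
    proof (rule ccontr)
      assume "\<not> (AE x in \<mu>. w x * inverse (1 + ?k x) = w x * inverse (1 + m x))"
      then have "\<not> (AE x in \<mu>. w x * inverse (1 + ?k x) \<le> w x * inverse (1 + m x))"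
        by (rule contrapos_nn) (erule eventually_mono, intro antisym mono)
      then have "J m < J ?k"
        unfolding J_def
        by (intro nn_integral_less AE_I2 mono)
           (use J_le[of m] w_fin in \<open>auto simp: J_def top_unique\<close>)
      then show False using \<open>J ?k \<le> J m\<close> by simp
    qed
    then show ?thesis
    proof (rule eventually_mono)
      fix x assume "w x * inverse (1 + ?k x) = w x * inverse (1 + m x)"
      then have "inverse (1 + ?k x) = inverse (1 + m x)"
        using w_pos[of x] by (auto simp: ennreal_mult_cancel_left)
      then have "1 + ?k x = 1 + m x" by (rule ennreal_inverse_inj)
      then have "?k x = m x" by (simp add: ennreal_add_left_cancel)
      then show "m x \<le> h x" by (metis min.cobounded2)
    qed
  qed
  then have "is_minimal_wug p \<mu> (\<lambda>x. ereal (u x)) m"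
    using m by (auto simp: is_minimal_wug_def \<G>_def)
  then show ?thesis unfolding minimal_wug_def by (rule someI[of "is_minimal_wug p \<mu> (\<lambda>x. ereal (u x))"])
qed

end

section \<open>Integrals of \<open>p\<close>th powers\<close>

context newtonian_setting begin

text \<open>
  The \<open>p\<close>th power of the \<open>L\<^sup>p\<close> norm on \<open>A\<close>.
\<close>
definition pint :: "'a set \<Rightarrow> ('a \<Rightarrow> ennreal) \<Rightarrow> ennreal" where
  "pint A g = (\<integral>\<^sup>+x\<in>A. ennpow (g x) p \<partial>\<mu>)"

lemma pint_mono:
  assumes "\<And>x. x \<in> A \<Longrightarrow> x \<in> B \<and> g x \<le> h x"
  shows "pint A g \<le> pint B h"
  unfolding pint_def using assms p_pos
  by (intro nn_integral_mono) (auto split: split_indicator intro: ennpow_mono)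

lemma pint_mono_AE: "AE x in \<mu>. g x \<le> h x \<Longrightarrow> pint A g \<le> pint A h"
  unfolding pint_def
  by (intro nn_integral_mono_AE) (auto elim!: eventually_mono intro!: mult_right_mono ennpow_mono p_pos)

lemma pint_add_le:
  assumes [measurable]: "g \<in> borel_measurable \<mu>" "h \<in> borel_measurable \<mu>" "A \<in> sets \<mu>"
  shows "pint A (\<lambda>x. g x + h x) \<le> ennreal (2 powr p) * (pint A g + pint A h)"
proof -
  have "pint A (\<lambda>x. g x + h x) \<le> (\<integral>\<^sup>+x. ennreal (2 powr p) * (ennpow (g x) p * indicator A x + ennpow (h x) p * indicator A x) \<partial>\<mu>)"
    unfolding pint_def
    by (intro nn_integral_mono) (use ennpow_add_le[OF p_pos] in \<open>auto split: split_indicator\<close>)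
  also have "\<dots> = ennreal (2 powr p) * (pint A g + pint A h)"
    unfolding pint_def by (simp add: nn_integral_cmult nn_integral_add)
  finally show ?thesis .
qed

lemma pint_cmult:
  assumes [measurable]: "g \<in> borel_measurable \<mu>" "A \<in> sets \<mu>" and "0 \<le> c"
  shows "pint A (\<lambda>x. ennreal c * g x) = ennreal (c powr p) * pint A g"
proof -
  have "pint A (\<lambda>x. ennreal c * g x) = (\<integral>\<^sup>+x. ennreal (c powr p) * (ennpow (g x) p * indicator A x) \<partial>\<mu>)"
    unfolding pint_def using assms(3)
    by (intro nn_integral_cong) (auto simp: ennpow_mult[OF p_pos] ennpow_ennreal mult.assoc)
  then show ?thesis unfolding pint_def by (simp add: nn_integral_cmult)
qed

text \<open>
  Balls need not be relatively compact, so this is more than membership in \<open>L\<^sup>p\<^sub>l\<^sub>o\<^sub>c\<close>.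
\<close>
definition Lp_bounded :: "('a \<Rightarrow> ennreal) \<Rightarrow> bool" where
  "Lp_bounded g \<longleftrightarrow> g \<in> borel_measurable \<mu> \<and> (\<forall>x r. pint (ball x r) g < \<infinity>)"

lemma Lp_bounded_loc: "Lp_bounded g \<Longrightarrow> Lp_loc p \<mu> g"
  unfolding Lp_bounded_def Lp_loc_def pint_def by (auto intro: zero_less_one)

lemma Lp_bounded_mono:
  assumes "Lp_bounded g" "h \<in> borel_measurable \<mu>" "\<And>x. h x \<le> g x"
  shows "Lp_bounded h"
  using assms pint_mono[of "ball x r" "ball x r" h g for x r] unfolding Lp_bounded_def
  by (meson order_le_less_trans)

lemma Lp_bounded_add:
  assumes "Lp_bounded g" "Lp_bounded h"
  shows "Lp_bounded (\<lambda>x. g x + h x)"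
  unfolding Lp_bounded_def
proof (intro conjI allI)
  fix x r
  have "pint (ball x r) (\<lambda>x. g x + h x) \<le> ennreal (2 powr p) * (pint (ball x r) g + pint (ball x r) h)"
    using assms by (intro pint_add_le) (auto simp: Lp_bounded_def)
  also have "\<dots> < \<infinity>" using assms by (auto simp: Lp_bounded_def ennreal_mult_less_top)
  finally show "pint (ball x r) (\<lambda>x. g x + h x) < \<infinity>" .
qed (use assms in \<open>auto simp: Lp_bounded_def\<close>)

lemma Lp_bounded_cmult:
  assumes "Lp_bounded g" "0 \<le> c"
  shows "Lp_bounded (\<lambda>x. ennreal c * g x)"
  using assms unfolding Lp_bounded_def by (auto simp: pint_cmult ennreal_mult_less_top)

lemma Lp_bounded_const: "Lp_bounded (\<lambda>x. ennreal c)"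
proof -
  have "pint (ball x r) (\<lambda>x. ennreal c) < \<infinity>" for x r
    using emeasure_ball_finite[of x r]
    by (simp add: pint_def nn_integral_cmult_indicator ennreal_mult_less_top ennpow_less_top)
  then show ?thesis by (auto simp: Lp_bounded_def)
qed

section \<open>Gluing of weak upper gradients\<close>

lemma p_ae_curve_restrict:
  assumes "p_ae_curve p (restrict_space \<mu> (ball x r)) P"
  shows "ae_curve (\<lambda>\<gamma> l. \<gamma> ` {0..l} \<subseteq> ball x r \<longrightarrow> P \<gamma> l)"
proof -
  let ?B = "ball x r"
  have sp: "space (restrict_space \<mu> ?B) = ?B" by (simp add: space_restrict_space)
  obtain \<rho> :: "'a \<Rightarrow> ennreal" where \<rho>: "\<rho> \<in> borel_measurable (restrict_space borel ?B)"
    "(\<integral>\<^sup>+x. ennpow (\<rho> x) p \<partial>restrict_space \<mu> ?B) < \<infinity>"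
    "\<And>\<gamma> l. arclength_curve ?B \<gamma> l \<Longrightarrow> \<not> P \<gamma> l \<Longrightarrow> line_integral \<gamma> l \<rho> = \<infinity>"
    using assms unfolding p_ae_curve_def sp by blast
  show ?thesis
  proof (rule ae_curveI)
    show "(\<lambda>x. \<rho> x * indicator ?B x) \<in> borel_measurable borel"
      using \<rho>(1) by (subst (asm) borel_measurable_restrict_space_iff_ennreal) auto
    have "(\<integral>\<^sup>+x. ennpow (\<rho> x * indicator ?B x) p \<partial>\<mu>) = (\<integral>\<^sup>+x. ennpow (\<rho> x) p \<partial>restrict_space \<mu> ?B)"
      by (subst nn_integral_restrict_space) (auto intro!: nn_integral_cong split: split_indicator)
    then show "(\<integral>\<^sup>+x. ennpow (\<rho> x * indicator ?B x) p \<partial>\<mu>) < \<infinity>" using \<rho>(2) by simp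
    fix \<gamma> l assume \<gamma>: "arclength_curve UNIV \<gamma> l" "line_integral \<gamma> l (\<lambda>x. \<rho> x * indicator ?B x) \<noteq> \<infinity>"
    show "\<gamma> ` {0..l} \<subseteq> ?B \<longrightarrow> P \<gamma> l"
    proof (intro impI, rule ccontr)
      assume sub: "\<gamma> ` {0..l} \<subseteq> ?B" and "\<not> P \<gamma> l"
      then have "line_integral \<gamma> l \<rho> = \<infinity>" using \<gamma>(1) by (intro \<rho>(3)) (auto simp: arclength_curve_def)
      moreover have "line_integral \<gamma> l \<rho> = line_integral \<gamma> l (\<lambda>x. \<rho> x * indicator ?B x)"
        unfolding line_integral_def
      proof (intro nn_integral_cong)
        fix t
        show "\<rho> (\<gamma> t) * indicator {0..l} t = \<rho> (\<gamma> t) * indicator ?B (\<gamma> t) * indicator {0..l} t"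
          using subsetD[OF sub, of "\<gamma> t"] by (auto split: split_indicator)
      qed
      ultimately show False using \<gamma>(2) by simp
    qed
  qed
qed

lemma newtonian_finite:
  assumes "v \<in> newtonian p M"
  shows "v \<in> borel_measurable M" "(\<integral>\<^sup>+x. ennpow (e2ennreal \<bar>v x\<bar>) p \<partial>M) < \<infinity>"
    "\<exists>g. weak_upper_gradient p M v g \<and> (\<integral>\<^sup>+x. ennpow (g x) p \<partial>M) < \<infinity>"
proof -
  show "v \<in> borel_measurable M" using assms by (simp add: newtonian_def)
  have "(\<integral>\<^sup>+x. ennpow (e2ennreal \<bar>v x\<bar>) p \<partial>M) +
             (INF g \<in> {g. weak_upper_gradient p M v g}. \<integral>\<^sup>+x. ennpow (g x) p \<partial>M) < \<infinity>"
    using assms by (simp add: newtonian_def newtonian_norm_def ennpow_less_top)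
  then show "(\<integral>\<^sup>+x. ennpow (e2ennreal \<bar>v x\<bar>) p \<partial>M) < \<infinity>"
    "\<exists>g. weak_upper_gradient p M v g \<and> (\<integral>\<^sup>+x. ennpow (g x) p \<partial>M) < \<infinity>"
    by (auto simp: INF_less_iff)
qed

lemma nn_integral_restrict_ball:
  "(\<integral>\<^sup>+x. f x \<partial>restrict_space \<mu> (ball z r)) = (\<integral>\<^sup>+x\<in>ball z r. f x \<partial>\<mu>)"
  by (subst nn_integral_restrict_space) auto

lemma newtonian_ball_Lp_bounded:
  assumes u: "continuous_on UNIV u"
    and N: "\<And>x r. (\<lambda>y. ereal (u y)) \<in> newtonian p (restrict_space \<mu> (ball x r))"
  shows "Lp_bounded (\<lambda>x. ennreal \<bar>u x\<bar>)"
  unfolding Lp_bounded_def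
proof (intro conjI allI)
  have [measurable]: "u \<in> borel_measurable \<mu>" by (rule continuous_measurable[OF u])
  show "(\<lambda>x. ennreal \<bar>u x\<bar>) \<in> borel_measurable \<mu>" by measurable
  fix x r
  show "pint (ball x r) (\<lambda>x. ennreal \<bar>u x\<bar>) < \<infinity>"
    using newtonian_finite(2)[OF N[of x r]] by (simp add: nn_integral_restrict_ball pint_def)
qed

text \<open>
  On each ball \<open>B n\<close> around \<open>x0\<close> there is a weak upper gradient \<open>g n\<close> of the restriction of \<open>u\<close>, but
  the \<open>g n\<close> for different \<open>n\<close> are unrelated.  They are cut off to the overlapping annuli \<open>A n\<close> and
  combined by a supremum: every short piece of a curve lies in one of the annuli, and every ball meets
  only finitely many of them.
\<close>
lemma wug_glue:
  assumes u: "continuous_on UNIV u"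
    and N: "\<And>x r. (\<lambda>y. ereal (u y)) \<in> newtonian p (restrict_space \<mu> (ball x r))"
  shows "\<exists>g. wug u g \<and> Lp_bounded g"
proof -
  fix x0 :: 'a
  define B where "B n = ball x0 (real n)" for n :: nat
  have "\<forall>n. \<exists>g. weak_upper_gradient p (restrict_space \<mu> (B n)) (\<lambda>y. ereal (u y)) g \<and>
      (\<integral>\<^sup>+x. ennpow (g x) p \<partial>restrict_space \<mu> (B n)) < \<infinity>"
    unfolding B_def by (intro allI newtonian_finite(3) N)
  then obtain g where g: "\<And>n. weak_upper_gradient p (restrict_space \<mu> (B n)) (\<lambda>y. ereal (u y)) (g n)"
    "\<And>n. (\<integral>\<^sup>+x. ennpow (g n x) p \<partial>restrict_space \<mu> (B n)) < \<infinity>" by metis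
  define A where "A n = {x. real n - 2 < dist x0 x \<and> dist x0 x < real n}" for n :: nat
  have [measurable]: "A n \<in> sets \<mu>" "B n \<in> sets \<mu>" for n
    unfolding A_def B_def by (intro borel_sets borel_open open_Collect_conj open_Collect_less continuous_intros, simp)
  define h where "h n x = g n x * indicator (B n) x" for n x
  have h[measurable]: "h n \<in> borel_measurable \<mu>" for n
    using g(1)[of n] unfolding weak_upper_gradient_def h_def
    by (subst (asm) borel_measurable_restrict_space_iff_ennreal) auto
  define G where "G x = (SUP n. h n x * indicator (A n) x)" for x
  have Gm[measurable]: "G \<in> borel_measurable \<mu>" unfolding G_def by measurable
  have "Lp_bounded G"
    unfolding Lp_bounded_def
  proof (intro conjI allI Gm)
    fix x r
    obtain N where N: "dist x0 x + r < real N" using reals_Archimedean2 by blast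
    have sub: "ball x r \<subseteq> B N"
    proof
      fix y assume "y \<in> ball x r"
      then show "y \<in> B N" using N dist_triangle[of x0 y x] by (simp add: B_def)
    qed
    let ?f = "\<lambda>n x. ennpow (h n x * indicator (A n) x) p * indicator (B N) x"
    have z: "?f n x = 0" if "n \<notin> {..<N + 2}" for n x
      using that by (auto simp: A_def B_def split: split_indicator)
    have f_fin: "(\<integral>\<^sup>+x. ?f n x \<partial>\<mu>) < \<infinity>" for n
    proof -
      have "(\<integral>\<^sup>+x. ?f n x \<partial>\<mu>) \<le> (\<integral>\<^sup>+x. ennpow (g n x) p * indicator (B n) x \<partial>\<mu>)"
        by (intro nn_integral_mono) (auto simp: h_def split: split_indicator)
      also have "\<dots> = (\<integral>\<^sup>+x. ennpow (g n x) p \<partial>restrict_space \<mu> (B n))"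
        unfolding B_def nn_integral_restrict_ball ..
      finally show ?thesis using g(2)[of n] by (rule order_le_less_trans)
    qed
    have "pint (ball x r) G \<le> (\<integral>\<^sup>+x. (\<Sum>n. ?f n x) \<partial>\<mu>)"
      unfolding pint_def
    proof (intro nn_integral_mono)
      fix y
      have "ennpow (G y) p \<le> (\<Sum>n. ennpow (h n y * indicator (A n) y) p)"
        unfolding G_def by (rule ennpow_SUP_le[OF p_pos])
      then show "ennpow (G y) p * indicator (ball x r) y \<le> (\<Sum>n. ?f n y)"
        using sub by (auto split: split_indicator)
    qed
    also have "\<dots> = (\<Sum>n. \<integral>\<^sup>+x. ?f n x \<partial>\<mu>)"
      by (rule nn_integral_suminf) measurable
    also have "\<dots> = (\<Sum>n<N + 2. \<integral>\<^sup>+x. ?f n x \<partial>\<mu>)"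
    proof (rule suminf_finite)
      fix n assume "n \<notin> {..<N + 2}"
      then have "?f n = (\<lambda>x. 0)" by (intro ext z)
      then show "(\<integral>\<^sup>+x. ?f n x \<partial>\<mu>) = 0" by simp
    qed simp
    also have "\<dots> < \<infinity>" using f_fin by (auto simp: ennreal_sum_less_top)
    finally show "pint (ball x r) G < \<infinity>" .
  qed
  moreover have "wug u G"
    unfolding wug_iff
  proof (intro conjI Gm)
    let ?P = "\<lambda>n \<gamma> l. ext_diff (ereal (u (\<gamma> 0))) (ereal (u (\<gamma> l))) \<le> line_integral \<gamma> l (g n)"
    have 1: "ae_curve (\<lambda>\<gamma> l. \<gamma> ` {0..l} \<subseteq> B n \<longrightarrow> ?P n \<gamma> l)" for n
      unfolding B_def by (rule p_ae_curve_restrict) (use g(1)[of n] in \<open>auto simp: weak_upper_gradient_def B_def\<close>)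
    have "ae_curve (\<lambda>\<gamma> l. (\<forall>n. \<forall>a b. 0 \<le> a \<and> a < b \<and> b \<le> l \<longrightarrow>
        ((\<lambda>t. \<gamma> (a + t)) ` {0..b - a} \<subseteq> B n \<longrightarrow> ?P n (\<lambda>t. \<gamma> (a + t)) (b - a))) \<and>
        (\<forall>n. (\<lambda>t. h n (\<gamma> t)) \<in> borel_measurable (lebesgue_on {0..l})) \<and>
        (\<lambda>t. G (\<gamma> t)) \<in> borel_measurable (lebesgue_on {0..l}))"
      by (intro ae_curve_conj ae_curve_all_nat ae_curve_measurable h Gm ae_curve_subcurves[OF 1])
    then show "ae_curve (\<lambda>\<gamma> l. controls l (\<lambda>t. u (\<gamma> t)) (\<lambda>t. G (\<gamma> t)))"
    proof (rule ae_curve_mono, elim conjE)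
      fix \<gamma> :: "real \<Rightarrow> 'a" and l
      assume \<gamma>: "arclength_curve UNIV \<gamma> l"
        and *: "\<forall>n. \<forall>a b. 0 \<le> a \<and> a < b \<and> b \<le> l \<longrightarrow>
        ((\<lambda>t. \<gamma> (a + t)) ` {0..b - a} \<subseteq> B n \<longrightarrow> ?P n (\<lambda>t. \<gamma> (a + t)) (b - a))"
        and hm: "\<forall>n. (\<lambda>t. h n (\<gamma> t)) \<in> borel_measurable (lebesgue_on {0..l})"
        and gm: "(\<lambda>t. G (\<gamma> t)) \<in> borel_measurable (lebesgue_on {0..l})"
      show "controls l (\<lambda>t. u (\<gamma> t)) (\<lambda>t. G (\<gamma> t))"
      proof (rule controls_local[OF gm])
        fix x assume x: "0 \<le> x" "x \<le> l"
        define n where "n = nat \<lfloor>dist x0 (\<gamma> x)\<rfloor> + 1"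
        have n: "real n - 2 < dist x0 (\<gamma> x)" "dist x0 (\<gamma> x) < real n"
          by (auto simp: n_def) linarith+
        define d where "d = min (real n - dist x0 (\<gamma> x)) (dist x0 (\<gamma> x) - (real n - 2))"
        have d: "0 < d" using n by (simp add: d_def)
        show "\<exists>d>0. \<forall>a b. 0 \<le> a \<and> a \<le> x \<and> x \<le> b \<and> b \<le> l \<and> b - a < d \<longrightarrow>
          ennreal \<bar>u (\<gamma> a) - u (\<gamma> b)\<bar> \<le> segint l a b (\<lambda>t. G (\<gamma> t))"
        proof (intro exI[of _ d] conjI allI impI d)
          fix a b assume ab: "0 \<le> a \<and> a \<le> x \<and> x \<le> b \<and> b \<le> l \<and> b - a < d"
          have inA: "\<gamma> t \<in> A n" if t: "t \<in> {a..b}" for t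
          proof -
            have "dist (\<gamma> x) (\<gamma> t) \<le> \<bar>x - t\<bar>"
              using t ab x by (intro arclength_curve_dist_abs[OF \<gamma>]) auto
            also have "\<dots> < d" using t ab by auto
            finally show ?thesis
              using dist_triangle[of x0 "\<gamma> t" "\<gamma> x"] dist_triangle[of x0 "\<gamma> x" "\<gamma> t"]
              by (auto simp: A_def d_def dist_commute)
          qed
          have inB: "\<gamma> t \<in> B n" if t: "t \<in> {a..b}" for t
            using inA[OF t] by (auto simp: A_def B_def)
          show "ennreal \<bar>u (\<gamma> a) - u (\<gamma> b)\<bar> \<le> segint l a b (\<lambda>t. G (\<gamma> t))"
          proof (cases "a = b")
            case False
            have "(\<lambda>t. \<gamma> (a + t)) ` {0..b - a} \<subseteq> B n" using inB by auto
            then have "?P n (\<lambda>t. \<gamma> (a + t)) (b - a)"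
              using *[rule_format, of a b n] ab False by linarith
            then have "ennreal \<bar>u (\<gamma> a) - u (\<gamma> b)\<bar> \<le> line_integral (\<lambda>t. \<gamma> (a + t)) (b - a) (g n)" by simp
            also have "\<dots> = line_integral (\<lambda>t. \<gamma> (a + t)) (b - a) (h n)"
              unfolding line_integral_def h_def using inB
              by (intro nn_integral_cong) (auto split: split_indicator)
            also have "\<dots> = segint l a b (\<lambda>t. h n (\<gamma> t))"
              by (rule line_integral_subcurve) (use hm ab in auto)
            also have "\<dots> \<le> segint l a b (\<lambda>t. G (\<gamma> t))"
            proof (intro nn_integral_mono)
              fix t
              have "h n (\<gamma> t) * indicator (A n) (\<gamma> t) \<le> G (\<gamma> t)"
                unfolding G_def by (rule SUP_upper) simp
              then show "h n (\<gamma> t) * indicator {a..b} t \<le> G (\<gamma> t) * indicator {a..b} t"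
                using inA by (auto split: split_indicator)
            qed
            finally show ?thesis .
          qed simp
        qed
      qed
    qed
  qed
  ultimately show ?thesis by blast
qed

end

section \<open>Quasiminimizers and the Caccioppoli inequality\<close>

text \<open>
  The inequality is iterated along the radii \<open>r1 - \<tau>\<^sup>i (r1 - r0)\<close>.  For \<open>\<tau> = \<theta> powr (1 / (2 * p))\<close> the
  errors form a geometric series of ratio \<open>\<theta> \<tau>\<^sup>-\<^sup>p = sqrt \<theta> < 1\<close>.
\<close>
lemma absorption_iteration:
  fixes f :: "real \<Rightarrow> real"
  assumes p: "0 < p" and \<theta>: "0 < \<theta>" "\<theta> < 1" and V: "0 \<le> V" and r: "r0 < r1"
    and bdd: "\<And>s. r0 \<le> s \<Longrightarrow> s \<le> r1 \<Longrightarrow> f s \<le> M"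
    and step: "\<And>s t. r0 \<le> s \<Longrightarrow> s < t \<Longrightarrow> t \<le> r1 \<Longrightarrow> f s \<le> \<theta> * f t + V * (t - s) powr (- p)"
  shows "f r0 \<le> (1 - \<theta> powr (1 / (2 * p))) powr (- p) / (1 - sqrt \<theta>) * (V * (r1 - r0) powr (- p))"
proof -
  define \<tau> where "\<tau> = \<theta> powr (1 / (2 * p))"
  have \<tau>: "0 < \<tau>" "\<tau> < 1"
    using \<theta> p powr_less_mono2[of "1 / (2 * p)" \<theta> 1] by (auto simp: \<tau>_def)
  have \<tau>p: "\<theta> * \<tau> powr (- p) = sqrt \<theta>"
  proof -
    have "\<tau> powr (- p) = \<theta> powr (- 1 / 2)" using p by (simp add: \<tau>_def powr_powr)
    then have "\<theta> * \<tau> powr (- p) = \<theta> powr 1 * \<theta> powr (- 1 / 2)" using \<theta> by simp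
    also have "\<dots> = \<theta> powr (1 / 2)" unfolding powr_add[symmetric] by simp
    finally show ?thesis using \<theta> by (simp add: powr_half_sqrt)
  qed
  define d where "d = r1 - r0"
  have d: "0 < d" using r by (simp add: d_def)
  define t where "t i = r1 - \<tau> ^ i * d" for i
  have t: "r0 \<le> t i" "t i < t (Suc i)" "t i \<le> r1" "t (Suc i) - t i = (1 - \<tau>) * d * \<tau> ^ i" for i
  proof -
    have "\<tau> ^ i * d \<le> 1 * d" using \<tau> d by (intro mult_right_mono power_le_one) auto
    then show "r0 \<le> t i" by (simp add: t_def d_def)
    show *: "t (Suc i) - t i = (1 - \<tau>) * d * \<tau> ^ i" by (simp add: t_def algebra_simps)
    have "0 < (1 - \<tau>) * d * \<tau> ^ i" using \<tau> d by simp
    then show "t i < t (Suc i)" using * by linarith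
    show "t i \<le> r1" using \<tau> d by (simp add: t_def)
  qed
  define K where "K = V * ((1 - \<tau>) * d) powr (- p)"
  have K: "0 \<le> K" using V by (simp add: K_def)
  have iter: "f r0 \<le> \<theta> ^ n * f (t n) + K * (\<Sum>i<n. sqrt \<theta> ^ i)" for n
  proof (induction n)
    case 0
    then show ?case by (simp add: t_def d_def)
  next
    case (Suc n)
    have e: "(\<tau> ^ n) powr (- p) = (\<tau> powr (- p)) ^ n"
      using \<tau> by (simp add: powr_realpow[symmetric] powr_powr mult.commute)
    have "f (t n) \<le> \<theta> * f (t (Suc n)) + V * (t (Suc n) - t n) powr (- p)"
      by (rule step) (use t in auto)
    also have "V * (t (Suc n) - t n) powr (- p) = K * (\<tau> powr (- p)) ^ n"
      unfolding t(4) K_def using \<tau> d by (simp add: powr_mult e)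
    finally have "\<theta> ^ n * f (t n) \<le> \<theta> ^ n * (\<theta> * f (t (Suc n)) + K * (\<tau> powr (- p)) ^ n)"
      using \<theta> by (intro mult_left_mono) auto
    also have "\<dots> = \<theta> ^ Suc n * f (t (Suc n)) + K * sqrt \<theta> ^ n"
      unfolding \<tau>p[symmetric] by (simp add: algebra_simps power_mult_distrib)
    finally show ?case using Suc by (simp add: algebra_simps)
  qed
  have sq: "sqrt \<theta> < 1" "0 \<le> sqrt \<theta>" using \<theta> by auto
  have "f r0 \<le> \<theta> ^ n * M + K / (1 - sqrt \<theta>)" for n
  proof -
    have "(\<Sum>i<n. sqrt \<theta> ^ i) \<le> 1 / (1 - sqrt \<theta>)"
      using sq sum_le_suminf[of "\<lambda>i. sqrt \<theta> ^ i" "{..<n}"] suminf_geometric[of "sqrt \<theta>"]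
      by (auto simp: summable_geometric)
    then have "K * (\<Sum>i<n. sqrt \<theta> ^ i) \<le> K * (1 / (1 - sqrt \<theta>))" using K by (rule mult_left_mono)
    moreover have "\<theta> ^ n * f (t n) \<le> \<theta> ^ n * M" using \<theta> t by (intro mult_left_mono bdd) auto
    ultimately show ?thesis using iter[of n] by simp
  qed
  moreover have "(\<lambda>n. \<theta> ^ n * M + K / (1 - sqrt \<theta>)) \<longlonglongrightarrow> 0 * M + K / (1 - sqrt \<theta>)"
    using \<theta> by (intro tendsto_intros LIMSEQ_power_zero) auto
  ultimately have "f r0 \<le> K / (1 - sqrt \<theta>)"
    by (intro LIMSEQ_le_const[of _ _ "f r0"]) auto
  also have "\<dots> = (1 - \<tau>) powr (- p) / (1 - sqrt \<theta>) * (V * (r1 - r0) powr (- p))"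
    using \<tau> d by (simp add: K_def d_def[symmetric] powr_mult)
  finally show ?thesis by (simp add: \<tau>_def)
qed

context newtonian_setting begin

text \<open>
  What is used of quasiharmonicity.  The energies are those of arbitrary weak upper gradients \<open>h\<close> of
  \<open>u + \<phi>\<close> rather than of minimal ones, and test functions are real-valued and continuous.  The function \<open>g\<close>
  is a separate argument, so that the same \<open>g\<close> can serve \<open>u\<close> and \<open>-u\<close>.
\<close>
definition quasimin :: "real \<Rightarrow> ('a \<Rightarrow> real) \<Rightarrow> ('a \<Rightarrow> ennreal) \<Rightarrow> bool" where
  "quasimin Q u g \<longleftrightarrow> 1 \<le> Q \<and> continuous_on UNIV u \<and> wug u g \<and> Lp_bounded g \<and>
     Lp_bounded (\<lambda>x. ennreal \<bar>u x\<bar>) \<and>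
     (\<forall>\<phi> k h x R. continuous_on UNIV \<phi> \<and> (\<forall>y. y \<notin> ball x R \<longrightarrow> \<phi> y = 0) \<and>
        pint UNIV (\<lambda>y. ennreal \<bar>\<phi> y\<bar>) < \<infinity> \<and> wug \<phi> k \<and> pint UNIV k < \<infinity> \<and>
        wug (\<lambda>y. u y + \<phi> y) h \<and> Lp_loc p \<mu> h \<longrightarrow>
        pint {y. \<phi> y \<noteq> 0} g \<le> ennreal Q * pint {y. \<phi> y \<noteq> 0} h)"

lemma wug_uminus: "wug (\<lambda>x. - u x) g \<longleftrightarrow> wug u g"
  using wug_contraction[of u g "\<lambda>x. - u x"] wug_contraction[of "\<lambda>x. - u x" g u] by auto

lemma wug_zero: "wug (\<lambda>x. 0) (\<lambda>x. 0)"
  by (auto simp: wug_iff controls_def ae_curve_def' intro!: bexI[of _ "\<lambda>x. 0"])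

lemma newtonian_normI:
  assumes "(\<lambda>y. ereal (\<phi> y)) \<in> borel_measurable \<mu>" "pint UNIV (\<lambda>y. ennreal \<bar>\<phi> y\<bar>) \<le> a" "wug \<phi> k" "pint UNIV k \<le> b"
  shows "newtonian_norm p \<mu> (\<lambda>y. ereal (\<phi> y)) \<le> ennpow (a + b) (1 / p)"
proof -
  have "(INF g \<in> {g. wug \<phi> g}. \<integral>\<^sup>+x. ennpow (g x) p \<partial>\<mu>) \<le> (\<integral>\<^sup>+x. ennpow (k x) p \<partial>\<mu>)"
    by (rule INF_lower) (use assms in auto)
  then show ?thesis
    unfolding newtonian_norm_def using p_pos assms
    by (intro ennpow_mono add_mono) (auto simp: pint_def intro: order_trans)
qed

text \<open>
  A test function with bounded support belongs to the closure in the definition of quasiminimizers,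
  because it can be approximated by itself.
\<close>
lemma quasiharmonic_imp_quasimin:
  assumes "quasiharmonic p \<mu> u"
  obtains Q where "quasimin Q u (minimal_wug p \<mu> (\<lambda>x. ereal (u x)))"
proof -
  let ?g = "minimal_wug p \<mu> (\<lambda>x. ereal (u x))"
  have u: "continuous_on UNIV u"
    and N: "\<And>G. open G \<and> bounded G \<Longrightarrow> (\<lambda>x. ereal (u x)) \<in> newtonian p (restrict_space \<mu> G)"
    using assms unfolding quasiharmonic_def quasiminimizer_def by auto
  obtain Q where Q: "1 \<le> Q" "\<And>\<phi>. \<phi> \<in> newtonian_bdd_supp_closure p \<mu> \<Longrightarrow>
        (\<integral>\<^sup>+x\<in>{x. \<phi> x \<noteq> 0}. ennpow (?g x) p \<partial>\<mu>)
          \<le> ennreal Q * (\<integral>\<^sup>+x\<in>{x. \<phi> x \<noteq> 0}. ennpow (minimal_wug p \<mu> (\<lambda>y. ereal (u y) + \<phi> y) x) p \<partial>\<mu>)"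
    using assms unfolding quasiharmonic_def quasiminimizer_def by auto
  have N': "(\<lambda>y. ereal (u y)) \<in> newtonian p (restrict_space \<mu> (ball x r))" for x r
    by (rule N) auto
  obtain g0 where g0: "wug u g0" "Lp_bounded g0" using wug_glue[OF u N'] by blast
  have min: "is_minimal_wug p \<mu> (\<lambda>x. ereal (u x)) ?g"
    by (rule ex_minimal_wug[OF g0(1) Lp_bounded_loc[OF g0(2)]])
  have g_wug: "wug u ?g" using min by (simp add: is_minimal_wug_def)
  have "AE x in \<mu>. ?g x \<le> g0 x"
    using min g0 Lp_bounded_loc by (auto simp: is_minimal_wug_def)
  then have "pint A ?g \<le> pint A g0" for A
    by (rule pint_mono_AE)
  then have g_Lp: "Lp_bounded ?g"
    using g0(2) wugD_measurable[OF g_wug] unfolding Lp_bounded_def by (meson order_le_less_trans)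
  show ?thesis
  proof (rule that[of Q], unfold quasimin_def, intro conjI allI impI Q(1) u g_wug g_Lp newtonian_ball_Lp_bounded[OF u N'])
    fix \<phi> k h x R
    assume *: "continuous_on UNIV \<phi> \<and> (\<forall>y. y \<notin> ball x R \<longrightarrow> \<phi> y = 0) \<and>
        pint UNIV (\<lambda>y. ennreal \<bar>\<phi> y\<bar>) < \<infinity> \<and> wug \<phi> k \<and> pint UNIV k < \<infinity> \<and>
        wug (\<lambda>y. u y + \<phi> y) h \<and> Lp_loc p \<mu> h"
    let ?\<phi> = "\<lambda>y. ereal (\<phi> y)"
    have [measurable]: "\<phi> \<in> borel_measurable \<mu>" using * by (auto intro: continuous_measurable)
    have m: "?\<phi> \<in> borel_measurable \<mu>" by measurable
    have "newtonian_norm p \<mu> ?\<phi> \<le> ennpow (pint UNIV (\<lambda>y. ennreal \<bar>\<phi> y\<bar>) + pint UNIV k) (1 / p)"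
      by (rule newtonian_normI[OF m]) (use * in auto)
    also have "\<dots> < \<infinity>" using * by (simp add: ennpow_less_top)
    finally have N: "?\<phi> \<in> newtonian p \<mu>" using m by (simp add: newtonian_def)
    have bs: "?\<phi> \<in> newtonian_bdd_supp p \<mu>"
      unfolding newtonian_bdd_supp_def using N * by (auto intro!: exI[of _ "ball x R"])
    have "newtonian_norm p \<mu> (\<lambda>y. ereal 0) \<le> ennpow (0 + 0) (1 / p)"
      by (rule newtonian_normI[OF _ _ wug_zero]) (auto simp: pint_def)
    then have z: "newtonian_norm p \<mu> (\<lambda>y. ?\<phi> y - ?\<phi> y) = 0" by (simp add: zero_ereal_def)
    have "?\<phi> \<in> newtonian_bdd_supp_closure p \<mu>"
      unfolding newtonian_bdd_supp_closure_def using N bs z by (auto intro!: bexI[of _ ?\<phi>])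
    from Q(2)[OF this]
    have 1: "pint {y. \<phi> y \<noteq> 0} ?g \<le> ennreal Q * pint {y. \<phi> y \<noteq> 0} (minimal_wug p \<mu> (\<lambda>y. ereal (u y + \<phi> y)))"
      by (simp add: pint_def)
    have "is_minimal_wug p \<mu> (\<lambda>y. ereal (u y + \<phi> y)) (minimal_wug p \<mu> (\<lambda>y. ereal (u y + \<phi> y)))"
      using * by (intro ex_minimal_wug[of "\<lambda>y. u y + \<phi> y" h]) auto
    then have "AE x in \<mu>. minimal_wug p \<mu> (\<lambda>y. ereal (u y + \<phi> y)) x \<le> h x"
      using * by (auto simp: is_minimal_wug_def)
    then have "pint {y. \<phi> y \<noteq> 0} (minimal_wug p \<mu> (\<lambda>y. ereal (u y + \<phi> y))) \<le> pint {y. \<phi> y \<noteq> 0} h"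
      by (rule pint_mono_AE)
    then show "pint {y. \<phi> y \<noteq> 0} ?g \<le> ennreal Q * pint {y. \<phi> y \<noteq> 0} h"
      using 1 by (meson mult_left_mono order_trans zero_le)
  qed
qed

lemma quasiminD:
  assumes "quasimin Q u g" "continuous_on UNIV \<phi>" "\<And>y. y \<notin> ball x R \<Longrightarrow> \<phi> y = 0"
    "pint UNIV (\<lambda>y. ennreal \<bar>\<phi> y\<bar>) < \<infinity>" "wug \<phi> k" "pint UNIV k < \<infinity>"
    "wug (\<lambda>y. u y + \<phi> y) h" "Lp_loc p \<mu> h"
  shows "pint {y. \<phi> y \<noteq> 0} g \<le> ennreal Q * pint {y. \<phi> y \<noteq> 0} h"
  using assms unfolding quasimin_def by blast

lemma quasimin_uminus:
  assumes "quasimin Q u g"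
  shows "quasimin Q (\<lambda>x. - u x) g"
  unfolding quasimin_def
proof (intro conjI allI impI)
  fix \<phi> k h x R
  assume *: "continuous_on UNIV \<phi> \<and> (\<forall>y. y \<notin> ball x R \<longrightarrow> \<phi> y = 0) \<and>
        pint UNIV (\<lambda>y. ennreal \<bar>\<phi> y\<bar>) < \<infinity> \<and> wug \<phi> k \<and> pint UNIV k < \<infinity> \<and>
        wug (\<lambda>y. - u y + \<phi> y) h \<and> Lp_loc p \<mu> h"
  have "wug (\<lambda>y. u y + - \<phi> y) h"
    using * wug_contraction[of "\<lambda>y. - u y + \<phi> y" h "\<lambda>y. u y + - \<phi> y"] by (auto simp: abs_minus_commute)
  moreover have "continuous_on UNIV (\<lambda>y. - \<phi> y)" using * by (intro continuous_on_minus) auto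
  moreover have "wug (\<lambda>y. - \<phi> y) k" using * by (simp add: wug_uminus)
  ultimately have "pint {y. - \<phi> y \<noteq> 0} g \<le> ennreal Q * pint {y. - \<phi> y \<noteq> 0} h"
    using * by (intro quasiminD[OF assms, of "\<lambda>y. - \<phi> y" x R k h]) auto
  then show "pint {y. \<phi> y \<noteq> 0} g \<le> ennreal Q * pint {y. \<phi> y \<noteq> 0} h" by simp
qed (use assms in \<open>auto simp: quasimin_def wug_uminus intro: continuous_on_minus\<close>)

lemma excess_Lp_bounded:
  assumes "continuous_on UNIV u" "Lp_bounded (\<lambda>x. ennreal \<bar>u x\<bar>)"
  shows "Lp_bounded (\<lambda>x. ennreal (max 0 (u x - k)))"
proof (rule Lp_bounded_mono[OF Lp_bounded_add[OF assms(2) Lp_bounded_const[of "\<bar>k\<bar>"]]])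
  have [measurable]: "u \<in> borel_measurable \<mu>" by (rule continuous_measurable[OF assms(1)])
  show "(\<lambda>x. ennreal (max 0 (u x - k))) \<in> borel_measurable \<mu>" by measurable
  show "ennreal (max 0 (u x - k)) \<le> ennreal \<bar>u x\<bar> + ennreal \<bar>k\<bar>" for x
  proof -
    have "ennreal (max 0 (u x - k)) \<le> ennreal (\<bar>u x\<bar> + \<bar>k\<bar>)" by (rule ennreal_leI) auto
    then show ?thesis by simp
  qed
qed

lemma wug_excess:
  assumes "continuous_on UNIV u" "wug u g" "Lp_loc p \<mu> g"
  shows "wug (\<lambda>x. max 0 (u x - k)) (\<lambda>x. if u x \<le> k then 0 else g x)"
proof -
  have 1: "wug (\<lambda>x. max 0 (u x - k)) g"
    by (rule wug_contraction[OF assms(2)]) (auto simp: max_def)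
  have "wug (\<lambda>x. max 0 (u x - k)) (\<lambda>x. if max 0 (u x - k) = 0 then 0 else g x)"
    by (rule wug_nonzero[OF 1 assms(3)]) (intro continuous_intros assms)
  moreover have "(\<lambda>x. if max 0 (u x - k) = 0 then 0 else g x) = (\<lambda>x. if u x \<le> k then 0 else g x)"
    by (intro ext) (auto simp: max_def)
  ultimately show ?thesis by simp
qed

lemma wug_truncation:
  assumes "continuous_on UNIV u" "wug u g" "Lp_loc p \<mu> g"
  shows "wug (\<lambda>x. min (u x) k) (\<lambda>x. if k \<le> u x then 0 else g x)"
proof -
  have 1: "wug (\<lambda>x. min (u x) k - k) g"
    by (rule wug_contraction[OF assms(2)]) (auto simp: min_def)
  have 2: "wug (\<lambda>x. min (u x) k - k) (\<lambda>x. if min (u x) k - k = 0 then 0 else g x)"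
    by (rule wug_nonzero[OF 1 assms(3)]) (intro continuous_intros assms)
  moreover have "(\<lambda>x. if min (u x) k - k = 0 then 0 else g x) = (\<lambda>x. if k \<le> u x then 0 else g x)"
    by (intro ext) (auto simp: min_def)
  ultimately show ?thesis
    using wug_contraction[OF 2, of "\<lambda>x. min (u x) k"] by simp
qed

definition superlevel :: "('a \<Rightarrow> real) \<Rightarrow> real \<Rightarrow> 'a \<Rightarrow> real \<Rightarrow> 'a set" where
  "superlevel u k x r = {y \<in> ball x r. k < u y}"

lemma superlevel_sets [measurable]: "continuous_on UNIV u \<Longrightarrow> superlevel u k x r \<in> sets \<mu>"
proof -
  assume "continuous_on UNIV u"
  then have [measurable]: "u \<in> borel_measurable \<mu>" by (rule continuous_measurable)
  have "superlevel u k x r = ball x r \<inter> {y\<in>space \<mu>. k < u y}" by (auto simp: superlevel_def)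
  also have "\<dots> \<in> sets \<mu>" by measurable
  finally show ?thesis .
qed

text \<open>
  The test function is \<open>-\<eta> (u - k)\<^sub>+\<close> with a cutoff function \<open>\<eta>\<close> that equals \<open>1\<close> on the small ball and \<open>0\<close>
  outside the large one.  Adding it to \<open>u\<close> yields \<open>min u k + (1 - \<eta>) (u - k)\<^sub>+\<close>, and where the test
  function does not vanish this has the upper gradient \<open>(1 - \<eta>) g + (u - k)\<^sub>+ / (R - \<rho>)\<close>, whose first
  term lives outside the small ball.
\<close>
lemma Caccioppoli_step:
  assumes qm: "quasimin Q u g" and r: "0 < \<rho>" "\<rho> < R"
  shows "pint (superlevel u k x \<rho>) g \<le> ennreal (Q * 2 powr p) *
     (pint (superlevel u k x R - superlevel u k x \<rho>) g +
      ennreal ((R - \<rho>) powr (- p)) * pint (ball x R) (\<lambda>y. ennreal (max 0 (u y - k))))"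
proof -
  have u: "continuous_on UNIV u" and g: "wug u g" "Lp_bounded g" and uL: "Lp_bounded (\<lambda>x. ennreal \<bar>u x\<bar>)" and Q: "1 \<le> Q"
    using qm by (auto simp: quasimin_def)
  have gloc: "Lp_loc p \<mu> g" by (rule Lp_bounded_loc[OF g(2)])
  have [measurable]: "u \<in> borel_measurable \<mu>" by (rule continuous_measurable[OF u])
  have [measurable]: "g \<in> borel_measurable \<mu>" using g(1) by (rule wugD_measurable)
  define L where "L = 1 / (R - \<rho>)"
  have L: "0 < L" using r by (simp add: L_def)
  define v where "v y = max 0 (u y - k)" for y
  define \<eta> where "\<eta> y = max 0 (min 1 ((R - dist x y) * L))" for y
  have \<eta>: "0 \<le> \<eta> y" "\<eta> y \<le> 1" for y by (auto simp: \<eta>_def)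
  have \<eta>_out: "\<eta> y = 0" if "y \<notin> ball x R" for y
  proof -
    have "(R - dist x y) * L \<le> 0" using that L by (intro mult_nonpos_nonneg) auto
    then show ?thesis by (simp add: \<eta>_def)
  qed
  have \<eta>_in: "\<eta> y = 1" if "y \<in> ball x \<rho>" for y
  proof -
    have "(R - dist x y) * L \<ge> (R - \<rho>) * L" using that L by (intro mult_right_mono) auto
    then show ?thesis using r by (simp add: \<eta>_def L_def)
  qed
  have clip: "\<bar>max 0 (min 1 a) - max 0 (min 1 b)\<bar> \<le> \<bar>a - b\<bar>" for a b :: real by auto
  have \<eta>_lip: "\<bar>\<eta> y - \<eta> z\<bar> \<le> L * dist y z" for y z
  proof -
    have "\<bar>\<eta> y - \<eta> z\<bar> \<le> \<bar>(R - dist x y) * L - (R - dist x z) * L\<bar>"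
      unfolding \<eta>_def by (rule clip)
    also have "\<dots> = L * \<bar>dist x z - dist x y\<bar>"
    proof -
      have "(R - dist x y) * L - (R - dist x z) * L = L * (dist x z - dist x y)" by (simp add: algebra_simps)
      then show ?thesis using L by (simp add: abs_mult)
    qed
    also have "\<dots> \<le> L * dist y z"
      using L abs_dist_diff_le[of z x y] by (intro mult_left_mono) (auto simp: dist_commute)
    finally show ?thesis .
  qed
  have \<eta>_cont: "continuous_on UNIV \<eta>" unfolding \<eta>_def by (intro continuous_intros)
  have v_cont: "continuous_on UNIV v" unfolding v_def by (intro continuous_intros u)
  have v0: "0 \<le> v y" for y by (simp add: v_def)
  have [measurable]: "\<eta> \<in> borel_measurable \<mu>" "v \<in> borel_measurable \<mu>"
    by (auto intro: continuous_measurable \<eta>_cont v_cont)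
  define gv where "gv y = (if u y \<le> k then 0 else g y)" for y
  have gv: "wug v gv" unfolding v_def gv_def by (rule wug_excess[OF u g(1) gloc])
  have gv_Lp: "Lp_bounded gv"
    by (rule Lp_bounded_mono[OF g(2) wugD_measurable[OF gv]]) (simp add: gv_def)
  note gv_loc = Lp_bounded_loc[OF gv_Lp]
  define gm where "gm y = (if k \<le> u y then 0 else g y)" for y
  have gm: "wug (\<lambda>y. min (u y) k) gm" unfolding gm_def by (rule wug_truncation[OF u g(1) gloc])
  have gm_Lp: "Lp_bounded gm"
    by (rule Lp_bounded_mono[OF g(2) wugD_measurable[OF gm]]) (simp add: gm_def)
  have vL: "Lp_bounded (\<lambda>y. ennreal (v y))"
    unfolding v_def by (rule excess_Lp_bounded[OF u uL])
  have "Lp_bounded (\<lambda>y. ennreal L * ennreal (v y))"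
    using L by (intro Lp_bounded_cmult vL) auto
  then have LvL: "Lp_bounded (\<lambda>y. ennreal (L * v y))" using L v0 by (simp add: ennreal_mult)
  have prod_Lp: "Lp_bounded (\<lambda>y. ennreal (\<psi> y) * gv y + ennreal (L * v y))"
    if [measurable]: "\<psi> \<in> borel_measurable \<mu>" and "\<And>y. \<psi> y \<le> 1" for \<psi> :: "'a \<Rightarrow> real"
  proof (rule Lp_bounded_mono[OF Lp_bounded_add[OF gv_Lp LvL]])
    have [measurable]: "gv \<in> borel_measurable \<mu>" using gv by (rule wugD_measurable)
    show "(\<lambda>y. ennreal (\<psi> y) * gv y + ennreal (L * v y)) \<in> borel_measurable \<mu>" by measurable
    show "ennreal (\<psi> y) * gv y + ennreal (L * v y) \<le> gv y + ennreal (L * v y)" for y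
    proof -
      have "ennreal (\<psi> y) * gv y \<le> 1 * gv y"
        using that(2)[of y] by (intro mult_right_mono) (auto simp: ennreal_le_1)
      then show ?thesis by (intro add_right_mono) simp
    qed
  qed
  let ?\<psi> = "\<lambda>y. 1 - \<eta> y"
  let ?\<phi> = "\<lambda>y. - (\<eta> y * v y)"
  let ?hpr = "\<lambda>y. ennreal (?\<psi> y) * gv y + ennreal (L * v y)"
  let ?h = "\<lambda>y. gm y + ?hpr y"
  let ?kpr = "\<lambda>y. ennreal (\<eta> y) * gv y + ennreal (L * v y)"
  let ?k = "\<lambda>y. if ?\<phi> y = 0 then 0 else ?kpr y"
  have h0: "wug (\<lambda>y. ?\<psi> y * v y) ?hpr"
  proof (rule wug_product[OF gv gv_loc v_cont v0])
    show "\<bar>?\<psi> y - ?\<psi> z\<bar> \<le> L * dist y z" for y z using \<eta>_lip[of y z] by simp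
    show "continuous_on UNIV ?\<psi>" by (intro continuous_intros \<eta>_cont)
  qed (use \<eta> L in auto)
  have eq: "min (u y) k + ?\<psi> y * v y = u y + ?\<phi> y" for y
    by (auto simp: v_def max_def min_def algebra_simps)
  have h: "wug (\<lambda>y. u y + ?\<phi> y) ?h"
    using wug_add[OF gm h0] unfolding eq .
  have h_Lp: "Lp_bounded ?h" using \<eta> by (intro Lp_bounded_add[OF gm_Lp prod_Lp]) auto
  have "wug (\<lambda>y. \<eta> y * v y) ?kpr"
    by (rule wug_product[OF gv gv_loc v_cont v0]) (use \<eta> L \<eta>_lip \<eta>_cont in auto)
  then have k0: "wug ?\<phi> ?kpr" by (simp add: wug_uminus)
  have k0_Lp: "Lp_bounded ?kpr" using \<eta> by (intro prod_Lp) auto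
  have \<phi>_cont: "continuous_on UNIV ?\<phi>" by (intro continuous_intros \<eta>_cont v_cont)
  have k: "wug ?\<phi> ?k" by (rule wug_nonzero[OF k0 Lp_bounded_loc[OF k0_Lp] \<phi>_cont])
  have k_fin: "pint UNIV ?k < \<infinity>"
  proof -
    have "pint UNIV ?k = pint (ball x R) ?k"
      unfolding pint_def using \<eta>_out by (intro nn_integral_cong) (auto split: split_indicator)
    also have "\<dots> \<le> pint (ball x R) ?kpr" by (intro pint_mono) auto
    also have "\<dots> < \<infinity>" using k0_Lp by (simp add: Lp_bounded_def)
    finally show ?thesis .
  qed
  have \<phi>_fin: "pint UNIV (\<lambda>y. ennreal \<bar>?\<phi> y\<bar>) < \<infinity>"
  proof -
    have "pint UNIV (\<lambda>y. ennreal \<bar>?\<phi> y\<bar>) = pint (ball x R) (\<lambda>y. ennreal \<bar>?\<phi> y\<bar>)"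
      unfolding pint_def using \<eta>_out by (intro nn_integral_cong) (auto split: split_indicator)
    also have "\<dots> \<le> pint (ball x R) (\<lambda>y. ennreal (v y))"
      using \<eta> v0 by (intro pint_mono conjI ennreal_leI) (auto simp: abs_mult intro: mult_left_le_one_le)
    also have "\<dots> < \<infinity>" using vL by (simp add: Lp_bounded_def)
    finally show ?thesis .
  qed
  let ?A = "superlevel u k x R - superlevel u k x \<rho>"
  have "pint (superlevel u k x \<rho>) g \<le> pint {y. ?\<phi> y \<noteq> 0} g"
    using \<eta>_in by (intro pint_mono) (auto simp: superlevel_def v_def)
  also have "\<dots> \<le> ennreal Q * pint {y. ?\<phi> y \<noteq> 0} ?h"
    by (rule quasiminD[OF qm \<phi>_cont _ \<phi>_fin k k_fin h Lp_bounded_loc[OF h_Lp], of x R])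
       (use \<eta>_out in auto)
  also have "pint {y. ?\<phi> y \<noteq> 0} ?h \<le> pint (ball x R) (\<lambda>y. g y * indicator ?A y + ennreal L * ennreal (v y))"
  proof (intro pint_mono conjI)
    fix y assume "y \<in> {y. ?\<phi> y \<noteq> 0}"
    then have nz: "\<eta> y \<noteq> 0" "v y \<noteq> 0" by auto
    show yR: "y \<in> ball x R" using \<eta>_out nz by blast
    have uk: "k < u y" using nz by (auto simp: v_def max_def split: if_splits)
    have "ennreal (?\<psi> y) * gv y \<le> g y * indicator ?A y"
    proof (cases "y \<in> ball x \<rho>")
      case True
      then show ?thesis by (simp add: \<eta>_in)
    next
      case False
      then have "y \<in> ?A" using yR uk by (auto simp: superlevel_def)
      moreover have "ennreal (?\<psi> y) * g y \<le> 1 * g y"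
        using \<eta>[of y] by (intro mult_right_mono) (auto simp: ennreal_le_1)
      ultimately show ?thesis using uk by (simp add: gv_def)
    qed
    then show "?h y \<le> g y * indicator ?A y + ennreal L * ennreal (v y)"
      using uk L v0[of y] by (simp add: gm_def ennreal_mult add_right_mono)
  qed
  also have "\<dots> \<le> ennreal (2 powr p) * (pint (ball x R) (\<lambda>y. g y * indicator ?A y) + pint (ball x R) (\<lambda>y. ennreal L * ennreal (v y)))"
    using u by (intro pint_add_le) measurable
  also have "pint (ball x R) (\<lambda>y. g y * indicator ?A y) = pint ?A g"
    unfolding pint_def by (intro nn_integral_cong) (auto simp: superlevel_def split: split_indicator)
  also have "pint (ball x R) (\<lambda>y. ennreal L * ennreal (v y)) = ennreal ((R - \<rho>) powr (- p)) * pint (ball x R) (\<lambda>y. ennreal (v y))"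
    using L r by (subst pint_cmult) (auto simp: L_def powr_minus powr_divide inverse_eq_divide)
  finally show ?thesis
    using Q by (simp add: v_def[symmetric] ennreal_mult mult.assoc mult_left_mono)
qed

definition caccioppoli_const :: "real \<Rightarrow> real" where
  "caccioppoli_const Q = (let a = Q * 2 powr p; \<theta> = a / (1 + a) in
     (1 - \<theta> powr (1 / (2 * p))) powr (- p) / (1 - sqrt \<theta>))"

text \<open>
  Hole filling: adding \<open>a\<close> times the left-hand side of \<open>Caccioppoli_step\<close> to both sides, where \<open>a\<close> is
  the constant there, gives the factor \<open>a / (1 + a) < 1\<close> in front of the energy on the larger ball.
\<close>
lemma Caccioppoli:
  assumes qm: "quasimin Q u g" and r: "0 < \<rho>" "\<rho> < R"
  shows "pint (superlevel u k x \<rho>) g \<le> ennreal (caccioppoli_const Q * (R - \<rho>) powr (- p)) *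
     pint (ball x R) (\<lambda>y. ennreal (max 0 (u y - k)))"
proof -
  have u: "continuous_on UNIV u" and g: "wug u g" "Lp_bounded g" and uL: "Lp_bounded (\<lambda>x. ennreal \<bar>u x\<bar>)" and Q: "1 \<le> Q"
    using qm by (auto simp: quasimin_def)
  have [measurable]: "g \<in> borel_measurable \<mu>" using g(1) by (rule wugD_measurable)
  have [measurable]: "superlevel u k x s \<in> sets \<mu>" for s by (rule superlevel_sets[OF u])
  define V where "V = enn2real (pint (ball x R) (\<lambda>y. ennreal (max 0 (u y - k))))"
  have V: "pint (ball x R) (\<lambda>y. ennreal (max 0 (u y - k))) = ennreal V" "0 \<le> V"
    using excess_Lp_bounded[OF u uL, of k] by (auto simp: V_def Lp_bounded_def)
  define f where "f s = enn2real (pint (superlevel u k x s) g)" for s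
  have fin: "pint (superlevel u k x s) g < \<infinity>" for s
  proof -
    have "pint (superlevel u k x s) g \<le> pint (ball x s) g" by (intro pint_mono) (auto simp: superlevel_def)
    then show ?thesis using g(2) unfolding Lp_bounded_def by (meson order_le_less_trans)
  qed
  have f: "pint (superlevel u k x s) g = ennreal (f s)" "0 \<le> f s" for s
    using fin[of s] by (auto simp: f_def)
  have f_mono: "f s \<le> f t" if "s \<le> t" for s t
  proof -
    have "pint (superlevel u k x s) g \<le> pint (superlevel u k x t) g"
      using that by (intro pint_mono) (auto simp: superlevel_def)
    then show ?thesis using f by (simp add: ennreal_le_iff)
  qed
  define a where "a = Q * 2 powr p"
  have a: "0 < a" using Q by (simp add: a_def)
  define \<theta> where "\<theta> = a / (1 + a)"
  have \<theta>: "0 < \<theta>" "\<theta> < 1" using a by (auto simp: \<theta>_def)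
  have step: "f s \<le> \<theta> * f t + V * (t - s) powr (- p)" if st: "\<rho> \<le> s" "s < t" "t \<le> R" for s t
  proof -
    have diff: "pint (superlevel u k x t - superlevel u k x s) g = ennreal (f t - f s)"
    proof -
      have "pint (superlevel u k x t) g = pint (superlevel u k x t - superlevel u k x s) g + pint (superlevel u k x s) g"
      proof -
        have "pint (superlevel u k x t) g = (\<integral>\<^sup>+y. ennpow (g y) p * indicator (superlevel u k x t - superlevel u k x s) y
            + ennpow (g y) p * indicator (superlevel u k x s) y \<partial>\<mu>)"
          unfolding pint_def using st
          by (intro nn_integral_cong) (auto simp: superlevel_def split: split_indicator)
        also have "\<dots> = pint (superlevel u k x t - superlevel u k x s) g + pint (superlevel u k x s) g"
          unfolding pint_def by (rule nn_integral_add) measurable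
        finally show ?thesis .
      qed
      then have "pint (superlevel u k x t - superlevel u k x s) g = ennreal (f t) - ennreal (f s)"
        unfolding f by (metis ennreal_add_diff_cancel_right ennreal_neq_top)
      then show ?thesis using f by (simp add: ennreal_minus)
    qed
    have "pint (ball x t) (\<lambda>y. ennreal (max 0 (u y - k))) \<le> ennreal V"
      unfolding V(1)[symmetric] using st by (intro pint_mono) auto
    then have "ennreal (f s) \<le> ennreal a * (ennreal (f t - f s) + ennreal ((t - s) powr (- p)) * ennreal V)"
      using Caccioppoli_step[OF qm, of s t k x] st r unfolding f diff a_def
      by (meson add_left_mono mult_left_mono order_less_le_trans order_trans zero_le)
    also have "\<dots> = ennreal (a * (f t - f s + (t - s) powr (- p) * V))"
      using a V f_mono[of s t] st by (simp add: ennreal_mult[symmetric] ennreal_plus[symmetric] del: ennreal_plus)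
    finally have "f s \<le> a * (f t - f s + (t - s) powr (- p) * V)"
      using a V f_mono[of s t] st by (subst (asm) ennreal_le_iff) auto
    then have "(1 + a) * f s \<le> a * f t + a * ((t - s) powr (- p) * V)" by (simp add: algebra_simps)
    then have "f s \<le> (a * f t + a * ((t - s) powr (- p) * V)) / (1 + a)"
      using a by (simp add: pos_le_divide_eq mult.commute)
    also have "\<dots> = \<theta> * f t + \<theta> * ((t - s) powr (- p) * V)" by (simp add: \<theta>_def add_divide_distrib)
    also have "\<dots> \<le> \<theta> * f t + 1 * ((t - s) powr (- p) * V)"
      using \<theta> V by (intro add_left_mono mult_right_mono) auto
    finally show ?thesis by (simp add: mult.commute)
  qed
  have "f \<rho> \<le> caccioppoli_const Q * (V * (R - \<rho>) powr (- p))"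
    unfolding caccioppoli_const_def Let_def a_def[symmetric] \<theta>_def[symmetric]
    by (rule absorption_iteration[OF p_pos \<theta> V(2) r(2) f_mono step])
  then have "ennreal (f \<rho>) \<le> ennreal (caccioppoli_const Q * (R - \<rho>) powr (- p) * V)"
    by (intro ennreal_leI) (simp add: mult_ac)
  also have "\<dots> = ennreal (caccioppoli_const Q * (R - \<rho>) powr (- p)) * ennreal V"
    using V \<theta> by (intro ennreal_mult) (auto simp: caccioppoli_const_def Let_def a_def[symmetric] \<theta>_def[symmetric])
  finally show ?thesis by (simp add: f V)
qed

end

section \<open>Doubling measures with a Poincare inequality\<close>

locale poincare_setting = newtonian_setting \<mu> p
  for \<mu> :: "'a::metric_space measure" and p :: real +
  fixes D CP \<Lambda> :: real
  assumes D_pos: "0 < D"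
    and doubling: "\<And>x r. 0 < r \<Longrightarrow> emeasure \<mu> (ball x (2 * r)) \<le> ennreal D * emeasure \<mu> (ball x r)"
    and CP_pos: "0 < CP" and \<Lambda>_ge_1: "1 \<le> \<Lambda>"
    and Poincare: "\<And>x r u g. 0 < r \<Longrightarrow> set_integrable \<mu> (ball x (\<Lambda> * r)) u \<Longrightarrow> wug u g \<Longrightarrow>
        ennreal (avg \<mu> (ball x r) (\<lambda>y. \<bar>u y - avg \<mu> (ball x r) u\<bar>))
          \<le> ennreal (CP * r) * ennpow ((\<integral>\<^sup>+y\<in>ball x (\<Lambda> * r). ennpow (g y) p \<partial>\<mu>)
                       / emeasure \<mu> (ball x (\<Lambda> * r))) (1 / p)"
begin

abbreviation vol :: "'a \<Rightarrow> real \<Rightarrow> real" where "vol x r \<equiv> measure \<mu> (ball x r)"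

lemma \<Lambda>_pos: "0 < \<Lambda>" using \<Lambda>_ge_1 by simp

lemma emeasure_vol: "emeasure \<mu> (ball x r) = ennreal (vol x r)"
  using emeasure_ball_finite[of x r] by (intro emeasure_eq_ennreal_measure) auto

lemma ball_fmeasurable [simp]: "ball x r \<in> fmeasurable \<mu>"
  using emeasure_ball_finite[of x r] by (intro fmeasurableI) auto

lemma vol_pos: "0 < r \<Longrightarrow> 0 < vol x r"
  using emeasure_ball_pos[of r x] unfolding emeasure_vol by simp

lemma vol_mono: "ball x r \<subseteq> ball y s \<Longrightarrow> vol x r \<le> vol y s"
  by (intro measure_mono_fmeasurable) auto

lemma vol_double: "0 < r \<Longrightarrow> vol x (2 * r) \<le> D * vol x r"
  using doubling[of r x] D_pos unfolding emeasure_vol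
  by (simp add: ennreal_mult[symmetric] ennreal_le_iff)

lemma D_ge_1: "1 \<le> D"
proof -
  fix x :: 'a
  have "vol x 1 \<le> vol x (2 * 1)" by (intro vol_mono) auto
  also have "\<dots> \<le> D * vol x 1" by (intro vol_double) auto
  finally show ?thesis using vol_pos[of 1 x] by simp
qed

lemma vol_double_pow: "0 < r \<Longrightarrow> vol x (2 ^ n * r) \<le> D ^ n * vol x r"
proof (induction n)
  case (Suc n)
  have "vol x (2 ^ Suc n * r) = vol x (2 * (2 ^ n * r))" by (simp add: mult.assoc)
  also have "\<dots> \<le> D * vol x (2 ^ n * r)" using Suc by (intro vol_double) auto
  also have "\<dots> \<le> D * (D ^ n * vol x r)" using Suc D_pos by (intro mult_left_mono) auto
  finally show ?case by (simp add: mult.assoc)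
qed simp

section \<open>Averages\<close>

lemma Lp_bounded_set_integrable:
  assumes v: "continuous_on UNIV v" and vL: "Lp_bounded (\<lambda>x. ennreal \<bar>v x\<bar>)"
  shows "set_integrable \<mu> (ball x r) v"
  unfolding set_integrable_def
proof (rule integrableI_bounded)
  have [measurable]: "v \<in> borel_measurable \<mu>" by (rule continuous_measurable[OF v])
  show "(\<lambda>y. indicat_real (ball x r) y *\<^sub>R v y) \<in> borel_measurable \<mu>" by measurable
  have "(\<integral>\<^sup>+y. ennreal (norm (indicat_real (ball x r) y *\<^sub>R v y)) \<partial>\<mu>)
      \<le> (\<integral>\<^sup>+y. indicator (ball x r) y + ennpow (ennreal \<bar>v y\<bar>) p * indicator (ball x r) y \<partial>\<mu>)"
  proof (rule nn_integral_mono)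
    fix y
    have "\<bar>v y\<bar> \<le> 1 + \<bar>v y\<bar> powr p"
    proof (cases "\<bar>v y\<bar> \<le> 1")
      case False
      then have "\<bar>v y\<bar> powr 1 \<le> \<bar>v y\<bar> powr p" using p_gt_1 by (intro powr_mono) auto
      then show ?thesis using False by simp
    qed (simp add: add_increasing2)
    then have "ennreal \<bar>v y\<bar> \<le> ennreal (1 + \<bar>v y\<bar> powr p)" by (rule ennreal_leI)
    then have "ennreal \<bar>v y\<bar> \<le> 1 + ennpow (ennreal \<bar>v y\<bar>) p" by (simp add: ennpow_ennreal)
    then show "ennreal (norm (indicat_real (ball x r) y *\<^sub>R v y)) \<le> indicator (ball x r) y + ennpow (ennreal \<bar>v y\<bar>) p * indicator (ball x r) y"
      by (auto split: split_indicator)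
  qed
  also have "\<dots> = emeasure \<mu> (ball x r) + pint (ball x r) (\<lambda>x. ennreal \<bar>v x\<bar>)"
    unfolding pint_def by (subst nn_integral_add) auto
  also have "\<dots> < \<infinity>" using vL emeasure_ball_finite by (auto simp: Lp_bounded_def)
  finally show "(\<integral>\<^sup>+y. ennreal (norm (indicat_real (ball x r) y *\<^sub>R v y)) \<partial>\<mu>) < \<infinity>" .
qed

lemma set_integrable_const_ball: "set_integrable \<mu> (ball x r) (\<lambda>y. c :: real)"
  unfolding set_integrable_def using emeasure_ball_finite[of x r] by auto

lemma set_integral_const_ball: "(\<integral>y\<in>ball x r. (c::real) \<partial>\<mu>) = c * vol x r"
  using emeasure_ball_finite[of x r] by (simp add: set_lebesgue_integral_def)

lemma avg_mono:
  assumes "set_integrable \<mu> (ball x r) f" "set_integrable \<mu> (ball x r) g" "\<And>y. y \<in> ball x r \<Longrightarrow> f y \<le> g y"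
  shows "avg \<mu> (ball x r) f \<le> avg \<mu> (ball x r) g"
  unfolding avg_def using assms by (intro divide_right_mono set_integral_mono) auto

lemma avg_const: "0 < r \<Longrightarrow> avg \<mu> (ball x r) (\<lambda>y. c) = c"
  using vol_pos[of r x] by (simp add: avg_def set_integral_const_ball)

text \<open>
  The integral of \<open>|v - a|\<close> increases with the ball; the ratio of the volumes comes from the
  different normalizations.
\<close>
lemma avg_deviation_le:
  assumes int: "set_integrable \<mu> (ball y s) v" and sub: "ball x r \<subseteq> ball y s" and r: "0 < r"
  shows "\<bar>avg \<mu> (ball x r) v - a\<bar> \<le> (vol y s / vol x r) * avg \<mu> (ball y s) (\<lambda>z. \<bar>v z - a\<bar>)"
proof -
  have pos: "0 < vol x r" by (rule vol_pos[OF r])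
  have pos': "0 < vol y s" using vol_mono[OF sub] pos by simp
  have int': "set_integrable \<mu> (ball x r) v"
    by (rule set_integrable_subset[OF int]) (use sub in auto)
  have i1: "set_integrable \<mu> (ball x r) (\<lambda>z. v z - a)"
    by (intro set_integral_diff int' set_integrable_const_ball)
  have i2: "set_integrable \<mu> (ball y s) (\<lambda>z. \<bar>v z - a\<bar>)"
    by (intro set_integrable_abs set_integral_diff int set_integrable_const_ball)
  have "avg \<mu> (ball x r) v - a = (\<integral>z\<in>ball x r. (v z - a) \<partial>\<mu>) / vol x r"
    using pos by (simp add: avg_def set_integral_diff int' set_integrable_const_ball set_integral_const_ball field_simps)
  then have "\<bar>avg \<mu> (ball x r) v - a\<bar> = \<bar>\<integral>z\<in>ball x r. (v z - a) \<partial>\<mu>\<bar> / vol x r"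
    using pos by simp
  also have "\<dots> \<le> (\<integral>z\<in>ball x r. \<bar>v z - a\<bar> \<partial>\<mu>) / vol x r"
    using set_integral_norm_bound[OF i1] pos by (intro divide_right_mono) auto
  also have "\<dots> \<le> (\<integral>z\<in>ball y s. \<bar>v z - a\<bar> \<partial>\<mu>) / vol x r"
  proof (intro divide_right_mono)
    show "(\<integral>z\<in>ball x r. \<bar>v z - a\<bar> \<partial>\<mu>) \<le> (\<integral>z\<in>ball y s. \<bar>v z - a\<bar> \<partial>\<mu>)"
      unfolding set_lebesgue_integral_def
    proof (rule integral_mono)
      show "integrable \<mu> (\<lambda>z. indicat_real (ball x r) z *\<^sub>R \<bar>v z - a\<bar>)"
        using set_integrable_abs[OF i1] by (simp add: set_integrable_def)
      show "integrable \<mu> (\<lambda>z. indicat_real (ball y s) z *\<^sub>R \<bar>v z - a\<bar>)"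
        using i2 by (simp add: set_integrable_def)
    qed (use sub in \<open>auto split: split_indicator\<close>)
  qed simp
  also have "\<dots> = (vol y s / vol x r) * avg \<mu> (ball y s) (\<lambda>z. \<bar>v z - a\<bar>)"
    using pos' by (simp add: avg_def)
  finally show ?thesis .
qed

lemma avg_tendsto:
  assumes v: "continuous_on UNIV v" and int: "\<And>r. set_integrable \<mu> (ball x r) v"
    and r: "\<And>j. 0 < r j" "r \<longlonglongrightarrow> 0"
  shows "(\<lambda>j. avg \<mu> (ball x (r j)) v) \<longlonglongrightarrow> v x"
proof (rule LIMSEQ_I)
  fix e :: real assume e: "0 < e"
  obtain d where d: "0 < d" "\<And>y. dist y x < d \<Longrightarrow> dist (v y) (v x) < e / 2"
    using v e unfolding continuous_on_iff by (metis UNIV_I half_gt_zero)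
  obtain N where N: "\<And>j. j \<ge> N \<Longrightarrow> r j < d"
    using order_tendstoD(2)[OF r(2) d(1)] by (auto simp: eventually_sequentially)
  show "\<exists>N. \<forall>j\<ge>N. norm (avg \<mu> (ball x (r j)) v - v x) < e"
  proof (intro exI[of _ N] allI impI)
    fix j assume j: "N \<le> j"
    have "\<bar>avg \<mu> (ball x (r j)) v - v x\<bar> \<le> (vol x (r j) / vol x (r j)) * avg \<mu> (ball x (r j)) (\<lambda>z. \<bar>v z - v x\<bar>)"
      by (rule avg_deviation_le[OF int]) (use r in auto)
    also have "\<dots> = avg \<mu> (ball x (r j)) (\<lambda>z. \<bar>v z - v x\<bar>)" using vol_pos[OF r(1)[of j], of x] by simp
    also have "\<dots> \<le> avg \<mu> (ball x (r j)) (\<lambda>z. e / 2)"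
      using N[OF j] d(2) by (intro avg_mono set_integrable_abs set_integral_diff int set_integrable_const_ball)
        (fastforce simp: dist_real_def dist_commute intro: less_imp_le)
    also have "\<dots> = e / 2" using r by (simp add: avg_const)
    also have "\<dots> < e" using e by simp
    finally show "norm (avg \<mu> (ball x (r j)) v - v x) < e" by simp
  qed
qed

section \<open>A potential estimate\<close>

definition mean_energy :: "('a \<Rightarrow> ennreal) \<Rightarrow> 'a \<Rightarrow> real \<Rightarrow> ennreal" where
  "mean_energy h x r = pint (ball x r) h / emeasure \<mu> (ball x r)"

text \<open>
  The ratio of the geometric weights in the potential below: \<open>2\<^sup>-\<^sup>p\<close> from the radii \<open>s / 2\<^sup>j\<close>, of which
  half the exponent is spent on summing over \<open>j\<close>.
\<close>
definition \<omega> :: real where "\<omega> = 2 powr (- p / 2)"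

text \<open>
  A dyadic Riesz potential of \<open>h\<^sup>p\<close>.
\<close>
definition energy_potential :: "('a \<Rightarrow> ennreal) \<Rightarrow> real \<Rightarrow> 'a \<Rightarrow> ennreal" where
  "energy_potential h s x = (\<Sum>j. ennreal (\<omega> ^ j) * mean_energy h x (\<Lambda> * (s / 2 ^ j)))"

definition C_telescope :: real where "C_telescope = (1 / (1 - 1 / sqrt 2)) powr p * (D * CP) powr p"

text \<open>
  By continuity, \<open>v(x)\<close> is the limit of the averages of \<open>v\<close> over the balls \<open>B(x, s / 2\<^sup>j)\<close>.  The
  doubling property and the Poincare inequality bound the difference of consecutive averages by
  \<open>C s / 2\<^sup>j\<close> times the \<open>p\<close>th root of the mean energy.
\<close>
lemma telescoping:
  assumes v: "continuous_on UNIV v" and vL: "Lp_bounded (\<lambda>x. ennreal \<bar>v x\<bar>)"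
    and h: "wug v h" and s: "0 < s"
  shows "ennpow (ennreal \<bar>v x - avg \<mu> (ball x s) v\<bar>) p \<le> ennreal (C_telescope * s powr p) * energy_potential h s x"
proof -
  define r where "r j = s / 2 ^ j" for j :: nat
  have r: "0 < r j" "r j = 2 * r (Suc j)" for j using s by (auto simp: r_def)
  have r0: "r \<longlonglongrightarrow> 0"
  proof -
    have "(\<lambda>j. s * (1 / 2) ^ j) \<longlonglongrightarrow> s * 0" by (intro tendsto_intros LIMSEQ_power_zero) auto
    moreover have "r = (\<lambda>j. s * (1 / 2) ^ j)" by (auto simp: r_def power_divide)
    ultimately show ?thesis by simp
  qed
  note int = Lp_bounded_set_integrable[OF v vL]
  define A where "A j = avg \<mu> (ball x (r j)) v" for j
  define T where "T j = mean_energy h x (\<Lambda> * r j)" for j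
  define a where "a j = ennreal \<bar>A (Suc j) - A j\<bar>" for j
  have a_le: "a j \<le> ennreal (D * CP * r j) * ennpow (T j) (1 / p)" for j
  proof -
    let ?dev = "avg \<mu> (ball x (r j)) (\<lambda>y. \<bar>v y - A j\<bar>)"
    have dev0: "0 \<le> ?dev"
      unfolding avg_def set_lebesgue_integral_def by (intro divide_nonneg_nonneg integral_nonneg) auto
    have "\<bar>A (Suc j) - A j\<bar> \<le> (vol x (r j) / vol x (r (Suc j))) * ?dev"
      unfolding A_def by (rule avg_deviation_le[OF int]) (use r(1)[of "Suc j"] in \<open>auto simp: r(2)[of j]\<close>)
    also have "\<dots> \<le> D * ?dev"
      using vol_double[OF r(1)[of "Suc j"], of x] vol_pos[OF r(1)[of "Suc j"], of x] dev0
      by (intro mult_right_mono) (auto simp: r(2)[of j] divide_le_eq)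
    finally have "a j \<le> ennreal (D * ?dev)" unfolding a_def by (rule ennreal_leI)
    also have "\<dots> = ennreal D * ennreal ?dev" using D_pos dev0 by (intro ennreal_mult) auto
    also have "\<dots> \<le> ennreal D * (ennreal (CP * r j) * ennpow (T j) (1 / p))"
      using Poincare[OF r(1)[of j] int h, of x] unfolding T_def mean_energy_def A_def pint_def
      by (intro mult_left_mono) auto
    also have "\<dots> = ennreal (D * CP * r j) * ennpow (T j) (1 / p)"
      using D_pos CP_pos r(1)[of j] by (simp add: mult.assoc ennreal_mult)
    finally show ?thesis .
  qed
  have sum_le: "ennreal \<bar>A n - A 0\<bar> \<le> (\<Sum>j. a j)" for n
  proof -
    have "ennreal \<bar>A n - A 0\<bar> \<le> (\<Sum>j<n. a j)"
    proof (induction n)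
      case (Suc n)
      have "ennreal \<bar>A (Suc n) - A 0\<bar> \<le> a n + ennreal \<bar>A n - A 0\<bar>"
        unfolding a_def by (rule ennreal_abs_triangle)
      then show ?case using Suc by (simp add: add.commute add_left_mono order_trans)
    qed simp
    also have "\<dots> \<le> (\<Sum>j. a j)" by (intro sum_le_suminf) auto
    finally show ?thesis .
  qed
  have "(\<lambda>n. ennreal \<bar>A n - A 0\<bar>) \<longlonglongrightarrow> ennreal \<bar>v x - A 0\<bar>"
    unfolding A_def by (intro tendsto_ennrealI tendsto_intros avg_tendsto[OF v int r(1) r0])
  then have "ennreal \<bar>v x - A 0\<bar> \<le> (\<Sum>j. a j)"
    by (rule LIMSEQ_le_const2) (use sum_le in auto)
  then have "ennpow (ennreal \<bar>v x - A 0\<bar>) p \<le> ennpow (\<Sum>j. a j) p"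
    by (intro ennpow_mono p_pos)
  also have "\<dots> \<le> ennreal ((1 / (1 - 1 / sqrt 2)) powr p) * (\<Sum>j. ennreal (((1 / (1 / sqrt 2)) ^ j) powr p) * ennpow (a j) p)"
    by (rule ennpow_suminf_le[OF p_pos]) auto
  also have "\<dots> \<le> ennreal ((1 / (1 - 1 / sqrt 2)) powr p) * (\<Sum>j. ennreal ((D * CP) powr p * s powr p) * (ennreal (\<omega> ^ j) * T j))"
  proof (intro mult_left_mono suminf_le allI summableI)
    fix j
    have "ennpow (a j) p \<le> ennpow (ennreal (D * CP * r j) * ennpow (T j) (1 / p)) p"
      by (intro ennpow_mono p_pos a_le)
    also have "\<dots> = ennreal ((D * CP * r j) powr p) * T j"
      using D_pos CP_pos r(1)[of j] by (simp add: ennpow_mult[OF p_pos] ennpow_ennreal ennpow_root'[OF p_pos])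
    finally have "ennreal (((1 / (1 / sqrt 2)) ^ j) powr p) * ennpow (a j) p
      \<le> ennreal (((1 / (1 / sqrt 2)) ^ j) powr p) * (ennreal ((D * CP * r j) powr p) * T j)"
      by (intro mult_left_mono) auto
    also have "\<dots> = ennreal (((1 / (1 / sqrt 2)) ^ j) powr p * (D * CP * r j) powr p) * T j"
      by (simp add: mult.assoc ennreal_mult)
    also have "((1 / (1 / sqrt 2)) ^ j) powr p * (D * CP * r j) powr p = (D * CP) powr p * s powr p * \<omega> ^ j"
    proof -
      have "((1 / (1 / sqrt 2)) ^ j) powr p * (D * CP * r j) powr p = (sqrt 2 ^ j * (D * CP * (s / 2 ^ j))) powr p"
        using D_pos CP_pos s by (simp add: powr_mult[symmetric] r_def)
      also have "sqrt 2 ^ j * (D * CP * (s / 2 ^ j)) = (D * CP) * s * ((sqrt 2 / 2) ^ j)"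
        by (simp add: power_divide)
      also have "sqrt 2 / 2 = 2 powr (- 1 / 2)"
      proof -
        have "sqrt 2 / 2 = 2 powr (1/2) / 2 powr 1" by (simp add: powr_half_sqrt)
        then show ?thesis unfolding powr_diff[symmetric] by simp
      qed
      also have "(2 powr (- 1 / 2)) ^ j = (2::real) powr (- 1 / 2 * j)"
        by (simp add: powr_realpow[symmetric] powr_powr)
      also have "((D * CP) * s * 2 powr (- 1 / 2 * j)) powr p = (D * CP) powr p * s powr p * \<omega> ^ j"
        using D_pos CP_pos s
        by (simp add: powr_mult powr_powr \<omega>_def powr_realpow[symmetric] algebra_simps)
      finally show ?thesis .
    qed
    also have "ennreal ((D * CP) powr p * s powr p * \<omega> ^ j) * T j = ennreal ((D * CP) powr p * s powr p) * (ennreal (\<omega> ^ j) * T j)"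
      by (simp add: ennreal_mult mult.assoc \<omega>_def)
    finally show "ennreal (((1 / (1 / sqrt 2)) ^ j) powr p) * ennpow (a j) p \<le> ennreal ((D * CP) powr p * s powr p) * (ennreal (\<omega> ^ j) * T j)" .
  qed auto
  also have "\<dots> = ennreal (C_telescope * s powr p) * (\<Sum>j. ennreal (\<omega> ^ j) * T j)"
    by (simp add: C_telescope_def ennreal_mult mult.assoc)
  also have "(\<Sum>j. ennreal (\<omega> ^ j) * T j) = energy_potential h s x"
    by (simp add: energy_potential_def T_def r_def)
  finally show ?thesis by (simp add: A_def r_def)
qed

text \<open>
  In a separable space this open set is a countable union of products of balls.
\<close>
lemma dist_less_measurable: "{(x::'a, y). dist x y < r} \<in> sets (\<mu> \<Otimes>\<^sub>M \<mu>)"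
proof -
  obtain E :: "'a set" where E: "countable E" "\<And>x e. 0 < e \<Longrightarrow> \<exists>d\<in>E. dist d x < e"
    by (rule separable) blast
  have "{(x::'a, y). dist x y < r} = (\<Union>z\<in>E. \<Union>q\<in>\<rat>. ball z q \<times> ball z (r - q))"
  proof (intro equalityI subsetI)
    fix w assume "w \<in> {(x::'a, y). dist x y < r}"
    then obtain x y where w: "w = (x, y)" "dist x y < r" by auto
    define e where "e = (r - dist x y) / 2"
    have "0 < e" using w by (simp add: e_def)
    then obtain z where z: "z \<in> E" "dist z x < e" using E by blast
    have "dist z y \<le> dist z x + dist x y" by (rule dist_triangle)
    then have "dist z x < r - dist z y" using z by (simp add: e_def)
    then obtain q where "q \<in> \<rat>" "dist z x < q" "q < r - dist z y" using Rats_dense_in_real by blast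
    then show "w \<in> (\<Union>z\<in>E. \<Union>q\<in>\<rat>. ball z q \<times> ball z (r - q))" using w z by force
  next
    fix w assume "w \<in> (\<Union>z\<in>E. \<Union>q\<in>\<rat>. ball z q \<times> ball z (r - q))"
    then obtain x y z q where w: "w = (x, y)" "dist z x < q" "dist z y < r - q" by auto
    then show "w \<in> {(x::'a, y). dist x y < r}"
      using dist_triangle[of x y z] by (simp add: dist_commute)
  qed
  also have "\<dots> \<in> sets (\<mu> \<Otimes>\<^sub>M \<mu>)"
    using E(1) countable_rat by (intro sets.countable_UN' pair_measureI) auto
  finally show ?thesis .
qed

lemma near_measurable [measurable]:
  "(\<lambda>(x::'a, y). indicator (ball x r) y :: ennreal) \<in> borel_measurable (\<mu> \<Otimes>\<^sub>M \<mu>)"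
proof -
  have "(\<lambda>(x::'a, y). indicator (ball x r) y :: ennreal) = indicator {(x::'a, y). dist x y < r}"
    by (auto split: split_indicator)
  then show ?thesis by (simp only: borel_measurable_indicator dist_less_measurable)
qed

lemma mean_energy_measurable [measurable]:
  assumes [measurable]: "h \<in> borel_measurable \<mu>"
  shows "(\<lambda>x. mean_energy h x r) \<in> borel_measurable \<mu>"
    and "(\<lambda>x. emeasure \<mu> (ball x r)) \<in> borel_measurable \<mu>"
proof -
  interpret sigma_finite_measure \<mu> by (rule sigma_finite)
  note [measurable] = near_measurable[of r, simplified case_prod_beta]
  have "(\<lambda>x. \<integral>\<^sup>+y. indicator (ball x r) y \<partial>\<mu>) \<in> borel_measurable \<mu>"
    by (intro borel_measurable_nn_integral) (simp add: case_prod_beta')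
  then show [measurable]: "(\<lambda>x. emeasure \<mu> (ball x r)) \<in> borel_measurable \<mu>" by simp
  have "(\<lambda>x. pint (ball x r) h) \<in> borel_measurable \<mu>"
    unfolding pint_def by (intro borel_measurable_nn_integral) (simp add: case_prod_beta')
  then show "(\<lambda>x. mean_energy h x r) \<in> borel_measurable \<mu>" unfolding mean_energy_def by measurable
qed

lemma energy_potential_measurable [measurable]:
  "h \<in> borel_measurable \<mu> \<Longrightarrow> (\<lambda>x. energy_potential h s x) \<in> borel_measurable \<mu>"
  unfolding energy_potential_def by measurable

text \<open>
  After exchanging the order of integration, \<open>h(y)\<^sup>p\<close> is multiplied by at most \<open>D\<close> times the fraction
  of the ball \<open>B(y, r)\<close> that is occupied by \<open>A\<close>.  This fraction is at most \<open>1\<close> and at most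
  \<open>D\<^sup>j \<mu>(A) / m\<close>, and thus at most the \<open>\<theta>\<close>th power of the latter.
\<close>
lemma integral_mean_energy_le:
  assumes h[measurable]: "h \<in> borel_measurable \<mu>" and A[measurable]: "A \<in> sets \<mu>" and AB: "A \<subseteq> ball z \<rho>"
    and r: "0 < r" "r = t / 2 ^ j" and R: "\<rho> + t \<le> R"
    and m: "0 < m" "\<And>y. y \<in> ball z R \<Longrightarrow> m \<le> vol y t"
    and \<theta>: "0 \<le> \<theta>" "\<theta> \<le> 1"
  shows "(\<integral>\<^sup>+x\<in>A. mean_energy h x r \<partial>\<mu>) \<le> ennreal (D * (D ^ j * measure \<mu> A / m) powr \<theta>) * pint (ball z R) h"
proof -
  interpret sigma_finite_measure \<mu> by (rule sigma_finite)
  interpret pair_sigma_finite \<mu> \<mu> ..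
  have t: "0 < t" "r \<le> t" using r by (auto simp: divide_le_eq zero_less_divide_iff mult_le_cancel_left1)
  define F where "F x y = indicator A x * (ennpow (h y) p * indicator (ball x r) y) / emeasure \<mu> (ball x r)" for x y
  have Fm: "case_prod F \<in> borel_measurable (\<mu> \<Otimes>\<^sub>M \<mu>)"
  proof -
    note [measurable] = near_measurable[of r, simplified case_prod_beta] mean_energy_measurable(2)[OF h, of r]
    show ?thesis unfolding F_def case_prod_beta' by measurable
  qed
  let ?K = "D * (D ^ j * measure \<mu> A / m) powr \<theta>"
  have fA: "A \<in> fmeasurable \<mu>" by (rule fmeasurableI2[OF ball_fmeasurable AB A])
  have "(\<integral>\<^sup>+x\<in>A. mean_energy h x r \<partial>\<mu>) = (\<integral>\<^sup>+x. (\<integral>\<^sup>+y. F x y \<partial>\<mu>) \<partial>\<mu>)"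
  proof (intro nn_integral_cong)
    fix x
    show "mean_energy h x r * indicator A x = (\<integral>\<^sup>+y. F x y \<partial>\<mu>)"
      unfolding F_def mean_energy_def pint_def
      by (subst nn_integral_divide, measurable) (auto simp: nn_integral_cmult split: split_indicator)
  qed
  also have "\<dots> = (\<integral>\<^sup>+y. (\<integral>\<^sup>+x. F x y \<partial>\<mu>) \<partial>\<mu>)" by (rule Fubini'[OF Fm, symmetric])
  also have "\<dots> \<le> (\<integral>\<^sup>+y. ennreal ?K * (ennpow (h y) p * indicator (ball z R) y) \<partial>\<mu>)"
  proof (intro nn_integral_mono)
    fix y
    show "(\<integral>\<^sup>+x. F x y \<partial>\<mu>) \<le> ennreal ?K * (ennpow (h y) p * indicator (ball z R) y)"
    proof (cases "y \<in> ball z R")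
      case False
      have "F x y = 0" for x
      proof (cases "x \<in> A \<and> y \<in> ball x r")
        case True
        then have "dist z x < \<rho>" "dist x y < r" using AB by auto
        then have "dist z y < R" using dist_triangle[of z y x] R t by linarith
        then show ?thesis using False by simp
      qed (auto simp: F_def)
      then show ?thesis by simp
    next
      case True
      let ?B = "A \<inter> ball y r"
      have fB: "?B \<in> fmeasurable \<mu>" by (rule fmeasurableI2[OF fA]) auto
      have voly: "0 < vol y r" by (rule vol_pos[OF r(1)])
      have "F x y \<le> ennreal (D / vol y r) * ennpow (h y) p * indicator ?B x" for x
      proof (cases "x \<in> A \<and> y \<in> ball x r")
        case T: True
        have "ball y r \<subseteq> ball x (2 * r)"
        proof
          fix w assume "w \<in> ball y r"
          then show "w \<in> ball x (2 * r)" using T dist_triangle[of x w y] by simp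
        qed
        then have "vol y r \<le> D * vol x r" using vol_mono vol_double[OF r(1), of x] by (meson order_trans)
        then have "1 / vol x r \<le> D / vol y r"
          using voly vol_pos[OF r(1), of x] by (simp add: field_simps)
        then have "ennreal (1 / vol x r) \<le> ennreal (D / vol y r)" by (rule ennreal_leI)
        then have "ennpow (h y) p * ennreal (1 / vol x r) \<le> ennpow (h y) p * ennreal (D / vol y r)"
          by (rule mult_left_mono) simp
        moreover have "F x y = ennpow (h y) p * ennreal (1 / vol x r)"
          using T vol_pos[OF r(1), of x]
          by (simp add: F_def emeasure_vol divide_ennreal_def inverse_ennreal inverse_eq_divide)
        ultimately show ?thesis using T by (simp add: dist_commute mult.commute)
      qed (auto simp: F_def)
      then have "(\<integral>\<^sup>+x. F x y \<partial>\<mu>) \<le> (\<integral>\<^sup>+x. ennreal (D / vol y r) * ennpow (h y) p * indicator ?B x \<partial>\<mu>)"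
        by (intro nn_integral_mono)
      also have "\<dots> = ennreal (D / vol y r) * ennpow (h y) p * ennreal (measure \<mu> ?B)"
        using fB by (subst nn_integral_cmult_indicator) (auto simp: emeasure_eq_measure2 fmeasurableD)
      also have "\<dots> = ennreal (D * (measure \<mu> ?B / vol y r)) * ennpow (h y) p"
        using D_pos voly by (simp add: ennreal_mult[symmetric] mult_ac)
      also have "\<dots> \<le> ennreal ?K * ennpow (h y) p"
      proof (intro mult_right_mono ennreal_leI mult_left_mono)
        let ?\<tau> = "measure \<mu> ?B / vol y r"
        have \<tau>1: "?\<tau> \<le> 1"
          using voly measure_mono_fmeasurable[of ?B "ball y r" \<mu>] fB by (simp add: fmeasurableD)
        have "m \<le> vol y t" by (rule m(2)[OF True])
        also have "\<dots> = vol y (2 ^ j * r)" using r by simp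
        also have "\<dots> \<le> D ^ j * vol y r" by (rule vol_double_pow[OF r(1)])
        finally have mD: "m \<le> D ^ j * vol y r" .
        have "measure \<mu> ?B * m \<le> measure \<mu> A * (D ^ j * vol y r)"
          using m(1) mD fA by (intro mult_mono measure_mono_fmeasurable) (auto intro: sets.Int)
        then have \<tau>2: "?\<tau> \<le> D ^ j * measure \<mu> A / m"
          using voly m(1) by (simp add: field_simps)
        have "?\<tau> \<le> ?\<tau> powr \<theta>"
        proof (cases "?\<tau> = 0")
          case False
          then have "0 < ?\<tau>" using voly by (auto simp: zero_less_divide_iff less_le)
          then have "?\<tau> powr 1 \<le> ?\<tau> powr \<theta>" using \<tau>1 \<theta> by (intro powr_mono') auto
          then show ?thesis using \<open>0 < ?\<tau>\<close> by simp
        next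
          case True
          then show ?thesis by (metis powr_ge_zero)
        qed
        also have "\<dots> \<le> (D ^ j * measure \<mu> A / m) powr \<theta>"
          using \<theta> \<tau>2 by (intro powr_mono2) auto
        finally show "?\<tau> \<le> (D ^ j * measure \<mu> A / m) powr \<theta>" .
      qed (use D_pos in auto)
      finally show ?thesis using True by simp
    qed
  qed
  also have "\<dots> = ennreal ?K * pint (ball z R) h"
    unfolding pint_def by (subst nn_integral_cmult) auto
  finally show ?thesis .
qed

text \<open>
  The factor \<open>(\<mu>(A) / m)\<^sup>\<theta>\<close> plays the role of the gain of integrability in Sobolev's inequality.
  The exponent \<open>\<theta>\<close> has to be so small that the weights \<open>\<omega>\<^sup>j\<close> compensate for \<open>D\<^sup>j\<^sup>\<theta>\<close>.
\<close>
lemma integral_energy_potential_le: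
  assumes h[measurable]: "h \<in> borel_measurable \<mu>" and A[measurable]: "A \<in> sets \<mu>" and AB: "A \<subseteq> ball z \<rho>"
    and s: "0 < s" and R: "\<rho> + \<Lambda> * s \<le> R"
    and m: "0 < m" "\<And>y. y \<in> ball z R \<Longrightarrow> m \<le> vol y (\<Lambda> * s)"
    and \<theta>: "0 \<le> \<theta>" "\<theta> \<le> 1" "D powr \<theta> * \<omega> < 1"
  shows "(\<integral>\<^sup>+x\<in>A. energy_potential h s x \<partial>\<mu>) \<le>
    ennreal (D / (1 - D powr \<theta> * \<omega>) * (measure \<mu> A / m) powr \<theta>) * pint (ball z R) h"
proof -
  let ?P = "pint (ball z R) h" and ?q = "D powr \<theta> * \<omega>"
  have \<omega>0: "0 < \<omega>" by (simp add: \<omega>_def)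
  have "(\<integral>\<^sup>+x\<in>A. energy_potential h s x \<partial>\<mu>)
      = (\<integral>\<^sup>+x. (\<Sum>j. ennreal (\<omega> ^ j) * (mean_energy h x (\<Lambda> * (s / 2 ^ j)) * indicator A x)) \<partial>\<mu>)"
    unfolding energy_potential_def by (simp add: ennreal_suminf_multc[symmetric] mult.assoc)
  also have "\<dots> = (\<Sum>j. \<integral>\<^sup>+x. ennreal (\<omega> ^ j) * (mean_energy h x (\<Lambda> * (s / 2 ^ j)) * indicator A x) \<partial>\<mu>)"
    by (rule nn_integral_suminf) measurable
  also have "\<dots> \<le> (\<Sum>j. ennreal (?q ^ j) * (ennreal (D * (measure \<mu> A / m) powr \<theta>) * ?P))"
  proof (intro suminf_le summableI allI)
    fix j
    have "(\<integral>\<^sup>+x. ennreal (\<omega> ^ j) * (mean_energy h x (\<Lambda> * (s / 2 ^ j)) * indicator A x) \<partial>\<mu>)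
       = ennreal (\<omega> ^ j) * (\<integral>\<^sup>+x\<in>A. mean_energy h x (\<Lambda> * (s / 2 ^ j)) \<partial>\<mu>)"
      by (rule nn_integral_cmult) measurable
    also have "\<dots> \<le> ennreal (\<omega> ^ j) * (ennreal (D * (D ^ j * measure \<mu> A / m) powr \<theta>) * ?P)"
      using s \<Lambda>_pos by (intro mult_left_mono integral_mean_energy_le[OF h A AB _ _ R m \<theta>(1,2)]) auto
    also have "\<dots> = ennreal (\<omega> ^ j * (D * (D ^ j * measure \<mu> A / m) powr \<theta>)) * ?P"
      using \<omega>0 D_pos by (simp add: ennreal_mult mult.assoc)
    also have "\<omega> ^ j * (D * (D ^ j * measure \<mu> A / m) powr \<theta>) = ?q ^ j * (D * (measure \<mu> A / m) powr \<theta>)"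
    proof -
      have "(D ^ j * measure \<mu> A / m) powr \<theta> = (D ^ j * (measure \<mu> A / m)) powr \<theta>" by simp
      also have "\<dots> = (D ^ j) powr \<theta> * (measure \<mu> A / m) powr \<theta>"
        by (rule powr_mult)
      also have "(D ^ j) powr \<theta> = (D powr \<theta>) ^ j"
        using D_pos by (simp add: powr_realpow[symmetric] powr_powr mult.commute)
      finally show ?thesis by (simp add: power_mult_distrib mult_ac)
    qed
    also have "ennreal (?q ^ j * (D * (measure \<mu> A / m) powr \<theta>)) * ?P = ennreal (?q ^ j) * (ennreal (D * (measure \<mu> A / m) powr \<theta>) * ?P)"
      using \<omega>0 D_pos by (subst ennreal_mult) (auto simp: mult.assoc)
    finally show "(\<integral>\<^sup>+x. ennreal (\<omega> ^ j) * (mean_energy h x (\<Lambda> * (s / 2 ^ j)) * indicator A x) \<partial>\<mu>)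
       \<le> ennreal (?q ^ j) * (ennreal (D * (measure \<mu> A / m) powr \<theta>) * ?P)" .
  qed
  also have "\<dots> = (\<Sum>j. ennreal (?q ^ j)) * (ennreal (D * (measure \<mu> A / m) powr \<theta>) * ?P)" by simp
  also have "(\<Sum>j. ennreal (?q ^ j)) = ennreal (1 / (1 - ?q))"
    using \<theta> \<omega>0 by (subst suminf_ennreal2) (auto simp: summable_geometric suminf_geometric)
  also have "ennreal (1 / (1 - ?q)) * (ennreal (D * (measure \<mu> A / m) powr \<theta>) * ?P) = ennreal (D / (1 - ?q) * (measure \<mu> A / m) powr \<theta>) * ?P"
    using \<theta> D_pos by (simp add: ennreal_mult[symmetric] mult.assoc[symmetric])
  finally show ?thesis .
qed

end

section \<open>De Giorgi iteration\<close>

text \<open>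
  If \<open>y 0\<close> is small, the superlinear power of \<open>y i\<close> compensates for the growth of \<open>b\<^sup>i\<close>, and
  \<open>y i \<le> y 0 / b\<^sup>i\<close> is preserved.
\<close>
lemma fast_decay:
  fixes y :: "nat \<Rightarrow> real"
  assumes y: "\<And>i. 0 \<le> y i" and C: "0 < C" and b: "1 < b" and B: "0 \<le> B" and \<theta>: "0 < \<theta>" "\<theta> \<le> 1"
    and step: "\<And>i. y (Suc i) \<le> C * y i * ((b ^ i * B * y i) powr \<theta> + b ^ i * B * y i)"
    and small: "B * y 0 \<le> 1" "2 * C * (B * y 0) powr \<theta> \<le> 1 / b"
  shows "y \<longlonglongrightarrow> 0"
proof -
  have bound: "y i \<le> y 0 * (1 / b) ^ i" for i
  proof (induction i)
    case (Suc i)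
    define w where "w = b ^ i * B * y i"
    have "b ^ i * B * y i \<le> b ^ i * B * (y 0 * (1 / b) ^ i)"
      using Suc b B by (intro mult_left_mono) auto
    also have "\<dots> = B * y 0" using b by (simp add: power_divide)
    finally have w: "0 \<le> w" "w \<le> B * y 0" using b B y[of i] by (auto simp: w_def)
    have w1: "w \<le> 1" using w small by simp
    have "w \<le> w powr \<theta>"
    proof (cases "w = 0")
      case False
      then have "w powr 1 \<le> w powr \<theta>" using w w1 \<theta> by (intro powr_mono') auto
      then show ?thesis using False w by simp
    qed simp
    also have "w powr \<theta> \<le> (B * y 0) powr \<theta>" using w \<theta> by (intro powr_mono2) auto
    finally have 1: "w powr \<theta> + w \<le> 2 * (B * y 0) powr \<theta>"
      using powr_mono2[of \<theta> w "B * y 0"] w \<theta> by simp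
    have "y (Suc i) \<le> C * y i * (w powr \<theta> + w)" using step[of i] by (simp add: w_def)
    also have "\<dots> \<le> C * y i * (2 * (B * y 0) powr \<theta>)"
      using 1 C y[of i] by (intro mult_left_mono) auto
    also have "\<dots> = y i * (2 * C * (B * y 0) powr \<theta>)" by simp
    also have "\<dots> \<le> y i * (1 / b)" using small(2) y[of i] by (intro mult_left_mono) auto
    also have "\<dots> \<le> y 0 * (1 / b) ^ i * (1 / b)" using Suc b by (intro mult_right_mono) auto
    finally show ?case by simp
  qed simp
  have "(\<lambda>i. y 0 * (1 / b) ^ i) \<longlonglongrightarrow> y 0 * 0"
    using b by (intro tendsto_intros LIMSEQ_power_zero) auto
  then show ?thesis
    using y bound by (intro tendsto_sandwich[of "\<lambda>_. 0" y sequentially "\<lambda>i. y 0 * (1 / b) ^ i"]) auto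
qed

context poincare_setting begin

lemma ex_\<theta>: "\<exists>\<theta>>0. \<theta> \<le> 1 \<and> D powr \<theta> * \<omega> < 1"
proof -
  have "\<omega> < 1" using p_pos powr_less_mono[of "- p / 2" 0 2] by (simp add: \<omega>_def)
  have "((\<lambda>\<theta>. D powr \<theta> * \<omega>) \<longlongrightarrow> D powr 0 * \<omega>) (at_right 0)"
    using D_pos by (intro tendsto_intros) auto
  then have "eventually (\<lambda>\<theta>. D powr \<theta> * \<omega> < 1) (at_right 0)"
    using D_pos \<open>\<omega> < 1\<close> by (intro order_tendstoD(2)) auto
  then obtain b where b: "b > 0" "\<And>\<theta>. 0 < \<theta> \<Longrightarrow> \<theta> < b \<Longrightarrow> D powr \<theta> * \<omega> < 1"
    by (auto simp: eventually_at_right_field)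
  then show ?thesis by (intro exI[of _ "min 1 (b / 2)"]) auto
qed

definition \<theta> :: real where "\<theta> = (SOME \<theta>. 0 < \<theta> \<and> \<theta> \<le> 1 \<and> D powr \<theta> * \<omega> < 1)"

lemma \<theta>: "0 < \<theta>" "\<theta> \<le> 1" "D powr \<theta> * \<omega> < 1"
  using someI_ex[OF ex_\<theta>] unfolding \<theta>_def by auto

definition C_deviation :: real where "C_deviation = C_telescope * (D / (1 - D powr \<theta> * \<omega>))"

lemma C_deviation_nonneg: "0 \<le> C_deviation" using D_pos \<theta> by (simp add: C_deviation_def C_telescope_def)

lemma ball_subsetI: "dist z x + s \<le> R \<Longrightarrow> ball x s \<subseteq> ball z R" for x z :: 'a
proof
  fix y assume "dist z x + s \<le> R" "y \<in> ball x s"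
  then show "y \<in> ball z R" using dist_triangle[of z y x] by simp
qed

lemma Chebyshev:
  assumes "0 \<le> t" and [measurable]: "B \<in> sets \<mu>"
    and B: "\<And>x. x \<in> B \<Longrightarrow> x \<in> A \<and> ennreal t \<le> f x"
  shows "ennreal (t powr p) * emeasure \<mu> B \<le> pint A f"
proof -
  have "ennreal (t powr p) * emeasure \<mu> B = pint B (\<lambda>x. ennreal t)"
    using assms(1) by (simp add: pint_def ennpow_ennreal nn_integral_cmult_indicator)
  also have "\<dots> \<le> pint A f" by (rule pint_mono) (rule B)
  finally show ?thesis .
qed

text \<open>
  Combines \<open>telescoping\<close> with \<open>integral_energy_potential_le\<close>.  The error \<open>e\<close> makes it possible to compare
  with something else than the averages over balls of radius \<open>s\<close>.
\<close>
lemma deviation_pint_le: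
  assumes v: "continuous_on UNIV v" "Lp_bounded (\<lambda>x. ennreal \<bar>v x\<bar>)" and h: "wug v h" and s: "0 < s"
    and A[measurable]: "A \<in> sets \<mu>" and AR: "A \<subseteq> ball z \<rho>" "\<rho> + \<Lambda> * s \<le> R"
    and m: "0 < m" "\<And>y. y \<in> ball z R \<Longrightarrow> m \<le> vol y (\<Lambda> * s)"
    and f: "\<And>x. x \<in> A \<Longrightarrow> f x \<le> ennreal \<bar>v x - avg \<mu> (ball x s) v\<bar> + e x"
    and e: "\<And>x. x \<in> A \<Longrightarrow> ennpow (e x) p \<le> K"
  shows "pint A f \<le> ennreal (2 powr p) *
    (ennreal (C_deviation * s powr p * (measure \<mu> A / m) powr \<theta>) * pint (ball z R) h + K * emeasure \<mu> A)"
proof -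
  have hm[measurable]: "h \<in> borel_measurable \<mu>" by (rule wugD_measurable[OF h])
  let ?c = "ennreal (C_telescope * s powr p)"
  have "pint A f \<le> (\<integral>\<^sup>+x. ennreal (2 powr p) * (?c * (energy_potential h s x * indicator A x) + K * indicator A x) \<partial>\<mu>)"
    unfolding pint_def
  proof (rule nn_integral_mono)
    fix x
    show "ennpow (f x) p * indicator A x \<le> ennreal (2 powr p) * (?c * (energy_potential h s x * indicator A x) + K * indicator A x)"
    proof (cases "x \<in> A")
      case True
      let ?d = "ennreal \<bar>v x - avg \<mu> (ball x s) v\<bar>"
      have "ennpow (f x) p \<le> ennpow (?d + e x) p"
        by (intro ennpow_mono p_pos f True)
      also have "\<dots> \<le> ennreal (2 powr p) * (ennpow ?d p + ennpow (e x) p)"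
        by (rule ennpow_add_le[OF p_pos])
      also have "\<dots> \<le> ennreal (2 powr p) * (?c * energy_potential h s x + K)"
        by (intro mult_left_mono add_mono telescoping[OF v h s] e True) auto
      finally show ?thesis using True by simp
    qed simp
  qed
  also have "\<dots> = ennreal (2 powr p) * (?c * (\<integral>\<^sup>+x\<in>A. energy_potential h s x \<partial>\<mu>) + K * emeasure \<mu> A)"
    by (subst nn_integral_cmult, measurable) (subst nn_integral_add, auto simp: nn_integral_cmult nn_integral_cmult_indicator)
  also have "\<dots> \<le> ennreal (2 powr p) * (?c *
      (ennreal (D / (1 - D powr \<theta> * \<omega>) * (measure \<mu> A / m) powr \<theta>) * pint (ball z R) h) + K * emeasure \<mu> A)"
    using \<theta> by (intro mult_left_mono add_right_mono integral_energy_potential_le[OF hm A AR(1) s AR(2) m]) auto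
  also have "?c * (ennreal (D / (1 - D powr \<theta> * \<omega>) * (measure \<mu> A / m) powr \<theta>) * pint (ball z R) h)
      = ennreal (C_telescope * s powr p * (D / (1 - D powr \<theta> * \<omega>) * (measure \<mu> A / m) powr \<theta>)) * pint (ball z R) h"
    using D_pos \<theta> by (subst ennreal_mult) (auto simp: C_telescope_def mult.assoc)
  also have "C_telescope * s powr p * (D / (1 - D powr \<theta> * \<omega>) * (measure \<mu> A / m) powr \<theta>) = C_deviation * s powr p * (measure \<mu> A / m) powr \<theta>"
    by (simp add: C_deviation_def)
  finally show ?thesis .
qed

text \<open>
  A form of Jensen's inequality: integrate \<open>v \<le> t + t\<^sup>1\<^sup>-\<^sup>p v\<^sup>p\<close> and choose \<open>t\<^sup>p = M\<close>.
\<close>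
lemma avg_powr_le:
  assumes v: "continuous_on UNIV v" "\<And>y. 0 \<le> v y" and vL: "Lp_bounded (\<lambda>x. ennreal (v x))"
    and s: "0 < s" and M: "pint (ball x s) (\<lambda>y. ennreal (v y)) \<le> ennreal (M * vol x s)" "0 \<le> M"
  shows "0 \<le> avg \<mu> (ball x s) v" "avg \<mu> (ball x s) v powr p \<le> 2 powr p * M"
proof -
  have [measurable]: "v \<in> borel_measurable \<mu>" by (rule continuous_measurable[OF v(1)])
  have int: "set_integrable \<mu> (ball x s) v"
    using v vL by (intro Lp_bounded_set_integrable) auto
  have vp: "0 < vol x s" by (rule vol_pos[OF s])
  define c where "c = avg \<mu> (ball x s) v"
  have c0: "0 \<le> c"
    unfolding c_def avg_def set_lebesgue_integral_def using v(2)
    by (intro divide_nonneg_nonneg integral_nonneg) auto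
  then show "0 \<le> avg \<mu> (ball x s) v" by (simp add: c_def)
  have bound: "c \<le> t + t powr (1 - p) * M" if t: "0 < t" for t
  proof -
    have "ennreal (c * vol x s) = ennreal (\<integral>y\<in>ball x s. v y \<partial>\<mu>)" using vp by (simp add: c_def avg_def)
    also have "\<dots> = (\<integral>\<^sup>+y. ennreal (indicator (ball x s) y *\<^sub>R v y) \<partial>\<mu>)"
      unfolding set_lebesgue_integral_def using int v(2)
      by (intro nn_integral_eq_integral[symmetric]) (auto simp: set_integrable_def)
    also have "\<dots> \<le> (\<integral>\<^sup>+y. ennreal t * indicator (ball x s) y + ennreal (t powr (1 - p)) * (ennpow (ennreal (v y)) p * indicator (ball x s) y) \<partial>\<mu>)"
    proof (rule nn_integral_mono)
      fix y
      have "v y \<le> t + t powr (1 - p) * v y powr p"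
      proof (cases "v y \<le> t")
        case False
        then have vt: "t < v y" by simp
        have "v y = v y powr (1 - p) * v y powr p"
          using vt t by (simp add: powr_add[symmetric])
        also have "\<dots> \<le> t powr (1 - p) * v y powr p"
          using vt t p_gt_1 by (intro mult_right_mono powr_mono2') auto
        finally show ?thesis using t by simp
      qed (simp add: add_increasing2)
      then have "ennreal (v y) \<le> ennreal (t + t powr (1 - p) * v y powr p)" by (rule ennreal_leI)
      also have "\<dots> = ennreal t + ennreal (t powr (1 - p)) * ennpow (ennreal (v y)) p"
        using t v(2)[of y] by (simp add: ennpow_ennreal ennreal_mult)
      finally show "ennreal (indicator (ball x s) y *\<^sub>R v y) \<le> ennreal t * indicator (ball x s) y + ennreal (t powr (1 - p)) * (ennpow (ennreal (v y)) p * indicator (ball x s) y)"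
        by (auto split: split_indicator)
    qed
    also have "\<dots> = ennreal t * ennreal (vol x s) + ennreal (t powr (1 - p)) * pint (ball x s) (\<lambda>y. ennreal (v y))"
      unfolding pint_def
      by (subst nn_integral_add) (auto simp: nn_integral_cmult nn_integral_cmult_indicator emeasure_vol)
    also have "\<dots> \<le> ennreal t * ennreal (vol x s) + ennreal (t powr (1 - p)) * ennreal (M * vol x s)"
      by (intro add_left_mono mult_left_mono M) auto
    also have "\<dots> = ennreal ((t + t powr (1 - p) * M) * vol x s)"
      using t M(2) by (simp add: ennreal_mult[symmetric] ennreal_plus[symmetric] algebra_simps del: ennreal_plus)
    finally have "c * vol x s \<le> (t + t powr (1 - p) * M) * vol x s"
      using t M(2) vp by (subst (asm) ennreal_le_iff) auto
    then show ?thesis using vp by simp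
  qed
  show "avg \<mu> (ball x s) v powr p \<le> 2 powr p * M"
  proof (cases "M = 0")
    case True
    then have "c \<le> 0 + t" if "0 < t" for t using bound[OF that] by simp
    then have "c \<le> 0" by (rule field_le_epsilon)
    then show ?thesis using c0 True by (simp add: c_def)
  next
    case False
    then have M0: "0 < M" using M by simp
    define t where "t = M powr (1 / p)"
    have t: "0 < t" "t powr p = M" using M0 p_pos by (auto simp: t_def powr_powr)
    have "t powr (1 - p) * M = t powr (1 - p) * t powr p" by (simp add: t)
    also have "\<dots> = t" using t(1) by (simp add: powr_add[symmetric])
    finally have "c \<le> 2 * t" using bound[OF t(1)] by simp
    then have "c powr p \<le> (2 * t) powr p" using c0 p_pos by (intro powr_mono2) auto
    also have "\<dots> = 2 powr p * M" using t by (simp add: powr_mult)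
    finally show ?thesis by (simp add: c_def)
  qed
qed

definition excess :: "('a \<Rightarrow> real) \<Rightarrow> real \<Rightarrow> 'a \<Rightarrow> real \<Rightarrow> real" where
  "excess u k z R = enn2real (pint (ball z R) (\<lambda>y. ennreal (max 0 (u y - k))))"

lemma excess_pint:
  assumes "quasimin Q u g"
  shows "pint (ball z R) (\<lambda>y. ennreal (max 0 (u y - k))) = ennreal (excess u k z R)"
  using excess_Lp_bounded[of u k] assms unfolding quasimin_def Lp_bounded_def by (simp add: excess_def)

lemma excess_nonneg: "0 \<le> excess u k z R" by (simp add: excess_def)

lemma excess_mono:
  assumes "quasimin Q u g" "R \<le> R'" "k' \<le> k"
  shows "excess u k z R \<le> excess u k' z R'"
proof -
  have "pint (ball z R) (\<lambda>y. ennreal (max 0 (u y - k))) \<le> pint (ball z R') (\<lambda>y. ennreal (max 0 (u y - k')))"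
    using assms by (intro pint_mono) (auto intro!: ennreal_leI)
  then show ?thesis by (simp add: excess_pint[OF assms(1)] excess_nonneg ennreal_le_iff)
qed

definition C_step :: "real \<Rightarrow> real" where
  "C_step Q = 2 powr p * (C_deviation * caccioppoli_const Q + 2 powr p)"

lemma caccioppoli_const_pos: "1 \<le> Q \<Longrightarrow> 0 \<le> caccioppoli_const Q"
proof -
  assume "1 \<le> Q"
  then have "0 < Q * 2 powr p" by simp
  then have "0 < 1 + Q * 2 powr p" by simp
  then show ?thesis
    unfolding caccioppoli_const_def Let_def by (auto intro!: divide_nonneg_nonneg simp: divide_le_eq_1)
qed

text \<open>
  Where \<open>u > k + H\<close>, the function \<open>v = (u - k)\<^sub>+\<close> is compared with its averages over balls of radius \<open>s\<close>.
  The averages are bounded by the excess at level \<open>k\<close>.  The deviation from them is bounded by the energy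
  above level \<open>k\<close>, hence by the excess again, times a power of the measure of \<open>{u > k + H}\<close>, which
  is at most the excess divided by \<open>H\<^sup>p\<close>.
\<close>
lemma De_Giorgi_step:
  assumes qm: "quasimin Q u g" and R: "0 < \<rho>" "\<rho> < R" and H: "0 < H"
    and s: "s = (R - \<rho>) / (2 * \<Lambda>)"
    and m: "0 < m" "\<And>y. y \<in> ball z R \<Longrightarrow> m \<le> vol y s"
  shows "excess u (k + H) z \<rho> \<le> C_step Q * excess u k z R *
    ((excess u k z R / (H powr p * m)) powr \<theta> + excess u k z R / (H powr p * m))"
proof -
  have u: "continuous_on UNIV u" and g: "wug u g" "Lp_bounded g" and uL: "Lp_bounded (\<lambda>x. ennreal \<bar>u x\<bar>)" and Q: "1 \<le> Q"
    using qm by (auto simp: quasimin_def)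
  have [measurable]: "u \<in> borel_measurable \<mu>" by (rule continuous_measurable[OF u])
  have s0: "0 < s" using R \<Lambda>_pos by (simp add: s)
  define Y where "Y = excess u k z R"
  have Y0: "0 \<le> Y" by (simp add: Y_def excess_nonneg)
  define v where "v y = max 0 (u y - k)" for y
  have v_cont: "continuous_on UNIV v" unfolding v_def by (intro continuous_intros u)
  have [measurable]: "v \<in> borel_measurable \<mu>" by (rule continuous_measurable[OF v_cont])
  have v0: "0 \<le> v y" for y by (simp add: v_def)
  have vL: "Lp_bounded (\<lambda>y. ennreal (v y))" unfolding v_def by (rule excess_Lp_bounded[OF u uL])
  have vY: "pint (ball z R) (\<lambda>y. ennreal (v y)) = ennreal Y"
    unfolding v_def Y_def by (rule excess_pint[OF qm])
  define h where "h y = (if u y \<le> k then 0 else g y)" for y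
  have h: "wug v h" unfolding v_def h_def by (rule wug_excess[OF u g(1) Lp_bounded_loc[OF g(2)]])
  have hm[measurable]: "h \<in> borel_measurable \<mu>" by (rule wugD_measurable[OF h])
  define A where "A = superlevel u (k + H) z \<rho>"
  have Am[measurable]: "A \<in> sets \<mu>" unfolding A_def by (rule superlevel_sets[OF u])
  have A_sub: "A \<subseteq> ball z \<rho>" by (auto simp: A_def superlevel_def)
  have fA: "A \<in> fmeasurable \<mu>" by (rule fmeasurableI2[OF ball_fmeasurable A_sub Am])
  have emA: "emeasure \<mu> A = ennreal (measure \<mu> A)"
    using fA by (simp add: emeasure_eq_measure2 fmeasurableD)
  define a where "a = measure \<mu> A"
  have a0: "0 \<le> a" by (simp add: a_def)
  
  have a_le: "a \<le> Y / H powr p"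
  proof -
    have "ennreal (H powr p * a) = ennreal (H powr p) * emeasure \<mu> A" by (simp add: emA a_def ennreal_mult)
    also have "\<dots> \<le> pint (ball z R) (\<lambda>y. ennreal (v y))"
      using H R by (intro Chebyshev Am conjI ennreal_leI) (auto simp: A_def superlevel_def v_def)
    finally have "H powr p * a \<le> Y" unfolding vY using Y0 by (simp add: ennreal_le_iff)
    then show ?thesis using H by (simp add: field_simps)
  qed
  define c where "c x = avg \<mu> (ball x s) v" for x
  have c: "0 \<le> c x" "c x powr p \<le> 2 powr p * (Y / m)" if x: "x \<in> ball z \<rho>" for x
  proof -
    have "s \<le> R - \<rho>" using R \<Lambda>_ge_1 by (simp add: s divide_le_eq mult_le_cancel_left1)
    then have sub: "ball x s \<subseteq> ball z R" using x by (intro ball_subsetI) auto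
    have "m \<le> vol x s" using x R by (intro m) auto
    then have "Y / m * m \<le> Y / m * vol x s" using Y0 m(1) by (intro mult_left_mono) auto
    then have "Y \<le> Y / m * vol x s" using m(1) by simp
    have "pint (ball x s) (\<lambda>y. ennreal (v y)) \<le> ennreal Y"
      unfolding vY[symmetric] using sub by (intro pint_mono) auto
    also have "\<dots> \<le> ennreal (Y / m * vol x s)" by (rule ennreal_leI) fact
    finally have *: "pint (ball x s) (\<lambda>y. ennreal (v y)) \<le> ennreal (Y / m * vol x s)" .
    show "0 \<le> c x" "c x powr p \<le> 2 powr p * (Y / m)"
      unfolding c_def using Y0 m(1) by (intro avg_powr_le[OF v_cont v0 vL s0 *]; simp)+
  qed
  \<comment> \<open>One half of \<open>R - \<rho>\<close> is left for the balls \<open>B(x, \<Lambda> s)\<close>, the other for the Caccioppoli inequality.\<close>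
  define R' where "R' = \<rho> + \<Lambda> * s"
  have \<Lambda>s: "\<Lambda> * s = (R - \<rho>) / 2" "R - R' = \<Lambda> * s" "0 < \<Lambda> * s"
    using \<Lambda>_pos R by (auto simp: s R'_def field_simps)
  note cc = caccioppoli_const_pos[OF Q]
  have "ennreal (excess u (k + H) z \<rho>) = pint A (\<lambda>y. ennreal (max 0 (u y - (k + H))))"
    unfolding excess_pint[OF qm, symmetric] pint_def
    by (intro nn_integral_cong) (auto simp: A_def superlevel_def max_def split: split_indicator)
  also have "\<dots> \<le> ennreal (2 powr p) *
    (ennreal (C_deviation * s powr p * (a / m) powr \<theta>) * pint (ball z R') h + ennreal (2 powr p * (Y / m)) * emeasure \<mu> A)"
    unfolding a_def
  proof (rule deviation_pint_le[OF v_cont _ h s0 Am A_sub _ m(1)])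
    show "Lp_bounded (\<lambda>x. ennreal \<bar>v x\<bar>)" using vL v0 by simp
    show "\<rho> + \<Lambda> * s \<le> R'" by (simp add: R'_def)
    show "m \<le> vol y (\<Lambda> * s)" if "y \<in> ball z R'" for y
    proof -
      have "m \<le> vol y s" using that \<Lambda>s by (intro m) auto
      also have "\<dots> \<le> vol y (\<Lambda> * s)" using s0 \<Lambda>_ge_1 by (intro vol_mono subset_ball) (simp add: mult_le_cancel_right1)
      finally show ?thesis .
    qed
    fix x assume "x \<in> A"
    then have x: "x \<in> ball z \<rho>" using A_sub by auto
    have "max 0 (u x - (k + H)) \<le> \<bar>v x - c x\<bar> + c x" using H by (auto simp: v_def)
    then have "ennreal (max 0 (u x - (k + H))) \<le> ennreal (\<bar>v x - c x\<bar> + c x)" by (rule ennreal_leI)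
    then show "ennreal (max 0 (u x - (k + H))) \<le> ennreal \<bar>v x - avg \<mu> (ball x s) v\<bar> + ennreal (c x)"
      using c(1)[OF x] by (simp add: c_def)
    show "ennpow (ennreal (c x)) p \<le> ennreal (2 powr p * (Y / m))"
      using c[OF x] by (simp add: ennpow_ennreal ennreal_leI)
  qed
  also have "pint (ball z R') h = pint (superlevel u k z R') g"
    unfolding pint_def h_def by (intro nn_integral_cong) (auto simp: superlevel_def split: split_indicator)
  also have "ennreal (2 powr p) * (ennreal (C_deviation * s powr p * (a / m) powr \<theta>) * pint (superlevel u k z R') g + ennreal (2 powr p * (Y / m)) * emeasure \<mu> A)
     \<le> ennreal (2 powr p) * (ennreal (C_deviation * s powr p * (a / m) powr \<theta>) *
          (ennreal (caccioppoli_const Q * (\<Lambda> * s) powr (- p)) * ennreal Y) + ennreal (2 powr p * (Y / m)) * ennreal a)"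
  proof (intro mult_left_mono add_mono)
    show "pint (superlevel u k z R') g \<le> ennreal (caccioppoli_const Q * (\<Lambda> * s) powr (- p)) * ennreal Y"
    proof -
      have "0 < R'" "R' < R" using R \<Lambda>s by (auto simp: R'_def)
      from Caccioppoli[OF qm this, of k z] show ?thesis unfolding \<Lambda>s(2) vY[unfolded v_def] .
    qed
  qed (auto simp: emA a_def)
  also have "\<dots> = ennreal (2 powr p * (C_deviation * s powr p * (a / m) powr \<theta> * (caccioppoli_const Q * (\<Lambda> * s) powr (- p) * Y) + 2 powr p * (Y / m) * a))"
    using C_deviation_nonneg cc Y0 a0 m(1)
    by (simp add: ennreal_mult[symmetric] ennreal_plus[symmetric] del: ennreal_plus)
  finally have "excess u (k + H) z \<rho> \<le> 2 powr p * (C_deviation * s powr p * (a / m) powr \<theta> * (caccioppoli_const Q * (\<Lambda> * s) powr (- p) * Y) + 2 powr p * (Y / m) * a)"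
    using C_deviation_nonneg cc Y0 a0 m(1) by (subst (asm) ennreal_le_iff) auto
  also have "\<dots> = 2 powr p * (C_deviation * caccioppoli_const Q * (s powr p * (\<Lambda> * s) powr (- p)) * (Y * (a / m) powr \<theta>) + 2 powr p * (Y * (a / m)))"
    by (simp add: mult_ac)
  also have "\<dots> \<le> 2 powr p * (C_deviation * caccioppoli_const Q * 1 * (Y * (Y / (H powr p * m)) powr \<theta>) + 2 powr p * (Y * (Y / (H powr p * m))))"
  proof -
    have az: "a / m \<le> Y / (H powr p * m)"
    proof -
      have "a / m \<le> Y / H powr p / m" using a_le m(1) by (intro divide_right_mono) auto
      then show ?thesis by simp
    qed
    have "s powr p * (\<Lambda> * s) powr (- p) = \<Lambda> powr (- p)"
      using s0 \<Lambda>_pos by (simp add: powr_mult powr_minus)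
    also have "\<dots> \<le> 1" using \<Lambda>_ge_1 p_pos by (simp add: powr_minus inverse_le_1_iff ge_one_powr_ge_zero)
    finally show ?thesis
      using az C_deviation_nonneg cc Y0 a0 m(1) \<theta>
      by (intro mult_left_mono add_mono mult_mono powr_mono2) auto
  qed
  also have "\<dots> \<le> C_step Q * Y * ((Y / (H powr p * m)) powr \<theta> + Y / (H powr p * m))"
  proof -
    define E1 E2 K where "E1 = Y * (Y / (H powr p * m)) powr \<theta>" "E2 = Y * (Y / (H powr p * m))" "K = C_deviation * caccioppoli_const Q"
    have "0 \<le> E1" "0 \<le> E2" "0 \<le> K" using Y0 m(1) C_deviation_nonneg cc by (auto simp: E1_E2_K_def)
    then have "K * E1 + 2 powr p * E2 \<le> (K + 2 powr p) * (E1 + E2)" by (simp add: algebra_simps)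
    then have "2 powr p * (K * E1 + 2 powr p * E2) \<le> 2 powr p * ((K + 2 powr p) * (E1 + E2))" by (rule mult_left_mono) simp
    moreover have "C_step Q * Y * ((Y / (H powr p * m)) powr \<theta> + Y / (H powr p * m)) = 2 powr p * ((K + 2 powr p) * (E1 + E2))"
      unfolding C_step_def E1_E2_K_def by (simp add: algebra_simps)
    ultimately show ?thesis by (simp add: E1_E2_K_def)
  qed
  finally show ?thesis by (simp add: Y_def)
qed

text \<open>
  De Giorgi's iteration with radii \<open>r (1 + 2\<^sup>-\<^sup>i)\<close> and levels \<open>k + H (1 - 2\<^sup>-\<^sup>i)\<close>.  The halving of the
  gaps between levels and between radii costs factors \<open>2\<^sup>p\<close> and \<open>D\<close> in each step, so \<open>De_Giorgi_step\<close> has the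
  form required by \<open>fast_decay\<close> with \<open>b = 2\<^sup>p D\<close>.  In the limit \<open>u \<le> k + H\<close> almost everywhere on
  the ball, and everywhere by continuity.
\<close>
lemma local_boundedness:
  assumes Q: "1 \<le> Q"
  shows "\<exists>\<kappa>>0. \<forall>u g z r k H. quasimin Q u g \<and> 0 < r \<and> 0 < H \<and>
      excess u k z (2 * r) \<le> \<kappa> * (H powr p * vol z (2 * r)) \<longrightarrow> (\<forall>y\<in>ball z r. u y \<le> k + H)"
proof -
  obtain L :: nat where L: "\<Lambda> \<le> 2 ^ L" using real_arch_pow[of 2 \<Lambda>] by (auto intro: less_imp_le)
  \<comment> \<open>With this \<open>N\<close>, the radius \<open>s\<close> of the \<open>i\<close>th step satisfies \<open>4 r \<le> 2\<^sup>i\<^sup>+\<^sup>N s\<close>.\<close>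
  define N where "N = 4 + L"
  define b where "b = 2 powr p * D"
  have b: "1 < b"
  proof -
    have "1 < 2 powr p * 1" using p_pos powr_less_mono[of 0 p 2] by simp
    also have "\<dots> \<le> b" unfolding b_def using D_ge_1 by (intro mult_left_mono) auto
    finally show ?thesis .
  qed
  have C_step: "0 < C_step Q"
    unfolding C_step_def using C_deviation_nonneg caccioppoli_const_pos[OF Q]
    by (intro mult_pos_pos add_nonneg_pos) auto
  define \<kappa>0 where "\<kappa>0 = min 1 ((1 / (2 * C_step Q * b)) powr (1 / \<theta>))"
  have \<kappa>0: "0 < \<kappa>0" "\<kappa>0 \<le> 1" using C_step b by (auto simp: \<kappa>0_def)
  have \<kappa>0': "2 * C_step Q * \<kappa>0 powr \<theta> \<le> 1 / b"
  proof -
    have "\<kappa>0 powr \<theta> \<le> ((1 / (2 * C_step Q * b)) powr (1 / \<theta>)) powr \<theta>"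
      using \<theta> \<kappa>0 by (intro powr_mono2) (auto simp: \<kappa>0_def)
    also have "\<dots> = 1 / (2 * C_step Q * b)" using \<theta> C_step b by (simp add: powr_powr)
    finally show ?thesis using C_step b by (simp add: field_simps)
  qed
  define \<kappa> where "\<kappa> = \<kappa>0 / (2 powr p * D ^ N)"
  show ?thesis
  proof (intro exI[of _ \<kappa>] conjI allI impI ballI)
    show "0 < \<kappa>" using \<kappa>0 D_pos by (simp add: \<kappa>_def)
    fix u g z r k H y
    assume *: "quasimin Q u g \<and> 0 < r \<and> 0 < H \<and> excess u k z (2 * r) \<le> \<kappa> * (H powr p * vol z (2 * r))"
      and y: "y \<in> ball z r"
    then have qm: "quasimin Q u g" and r: "0 < r" and H: "0 < H"
      and small: "excess u k z (2 * r) \<le> \<kappa> * (H powr p * vol z (2 * r))" by auto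
    define M where "M = vol z (2 * r)"
    have M: "0 < M" using r by (simp add: M_def vol_pos)
    define R where "R i = r * (1 + (1/2) ^ i)" for i :: nat
    define l where "l i = k + H * (1 - (1/2) ^ i)" for i :: nat
    define Y where "Y i = excess u (l i) z (R i)" for i
    define B where "B = 2 powr p * D ^ N / (H powr p * M)"
    have B: "0 \<le> B" using M D_pos by (simp add: B_def)
    have Y0: "Y 0 = excess u k z (2 * r)" by (simp add: Y_def l_def R_def mult.commute)
    have BY0: "B * Y 0 \<le> \<kappa>0"
    proof -
      have "B * Y 0 \<le> B * (\<kappa> * (H powr p * M))"
        unfolding Y0 M_def by (intro mult_left_mono small) (use B M_def in auto)
      also have "\<dots> = \<kappa>0" using M H D_pos by (simp add: B_def \<kappa>_def)
      finally show ?thesis .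
    qed
    have "Y \<longlonglongrightarrow> 0"
    proof (rule fast_decay[OF _ C_step b B \<theta>(1,2)])
      show "0 \<le> Y i" for i by (simp add: Y_def excess_nonneg)
      show "B * Y 0 \<le> 1" using BY0 \<kappa>0 by simp
      have "2 * C_step Q * (B * Y 0) powr \<theta> \<le> 2 * C_step Q * \<kappa>0 powr \<theta>"
        using BY0 B C_step \<theta> by (intro mult_left_mono powr_mono2) (auto simp: Y_def excess_nonneg)
      then show "2 * C_step Q * (B * Y 0) powr \<theta> \<le> 1 / b" using \<kappa>0' by simp
      fix i
      define s where "s = (R i - R (Suc i)) / (2 * \<Lambda>)"
      have dR: "R i - R (Suc i) = r * (1/2) ^ Suc i" by (simp add: R_def algebra_simps)
      have s0: "0 < s" using r \<Lambda>_pos by (simp add: s_def dR)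
      define m where "m = M / D ^ (i + N)"
      define h where "h = H * (1/2) ^ Suc i"
      have m0: "0 < m" using M D_pos by (simp add: m_def)
      have m_le: "m \<le> vol x s" if x: "x \<in> ball z (R i)" for x
      proof -
        have "R i \<le> 2 * r" using r by (simp add: R_def power_le_one)
        then have sub: "ball z (2 * r) \<subseteq> ball x (4 * r)"
          using x by (intro ball_subsetI) (simp add: dist_commute)
        have "4 * r = 2 ^ (i + 4) * \<Lambda> * s"
          unfolding s_def dR using \<Lambda>_pos by (simp add: power_add power_divide)
        also have "\<dots> \<le> 2 ^ (i + 4) * 2 ^ L * s" using L s0 by (intro mult_right_mono mult_left_mono) auto
        also have "\<dots> = 2 ^ (i + N) * s" by (simp add: N_def power_add)
        finally have "ball x (4 * r) \<subseteq> ball x (2 ^ (i + N) * s)" by (rule subset_ball)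
        then have "M \<le> vol x (2 ^ (i + N) * s)" unfolding M_def using sub by (intro vol_mono) auto
        also have "\<dots> \<le> D ^ (i + N) * vol x s" by (rule vol_double_pow[OF s0])
        finally show ?thesis using D_pos by (simp add: m_def field_simps)
      qed
      have lh: "l (Suc i) = l i + h" by (simp add: l_def h_def algebra_simps)
      have "excess u (l i + h) z (R (Suc i)) \<le> C_step Q * excess u (l i) z (R i) *
        ((excess u (l i) z (R i) / (h powr p * m)) powr \<theta> + excess u (l i) z (R i) / (h powr p * m))"
      proof (rule De_Giorgi_step[OF qm _ _ _ s_def m0 m_le])
        show "0 < R (Suc i)" using r by (simp add: R_def add_pos_pos)
        have "0 < R i - R (Suc i)" unfolding dR using r by simp
        then show "R (Suc i) < R i" by simp
        show "0 < h" using H by (simp add: h_def)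
      qed
      moreover have "Y i / (h powr p * m) = b ^ i * B * Y i"
      proof -
        have "h powr p = H powr p / (2 powr p) ^ Suc i"
        proof -
          have "h powr p = H powr p * ((1/2) ^ Suc i) powr p" unfolding h_def by (rule powr_mult)
          also have "((1/2::real) ^ Suc i) powr p = ((2 powr p) ^ Suc i) powr (- 1)"
          proof -
            have "((1/2::real) ^ Suc i) = 2 powr (- real (Suc i))"
              by (simp add: powr_minus powr_realpow power_one_over inverse_eq_divide del: power_Suc of_nat_Suc)
            then have "((1/2::real) ^ Suc i) powr p = 2 powr (- real (Suc i) * p)" by (simp add: powr_powr)
            moreover have "((2 powr p) ^ Suc i) powr (- 1) = (2::real) powr (- real (Suc i) * p)"
              by (simp add: powr_realpow[symmetric] powr_powr mult.commute powr_minus inverse_eq_divide del: power_Suc of_nat_Suc)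
            ultimately show ?thesis by simp
          qed
          finally show ?thesis by (simp add: powr_minus divide_inverse del: power_Suc)
        qed
        then have "Y i / (h powr p * m) = Y i * ((2 powr p) ^ Suc i * D ^ (i + N)) / (H powr p * M)"
        proof -
          have "y' / (a' / q' * (M' / d')) = y' * (q' * d') / (a' * M')" for y' a' q' M' d' :: real by simp
          then show ?thesis unfolding \<open>h powr p = H powr p / (2 powr p) ^ Suc i\<close> m_def .
        qed
        also have "(2 powr p) ^ Suc i * D ^ (i + N) = b ^ i * (2 powr p * D ^ N)"
          by (simp add: b_def power_add power_mult_distrib mult_ac)
        finally show ?thesis by (simp add: B_def mult_ac)
      qed
      ultimately show "Y (Suc i) \<le> C_step Q * Y i * ((b ^ i * B * Y i) powr \<theta> + b ^ i * B * Y i)"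
        by (simp add: Y_def lh)
    qed
    moreover have "excess u (k + H) z r \<le> Y i" for i
    proof -
      have "r \<le> R i" using r by (simp add: R_def)
      moreover have "l i \<le> k + H" using H by (simp add: l_def)
      ultimately show ?thesis unfolding Y_def by (rule excess_mono[OF qm])
    qed
    ultimately have "excess u (k + H) z r \<le> 0"
      by (intro LIMSEQ_le_const[of Y 0]) auto
    then have zero: "pint (ball z r) (\<lambda>y. ennreal (max 0 (u y - (k + H)))) = 0"
      unfolding excess_pint[OF qm] by (simp add: ennreal_eq_0_iff)
    show "u y \<le> k + H"
    proof (rule ccontr)
      assume "\<not> u y \<le> k + H"
      define e where "e = (u y - (k + H)) / 2"
      have e: "0 < e" using \<open>\<not> u y \<le> k + H\<close> by (simp add: e_def)
      have u: "continuous_on UNIV u" using qm by (simp add: quasimin_def)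
      obtain d where d: "0 < d" "\<And>x. dist x y < d \<Longrightarrow> dist (u x) (u y) < e"
        using u e unfolding continuous_on_iff by (metis UNIV_I)
      define d' where "d' = min d (r - dist z y)"
      have d': "0 < d'" using d y by (simp add: d'_def)
      have "ennreal (e powr p) * emeasure \<mu> (ball y d') \<le> pint (ball z r) (\<lambda>y. ennreal (max 0 (u y - (k + H))))"
      proof (intro Chebyshev conjI ennreal_leI)
        fix x assume x: "x \<in> ball y d'"
        then have "dist x y < d" "x \<in> ball z r"
          using dist_triangle[of z x y] by (auto simp: d'_def dist_commute)
        then show "x \<in> ball z r" by simp
        have "\<bar>u x - u y\<bar> < e" using d(2)[OF \<open>dist x y < d\<close>] by (simp add: dist_real_def)
        moreover have "u y - (k + H) = 2 * e" by (simp add: e_def)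
        ultimately show "e \<le> max 0 (u x - (k + H))" by linarith
      qed (use e in auto)
      then show False using zero e emeasure_ball_pos[OF d', of y] by (simp add: ennreal_eq_0_iff)
    qed
  qed
qed

section \<open>The Poincare inequality with exponent \<open>p\<close> on the left\<close>

text \<open>
  The assumed Poincare inequality only concerns \<open>L\<^sup>1\<close> deviations.  Here \<open>u(x)\<close> is first compared with its
  average over \<open>B(x, 2r)\<close>, by \<open>deviation_pint_le\<close> with \<open>A\<close> the whole ball, and then with the average over
  \<open>B(z, 4r)\<close>.
\<close>
lemma Lp_Poincare:
  "\<exists>C>0. \<forall>u g z r. continuous_on UNIV u \<and> Lp_bounded (\<lambda>x. ennreal \<bar>u x\<bar>) \<and> wug u g \<and> 0 < r \<longrightarrow>
     pint (ball z (2 * r)) (\<lambda>x. ennreal \<bar>u x - avg \<mu> (ball z (4 * r)) u\<bar>)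
       \<le> ennreal (C * r powr p) * pint (ball z (4 * \<Lambda> * r)) g"
proof -
  define K1 where "K1 = C_deviation * 2 powr p * (D ^ 2) powr \<theta>"
  define K2 where "K2 = (D ^ 2 * CP * 4) powr p"
  define C where "C = 2 powr p * (K1 + K2)"
  have K: "0 \<le> K1" "0 < K2"
    unfolding K1_def K2_def using C_deviation_nonneg D_pos CP_pos by (auto intro!: mult_nonneg_nonneg)
  show ?thesis
  proof (intro exI[of _ C] conjI allI impI)
    show "0 < C" using K by (simp add: C_def)
    fix u :: "'a \<Rightarrow> real" and g :: "'a \<Rightarrow> ennreal" and z :: 'a and r :: real
    assume *: "continuous_on UNIV u \<and> Lp_bounded (\<lambda>x. ennreal \<bar>u x\<bar>) \<and> wug u g \<and> 0 < r"
    then have u: "continuous_on UNIV u" and uL: "Lp_bounded (\<lambda>x. ennreal \<bar>u x\<bar>)" and g: "wug u g" and r: "0 < r" by auto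
    have gm[measurable]: "g \<in> borel_measurable \<mu>" using g by (rule wugD_measurable)
    note int = Lp_bounded_set_integrable[OF u uL]
    define c where "c = avg \<mu> (ball z (4 * r)) u"
    define P where "P = pint (ball z (4 * \<Lambda> * r)) g"
    define T where "T = mean_energy g z (4 * \<Lambda> * r)"
    have far: "ennpow (ennreal \<bar>avg \<mu> (ball x (2 * r)) u - c\<bar>) p \<le> ennreal (K2 * r powr p) * T"
      if x: "x \<in> ball z (2 * r)" for x
    proof -
      let ?dev = "avg \<mu> (ball z (4 * r)) (\<lambda>y. \<bar>u y - c\<bar>)"
      have dev0: "0 \<le> ?dev"
        unfolding avg_def set_lebesgue_integral_def by (intro divide_nonneg_nonneg integral_nonneg) auto
      have sub: "ball x (2 * r) \<subseteq> ball z (4 * r)" using x by (intro ball_subsetI) auto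
      have sub2: "ball z (4 * r) \<subseteq> ball x (2 ^ 2 * (2 * r))"
        using x r by (intro ball_subsetI) (auto simp: dist_commute)
      have "vol z (4 * r) \<le> D ^ 2 * vol x (2 * r)"
        using vol_mono[OF sub2] vol_double_pow[of "2 * r" x 2] r by linarith
      then have ratio: "vol z (4 * r) / vol x (2 * r) \<le> D ^ 2"
        using vol_pos[of "2 * r" x] r by (simp add: divide_le_eq)
      have "\<bar>avg \<mu> (ball x (2 * r)) u - c\<bar> \<le> (vol z (4 * r) / vol x (2 * r)) * ?dev"
        by (rule avg_deviation_le[OF int sub]) (use r in simp)
      also have "\<dots> \<le> D ^ 2 * ?dev" by (rule mult_right_mono[OF ratio dev0])
      finally have "ennreal \<bar>avg \<mu> (ball x (2 * r)) u - c\<bar> \<le> ennreal (D ^ 2 * ?dev)" by (rule ennreal_leI)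
      also have "\<dots> = ennreal (D ^ 2) * ennreal ?dev" using dev0 by (intro ennreal_mult) auto
      also have "\<dots> \<le> ennreal (D ^ 2) * (ennreal (CP * (4 * r)) * ennpow T (1 / p))"
        using Poincare[of "4 * r", OF _ int g, of z] r
        unfolding T_def mean_energy_def pint_def c_def by (intro mult_left_mono) (auto simp: mult_ac)
      also have "\<dots> = ennreal (D ^ 2 * CP * 4 * r) * ennpow T (1 / p)"
        using CP_pos r by (simp add: ennreal_mult[symmetric] mult.assoc[symmetric])
      finally have "ennpow (ennreal \<bar>avg \<mu> (ball x (2 * r)) u - c\<bar>) p \<le> ennpow (ennreal (D ^ 2 * CP * 4 * r) * ennpow T (1 / p)) p"
        by (intro ennpow_mono p_pos)
      also have "\<dots> = ennreal (K2 * r powr p) * T"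
        using D_pos CP_pos r by (simp add: ennpow_mult[OF p_pos] ennpow_ennreal ennpow_root'[OF p_pos] K2_def powr_mult)
      finally show ?thesis .
    qed
    let ?A = "ball z (2 * r)"
    have r\<Lambda>: "r \<le> \<Lambda> * r" using \<Lambda>_ge_1 r by (simp add: mult_le_cancel_right1)
    define m where "m = vol z (2 * r) / D ^ 2"
    have m0: "0 < m" using vol_pos[of "2 * r" z] r D_pos by (simp add: m_def)
    have "pint ?A (\<lambda>x. ennreal \<bar>u x - c\<bar>) \<le> ennreal (2 powr p) *
      (ennreal (C_deviation * (2 * r) powr p * (measure \<mu> ?A / m) powr \<theta>) * pint (ball z (4 * \<Lambda> * r)) g + ennreal (K2 * r powr p) * T * emeasure \<mu> ?A)"
    proof (rule deviation_pint_le[OF u uL g _ _ subset_refl _ m0 _ ennreal_abs_triangle far])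
      show "2 * r + \<Lambda> * (2 * r) \<le> 4 * \<Lambda> * r" using r\<Lambda> by simp
      fix y assume y: "y \<in> ball z (4 * \<Lambda> * r)"
      have "dist z y < 4 * (\<Lambda> * r)" using y by (simp add: mult.assoc)
      then have "dist y z + 2 * r \<le> 8 * (\<Lambda> * r)" using r\<Lambda> r dist_commute[of y z] by linarith
      then have "ball z (2 * r) \<subseteq> ball y (2 ^ 2 * (\<Lambda> * (2 * r)))" by (intro ball_subsetI) simp
      then have "vol z (2 * r) \<le> D ^ 2 * vol y (\<Lambda> * (2 * r))"
        using vol_mono[of z "2 * r" y "2 ^ 2 * (\<Lambda> * (2 * r))"] vol_double_pow[of "\<Lambda> * (2 * r)" y 2] r \<Lambda>_pos
        by (meson mult_pos_pos order_trans zero_less_numeral)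
      then show "m \<le> vol y (\<Lambda> * (2 * r))" using D_pos by (simp add: m_def field_simps)
    qed (use r in auto)
    also have "measure \<mu> ?A / m = D ^ 2" using vol_pos[of "2 * r" z] r by (simp add: m_def)
    also have "C_deviation * (2 * r) powr p * (D ^ 2) powr \<theta> = K1 * r powr p"
      unfolding K1_def powr_mult by (simp only: mult_ac)
    also have "ennreal (2 powr p) * (ennreal (K1 * r powr p) * pint (ball z (4 * \<Lambda> * r)) g + ennreal (K2 * r powr p) * T * emeasure \<mu> ?A)
      \<le> ennreal (2 powr p) * (ennreal (K1 * r powr p) * P + ennreal (K2 * r powr p) * P)"
    proof (intro mult_left_mono add_mono)
      have "?A \<subseteq> ball z (4 * \<Lambda> * r)" using r r\<Lambda> by (intro subset_ball) simp
      then have "emeasure \<mu> ?A \<le> emeasure \<mu> (ball z (4 * \<Lambda> * r))" by (intro emeasure_mono) auto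
      then have "T * emeasure \<mu> ?A \<le> T * emeasure \<mu> (ball z (4 * \<Lambda> * r))" by (rule mult_left_mono) simp
      also have "\<dots> = P"
        unfolding T_def mean_energy_def P_def
        using emeasure_ball_pos[of "4 * \<Lambda> * r" z] emeasure_ball_finite[of z "4 * \<Lambda> * r"] r \<Lambda>_pos
        by (subst ennreal_divide_times) (simp add: ennreal_divide_self less_top)
      finally show "ennreal (K2 * r powr p) * T * emeasure \<mu> ?A \<le> ennreal (K2 * r powr p) * P"
        by (simp add: mult.assoc mult_left_mono)
    qed (auto simp: P_def)
    also have "\<dots> = ennreal (2 powr p) * (ennreal ((K1 + K2) * r powr p) * P)"
      using K by (simp add: distrib_right ennreal_plus)
    also have "\<dots> = ennreal (C * r powr p) * P"
      using K by (simp add: C_def ennreal_mult mult.assoc)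
    finally show "pint (ball z (2 * r)) (\<lambda>x. ennreal \<bar>u x - avg \<mu> (ball z (4 * r)) u\<bar>)
       \<le> ennreal (C * r powr p) * pint (ball z (4 * \<Lambda> * r)) g" by (simp add: c_def P_def)
  qed
qed

end

section \<open>Growth of the energy\<close>

context poincare_setting begin

text \<open>
  If \<open>r\<close> is so large that \<open>B(z, r)\<close> contains points \<open>a\<close> and \<open>b\<close> with \<open>|u(a) - u(b)| = 3 H > 0\<close>, then \<open>u\<close> cannot
  stay within \<open>H\<close> of a constant on \<open>B(z, r)\<close>.  So the smallness assumption of \<open>local_boundedness\<close> must
  fail for \<open>u\<close> or for \<open>-u\<close>, and by \<open>Lp_Poincare\<close> this is only possible if the energy is large.
\<close>
theorem energy_lower_bound:
  assumes qm: "quasimin Q u g" and nc: "\<not> u constant_on UNIV"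
  shows "\<exists>c>0. \<exists>R0>0. \<forall>R\<ge>R0. ennreal (c * vol z R * R powr (- p)) \<le> pint (ball z R) g"
proof -
  have u: "continuous_on UNIV u" and g: "wug u g" "Lp_bounded g" and uL: "Lp_bounded (\<lambda>x. ennreal \<bar>u x\<bar>)" and Q: "1 \<le> Q"
    using qm by (auto simp: quasimin_def)
  obtain a b where ab: "u a \<noteq> u b" using nc by (auto simp: constant_on_def) (metis)
  define H where "H = \<bar>u a - u b\<bar> / 3"
  have H: "0 < H" using ab by (simp add: H_def)
  obtain \<kappa> where \<kappa>: "0 < \<kappa>" "\<And>u g z r k H. quasimin Q u g \<Longrightarrow> 0 < r \<Longrightarrow> 0 < H \<Longrightarrow>
      excess u k z (2 * r) \<le> \<kappa> * (H powr p * vol z (2 * r)) \<Longrightarrow> (\<forall>y\<in>ball z r. u y \<le> k + H)"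
    using local_boundedness[OF Q] by blast
  obtain C where C: "0 < C" "\<And>r. 0 < r \<Longrightarrow>
     pint (ball z (2 * r)) (\<lambda>x. ennreal \<bar>u x - avg \<mu> (ball z (4 * r)) u\<bar>)
       \<le> ennreal (C * r powr p) * pint (ball z (4 * \<Lambda> * r)) g"
    using Lp_Poincare u uL g(1) by blast
  obtain n :: nat where n: "2 * \<Lambda> \<le> 2 ^ n" using real_arch_pow[of 2 "2 * \<Lambda>"] by (auto intro: less_imp_le)
  define r0 where "r0 = max (dist z a) (dist z b) + 1"
  have r0: "0 < r0"
    unfolding r0_def using zero_le_dist[of z a] max.cobounded1[of "dist z a" "dist z b"] by linarith
  define c where "c = \<kappa> * H powr p * (4 * \<Lambda>) powr p / (C * D ^ n)"
  have key: "ennreal (\<kappa> * (H powr p * vol z (2 * r))) < ennreal (C * r powr p) * pint (ball z (4 * \<Lambda> * r)) g"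
    if r: "r0 \<le> r" for r
  proof (rule ccontr)
    have rpos: "0 < r" using r r0 by simp 
    let ?c = "avg \<mu> (ball z (4 * r)) u"
    assume "\<not> ?thesis"
    then have small: "pint (ball z (2 * r)) (\<lambda>x. ennreal \<bar>u x - ?c\<bar>) \<le> ennreal (\<kappa> * (H powr p * vol z (2 * r)))"
      using C(2)[OF rpos] by simp
    have exc: "excess w k z (2 * r) \<le> \<kappa> * (H powr p * vol z (2 * r))"
      if "quasimin Q w g" "\<And>x. max 0 (w x - k) \<le> \<bar>u x - ?c\<bar>" for w k
    proof -
      have "ennreal (excess w k z (2 * r)) = pint (ball z (2 * r)) (\<lambda>y. ennreal (max 0 (w y - k)))"
        by (rule excess_pint[OF that(1), symmetric])
      also have "\<dots> \<le> pint (ball z (2 * r)) (\<lambda>x. ennreal \<bar>u x - ?c\<bar>)"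
        by (intro pint_mono conjI ennreal_leI that(2))
      also note small
      finally show ?thesis using \<kappa>(1) by (subst (asm) ennreal_le_iff) auto
    qed
    have "\<forall>y\<in>ball z r. u y \<le> ?c + H"
      by (rule \<kappa>(2)[OF qm rpos H exc[OF qm]]) auto
    moreover have "\<forall>y\<in>ball z r. - u y \<le> - ?c + H"
      by (rule \<kappa>(2)[OF quasimin_uminus[OF qm] rpos H exc[OF quasimin_uminus[OF qm]]]) auto
    moreover have "a \<in> ball z r" "b \<in> ball z r" using r by (auto simp: r0_def)
    ultimately have "u a \<le> ?c + H" "u b \<le> ?c + H" "?c - H \<le> u a" "?c - H \<le> u b" by fastforce+
    then have "\<bar>u a - u b\<bar> \<le> 2 * H" by linarith
    then show False using H by (simp add: H_def)
  qed
  have "0 < c" using \<kappa>(1) H C(1) D_pos \<Lambda>_pos by (simp add: c_def)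
    moreover have "0 < 4 * \<Lambda> * r0" using r0 \<Lambda>_pos by simp
  moreover have "ennreal (c * vol z R * R powr (- p)) \<le> pint (ball z R) g" if R: "4 * \<Lambda> * r0 \<le> R" for R
  proof -
    define r where "r = R / (4 * \<Lambda>)"
    have r: "r0 \<le> r" "R = 4 * \<Lambda> * r" using R \<Lambda>_pos by (auto simp: r_def field_simps)
    have rpos: "0 < r" using r0 r by simp
    have "2 * \<Lambda> * (2 * r) \<le> 2 ^ n * (2 * r)" using n rpos by (intro mult_right_mono) auto
    then have "R \<le> 2 ^ n * (2 * r)" using r by simp
    then have "vol z R \<le> vol z (2 ^ n * (2 * r))" by (intro vol_mono subset_ball)
    also have "\<dots> \<le> D ^ n * vol z (2 * r)" using rpos by (intro vol_double_pow) auto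
    finally have vR: "vol z R \<le> D ^ n * vol z (2 * r)" .
    have "c * vol z R * R powr (- p) \<le> c * (D ^ n * vol z (2 * r)) * R powr (- p)"
      using vR \<open>0 < c\<close> by (intro mult_right_mono mult_left_mono) auto
    also have "\<dots> = \<kappa> * (H powr p * vol z (2 * r)) / (C * r powr p)"
    proof -
      have "R powr (- p) = 1 / ((4 * \<Lambda>) powr p * r powr p)"
        unfolding r(2) using \<Lambda>_pos rpos by (simp add: powr_mult powr_minus inverse_eq_divide)
      then show ?thesis using D_pos \<Lambda>_pos by (simp add: c_def)
    qed
    finally have "ennreal (c * vol z R * R powr (- p)) \<le> ennreal (\<kappa> * (H powr p * vol z (2 * r)) / (C * r powr p))"
      by (rule ennreal_leI)
    also have "\<dots> \<le> pint (ball z R) g"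
    proof -
      have Cr: "0 < C * r powr p" using C(1) rpos by simp
      define P where "P = enn2real (pint (ball z R) g)"
      have P: "pint (ball z R) g = ennreal P" "0 \<le> P" using g(2) by (auto simp: P_def Lp_bounded_def)
      have "ennreal (\<kappa> * (H powr p * vol z (2 * r))) \<le> ennreal (C * r powr p) * ennreal P"
        using key[OF r(1)] unfolding r(2)[symmetric] P by simp
      also have "\<dots> = ennreal (C * r powr p * P)" using Cr P by (intro ennreal_mult[symmetric]) auto
      finally have "\<kappa> * (H powr p * vol z (2 * r)) \<le> C * r powr p * P"
        using Cr P by (subst (asm) ennreal_le_iff) auto
      then have "\<kappa> * (H powr p * vol z (2 * r)) / (C * r powr p) \<le> P"
        using Cr by (simp add: pos_divide_le_eq mult.commute)
      then show ?thesis unfolding P(1) by (rule ennreal_leI)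
    qed
    finally show ?thesis .
  qed
  ultimately show ?thesis by blast
qed

end

theorem corollary4p2:
  fixes \<mu> :: "'a::metric_space measure" and p \<alpha> :: real and x0 :: 'a and u :: "'a \<Rightarrow> real"
  assumes "1 < p"
    and "metric_measure \<mu>"
    and "\<not> bounded (UNIV :: 'a set)"
    and "globally_doubling \<mu>"
    and "global_Poincare p \<mu>"
    and "quasiharmonic p \<mu> u"
    and "\<not> u constant_on UNIV"
    and "p < \<alpha>"
  shows "(0 < Limsup at_top (\<lambda>r. ereal (measure \<mu> (ball x0 r) / r powr \<alpha>)) \<longrightarrow>
           (\<exists>C>0. \<exists>R :: nat \<Rightarrow> real. (\<forall>j. 0 < R j) \<and> filterlim R at_top sequentially \<and>
              (\<forall>j. ennreal (C * R j powr (\<alpha> - p)) \<le> energy p \<mu> u (ball x0 (R j)))))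
       \<and> (0 < Liminf at_top (\<lambda>r. ereal (measure \<mu> (ball x0 r) / r powr \<alpha>)) \<longrightarrow>
           (\<exists>C>0. eventually (\<lambda>r. ennreal (C * r powr (\<alpha> - p)) \<le> energy p \<mu> u (ball x0 r)) at_top))"
proof -
  interpret newtonian_setting \<mu> p by standard (rule assms)+
  obtain D where D: "0 < D" "\<And>x r. 0 < r \<Longrightarrow> emeasure \<mu> (ball x (2 * r)) \<le> ennreal D * emeasure \<mu> (ball x r)"
    using assms(4) unfolding globally_doubling_def by blast
  obtain CP \<Lambda> where P: "0 < CP" "1 \<le> \<Lambda>" "\<And>x r u g. 0 < r \<Longrightarrow> set_integrable \<mu> (ball x (\<Lambda> * r)) u \<Longrightarrow> wug u g \<Longrightarrow>
        ennreal (avg \<mu> (ball x r) (\<lambda>y. \<bar>u y - avg \<mu> (ball x r) u\<bar>))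
          \<le> ennreal (CP * r) * ennpow ((\<integral>\<^sup>+y\<in>ball x (\<Lambda> * r). ennpow (g y) p \<partial>\<mu>)
                       / emeasure \<mu> (ball x (\<Lambda> * r))) (1 / p)"
    using assms(5) unfolding global_Poincare_def by blast
  interpret poincare_setting \<mu> p D CP \<Lambda> by standard (use D P in auto)
  obtain Q where "quasimin Q u (minimal_wug p \<mu> (\<lambda>x. ereal (u x)))"
    by (rule quasiharmonic_imp_quasimin[OF assms(6)])
  from energy_lower_bound[OF this assms(7), of x0]
  obtain c R0 where c: "0 < c" and R0: "0 < R0"
    and energy: "\<And>R. R0 \<le> R \<Longrightarrow> ennreal (c * measure \<mu> (ball x0 R) * R powr (- p)) \<le> energy p \<mu> u (ball x0 R)"
    unfolding energy_def pint_def by blast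
  define f where "f r = measure \<mu> (ball x0 r) / r powr \<alpha>" for r
  have lower: "ennreal (c * L * R powr (\<alpha> - p)) \<le> energy p \<mu> u (ball x0 R)"
    if R: "R0 \<le> R" and L: "L < f R" for R L
  proof -
    have "0 < R" using R R0 by simp
    have "L * R powr \<alpha> \<le> measure \<mu> (ball x0 R)"
      using L \<open>0 < R\<close> by (simp add: f_def pos_less_divide_eq less_imp_le)
    then have "c * (L * R powr \<alpha>) * R powr (- p) \<le> c * measure \<mu> (ball x0 R) * R powr (- p)"
      using c by (intro mult_right_mono mult_left_mono) auto
    moreover have "c * (L * R powr \<alpha>) * R powr (- p) = c * L * R powr (\<alpha> - p)"
      by (simp add: powr_add[symmetric] mult.assoc)
    ultimately show ?thesis using energy[OF R] by (metis ennreal_leI order_trans)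
  qed
  have pos_real: "\<exists>L>0. ereal L < x" if "0 < x" for x :: ereal
    using ereal_dense2[OF that] by (metis ereal_less(2))
  show ?thesis
  proof (intro conjI impI)
    assume "0 < Limsup at_top (\<lambda>r. ereal (measure \<mu> (ball x0 r) / r powr \<alpha>))"
    then obtain L where L: "0 < L" "ereal L < Limsup at_top (\<lambda>r. ereal (f r))"
      unfolding f_def using pos_real by blast
    have "\<exists>R\<ge>N. L < f R" for N
    proof (rule ccontr)
      assume "\<not> (\<exists>R\<ge>N. L < f R)"
      then have "eventually (\<lambda>r. ereal (f r) \<le> ereal L) at_top"
        unfolding eventually_at_top_linorder by (intro exI[of _ N]) (auto simp: not_less)
      then have "Limsup at_top (\<lambda>r. ereal (f r)) \<le> ereal L" by (rule Limsup_bounded)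
      then show False using L by simp
    qed
    then have "\<forall>j. \<exists>R\<ge>max R0 (real j). L < f R" by blast
    then obtain R where R: "\<And>j. max R0 (real j) \<le> R j" "\<And>j. L < f (R j)" by metis
    have "filterlim R at_top sequentially"
      by (rule filterlim_at_top_mono[OF filterlim_real_sequentially]) (use R(1) in auto)
    moreover have "0 < R j" for j using R(1)[of j] R0 by simp
    moreover have "ennreal (c * L * R j powr (\<alpha> - p)) \<le> energy p \<mu> u (ball x0 (R j))" for j
      using R by (intro lower) auto
    ultimately show "\<exists>C>0. \<exists>R :: nat \<Rightarrow> real. (\<forall>j. 0 < R j) \<and> filterlim R at_top sequentially \<and>
              (\<forall>j. ennreal (C * R j powr (\<alpha> - p)) \<le> energy p \<mu> u (ball x0 (R j)))"
      using c L(1) by (intro exI[of _ "c * L"] conjI exI[of _ R]) auto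
  next
    assume "0 < Liminf at_top (\<lambda>r. ereal (measure \<mu> (ball x0 r) / r powr \<alpha>))"
    then obtain L where L: "0 < L" "ereal L < Liminf at_top (\<lambda>r. ereal (f r))"
      unfolding f_def using pos_real by blast
    have "eventually (\<lambda>r. ereal L < ereal (f r)) at_top" using less_LiminfD[OF L(2)] .
    then have "eventually (\<lambda>r. ennreal (c * L * r powr (\<alpha> - p)) \<le> energy p \<mu> u (ball x0 r)) at_top"
      using eventually_ge_at_top[of R0] by eventually_elim (auto intro: lower)
    then show "\<exists>C>0. eventually (\<lambda>r. ennreal (C * r powr (\<alpha> - p)) \<le> energy p \<mu> u (ball x0 r)) at_top"
      using c L(1) by (intro exI[of _ "c * L"]) auto
  qed
qed

end
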